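(* There exists a polynomial time rounding algorithm that, given a feasible solution $(x^*,y^* )$ to $\operatorname{SC-LP}(T,k)$ and any $\varepsilon\in(0,1)$, outputs an integral $(O(1/\varepsilon^2),\,1+\varepsilon)$-approximate solution to $\operatorname{SC-LP}(T,k)$ (the constant in $O(\cdot)$ being absolute).
   Context: Let $F$ (facilities) and $C$ (clients) be finite sets, $(F\cup C,d)$ a finite metric space, $T>0$ and $k>0$. The polytope $\operatorname{SC-LP}(T,k)$ consists of vectors $(x,y)$, $x=(x_{ij})_{i\in F,j\in C}$, $y=(y_i)_{i\in F}$, satisfying: $\sum_{j\in C}d(i,j)x_{ij}\le T y_i$ for all $i\in F$; $\sum_{i\in F}y_i\le k$; $\sum_{i\in F}x_{ij}=1$ for all $j\in C$; $x_{ij}\le y_i$ for all $i,j$; $y_i\in[0,1]$, $x_{ij}\in[0,1]$ for all $i,j$; and $x_{ij}=0$ whenever $d(i,j)>T$. For an assignment $x$ and $i\in F$, the fractional load is $L(i,x):=\sum_{j\in C}d(i,j)x_{ij}$. A solution $(x,y)$ (with $x_{ij},y_i\in[0,1]$, $\sum_{i}x_{ij}=1$ for all $j$, and $x_{ij}\le y_i$, but not necessarily satisfying the load and cardinality constraints) is called $(\alpha,\beta)$-approximate if $L(i,x)\le\alpha T y_i$ for every $i\in F$ and $\sum_{i\in F}y_i\le\beta k$. It is integral if all $x_{ij},y_i\in\{0,1\}$. *)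

theory Defs
  imports
    "HOL-Analysis.Analysis"
    "HOL-Computational_Algebra.Polynomial"
    "HOL-Library.Log_Nat"
begin

section \<open>The polytope and approximate solutions\<close>

definition load :: "'p set \<Rightarrow> ('p \<Rightarrow> 'p \<Rightarrow> real) \<Rightarrow> ('p \<Rightarrow> 'p \<Rightarrow> real) \<Rightarrow> 'p \<Rightarrow> real" where
  "load C d x i = (\<Sum>j\<in>C. d i j * x i j)"

text \<open>The constraints shared by the polytope and by approximate solutions. Only the values of
  \<open>x\<close> on \<open>F \<times> C\<close> and of \<open>y\<close> on \<open>F\<close> are constrained.\<close>

definition fractional_assignment ::
  "'p set \<Rightarrow> 'p set \<Rightarrow> ('p \<Rightarrow> 'p \<Rightarrow> real) \<Rightarrow> ('p \<Rightarrow> real) \<Rightarrow> bool" where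
  "fractional_assignment F C x y \<longleftrightarrow>
     (\<forall>j\<in>C. (\<Sum>i\<in>F. x i j) = 1) \<and>
     (\<forall>i\<in>F. \<forall>j\<in>C. x i j \<le> y i) \<and>
     (\<forall>i\<in>F. 0 \<le> y i \<and> y i \<le> 1) \<and>
     (\<forall>i\<in>F. \<forall>j\<in>C. 0 \<le> x i j \<and> x i j \<le> 1)"

definition SC_LP ::
  "'p set \<Rightarrow> 'p set \<Rightarrow> ('p \<Rightarrow> 'p \<Rightarrow> real) \<Rightarrow> real \<Rightarrow> real \<Rightarrow> (('p \<Rightarrow> 'p \<Rightarrow> real) \<times> ('p \<Rightarrow> real)) set" where
  "SC_LP F C d T k = {(x, y).
     (\<forall>i\<in>F. (\<Sum>j\<in>C. d i j * x i j) \<le> T * y i) \<and>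
     (\<Sum>i\<in>F. y i) \<le> k \<and>
     fractional_assignment F C x y \<and>
     (\<forall>i\<in>F. \<forall>j\<in>C. d i j > T \<longrightarrow> x i j = 0)}"

definition approximate_solution ::
  "'p set \<Rightarrow> 'p set \<Rightarrow> ('p \<Rightarrow> 'p \<Rightarrow> real) \<Rightarrow> real \<Rightarrow> real \<Rightarrow> real \<Rightarrow> real
    \<Rightarrow> ('p \<Rightarrow> 'p \<Rightarrow> real) \<Rightarrow> ('p \<Rightarrow> real) \<Rightarrow> bool" where
  "approximate_solution F C d T k \<alpha> \<beta> x y \<longleftrightarrow>
     fractional_assignment F C x y \<and>
     (\<forall>i\<in>F. load C d x i \<le> \<alpha> * T * y i) \<and>
     (\<Sum>i\<in>F. y i) \<le> \<beta> * k"

definition integral_solution ::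
  "'p set \<Rightarrow> 'p set \<Rightarrow> ('p \<Rightarrow> 'p \<Rightarrow> real) \<Rightarrow> ('p \<Rightarrow> real) \<Rightarrow> bool" where
  "integral_solution F C x y \<longleftrightarrow>
     (\<forall>i\<in>F. \<forall>j\<in>C. x i j \<in> {0, 1}) \<and> (\<forall>i\<in>F. y i \<in> {0, 1})"


section \<open>A machine model with logarithmic cost\<close>

text \<open>
  Algorithms are programs of a random access machine under the logarithmic cost criterion, written
  as while-programs. The memory consists of arrays, named by numbers fixed in the program text, of
  unbounded length, with rational entries. Every evaluation of an expression is charged the bit
  lengths of all values that occur in it (operands, array indices, and results), so the cost of a
  run is polynomially related to the running time of a Turing machine that stores rationals as
  reduced fractions in binary.
\<close>

type_synonym memory = "nat \<Rightarrow> nat \<Rightarrow> rat"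

definition rat_size :: "rat \<Rightarrow> nat" where
  "rat_size r = (let (p, q) = quotient_of r in 1 + nat (bitlen \<bar>p\<bar>) + nat (bitlen q))"

text \<open>An index expression denotes a cell through its integral part, negative values
  denoting cell 0; division by zero yields 0.\<close>

datatype aexp =
    Const rat
  | Read nat aexp
  | Plus aexp aexp
  | Minus aexp aexp
  | Times aexp aexp
  | Divide aexp aexp
  | Floor aexp

fun aval :: "aexp \<Rightarrow> memory \<Rightarrow> rat" where
  "aval (Const c) s = c"
| "aval (Read a e) s = s a (nat \<lfloor>aval e s\<rfloor>)"
| "aval (Plus e f) s = aval e s + aval f s"
| "aval (Minus e f) s = aval e s - aval f s"
| "aval (Times e f) s = aval e s * aval f s"
| "aval (Divide e f) s = aval e s / aval f s"
| "aval (Floor e) s = of_int \<lfloor>aval e s\<rfloor>"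

fun acost :: "aexp \<Rightarrow> memory \<Rightarrow> nat" where
  "acost (Const c) s = rat_size c"
| "acost (Read a e) s = acost e s + rat_size (aval (Read a e) s)"
| "acost (Plus e f) s = acost e s + acost f s + rat_size (aval (Plus e f) s)"
| "acost (Minus e f) s = acost e s + acost f s + rat_size (aval (Minus e f) s)"
| "acost (Times e f) s = acost e s + acost f s + rat_size (aval (Times e f) s)"
| "acost (Divide e f) s = acost e s + acost f s + rat_size (aval (Divide e f) s)"
| "acost (Floor e) s = acost e s + rat_size (aval (Floor e) s)"

datatype bexp = Less aexp aexp | Neg bexp | Conj bexp bexp

fun bval :: "bexp \<Rightarrow> memory \<Rightarrow> bool" where
  "bval (Less e f) s \<longleftrightarrow> aval e s < aval f s"
| "bval (Neg b) s \<longleftrightarrow> \<not> bval b s"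
| "bval (Conj b c) s \<longleftrightarrow> bval b s \<and> bval c s"

fun bcost :: "bexp \<Rightarrow> memory \<Rightarrow> nat" where
  "bcost (Less e f) s = 1 + acost e s + acost f s"
| "bcost (Neg b) s = 1 + bcost b s"
| "bcost (Conj b c) s = 1 + bcost b s + bcost c s"

datatype com =
    Skip
  | Write nat aexp aexp
  | Seq com com
  | Cond bexp com com
  | While bexp com

text \<open>\<open>exec c s t s'\<close>: started in memory \<open>s\<close>, the program \<open>c\<close> halts in memory \<open>s'\<close> at cost \<open>t\<close>.\<close>

inductive exec :: "com \<Rightarrow> memory \<Rightarrow> nat \<Rightarrow> memory \<Rightarrow> bool" where
  Skip: "exec Skip s 1 s"
| Write: "exec (Write a e f) s (1 + acost e s + acost f s)
            (s(a := (s a)(nat \<lfloor>aval e s\<rfloor> := aval f s)))"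
| Seq: "\<lbrakk>exec c s t s'; exec c' s' t' s''\<rbrakk> \<Longrightarrow> exec (Seq c c') s (1 + t + t') s''"
| CondTrue: "\<lbrakk>bval b s; exec c s t s'\<rbrakk> \<Longrightarrow> exec (Cond b c c') s (1 + bcost b s + t) s'"
| CondFalse: "\<lbrakk>\<not> bval b s; exec c' s t s'\<rbrakk> \<Longrightarrow> exec (Cond b c c') s (1 + bcost b s + t) s'"
| WhileFalse: "\<not> bval b s \<Longrightarrow> exec (While b c) s (1 + bcost b s) s"
| WhileTrue: "\<lbrakk>bval b s; exec c s t s'; exec (While b c) s' t' s''\<rbrakk>
    \<Longrightarrow> exec (While b c) s (1 + bcost b s + t + t') s''"

inductive_cases exec_SkipE: "exec Skip s t s'"
inductive_cases exec_WriteE: "exec (Write a e f) s t s'"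
inductive_cases exec_SeqE: "exec (Seq c c') s t s'"
inductive_cases exec_CondE: "exec (Cond b c c') s t s'"
inductive_cases exec_WhileE: "exec (While b c) s t s'"

lemma exec_deterministic:
  assumes "exec c s t s'" and "exec c s u s''"
  shows "t = u \<and> s' = s''"
  using assms
proof (induction arbitrary: u s'' rule: exec.induct)
  case (Skip s)
  then show ?case by (rule exec_SkipE) simp
next
  case (Write a e f s)
  then show ?case by (rule exec_WriteE) simp
next
  case (Seq c s t s' c' t' s3)
  from Seq.prems show ?case
    by (rule exec_SeqE) (auto dest!: Seq.IH)
next
  case (CondTrue b s c t s' c')
  from CondTrue.prems show ?case
    by (rule exec_CondE) (use CondTrue.hyps(1) in \<open>auto dest!: CondTrue.IH\<close>)
next
  case (CondFalse b s c' t s' c)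
  from CondFalse.prems show ?case
    by (rule exec_CondE) (use CondFalse.hyps(1) in \<open>auto dest!: CondFalse.IH\<close>)
next
  case (WhileFalse b s c)
  from WhileFalse.prems show ?case
    by (rule exec_WhileE) (use WhileFalse.hyps in simp_all)
next
  case (WhileTrue b s c t s' t' s3)
  from WhileTrue.prems show ?case
    by (rule exec_WhileE) (use WhileTrue.hyps(1) in \<open>auto dest!: WhileTrue.IH\<close>)
qed

definition initial_memory :: "rat list \<Rightarrow> memory" where
  "initial_memory inp = (\<lambda>a i. if a = 0 \<and> i < length inp then inp ! i else 0)"

definition input_size :: "rat list \<Rightarrow> nat" where
  "input_size inp = (\<Sum>r\<leftarrow>inp. rat_size r)"

text \<open>The input is given in array 0; the first \<open>l\<close> cells of array 1 hold the output.\<close>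

definition runs_in_time :: "com \<Rightarrow> rat list \<Rightarrow> nat \<Rightarrow> nat \<Rightarrow> rat list \<Rightarrow> bool" where
  "runs_in_time P inp t l out \<longleftrightarrow>
     (\<exists>t' \<le> t. \<exists>s. exec P (initial_memory inp) t' s \<and> out = map (s 1) [0..<l])"


section \<open>Encoding of instances and solutions\<close>

text \<open>The lists \<open>fs\<close> and \<open>cs\<close> enumerate the facilities and clients. Names of points are not part of
  the input: a point occurs only through its positions in \<open>fs @ cs\<close>.\<close>

definition solution_data ::
  "'p list \<Rightarrow> 'p list \<Rightarrow> ('p \<Rightarrow> 'p \<Rightarrow> real) \<Rightarrow> ('p \<Rightarrow> real) \<Rightarrow> real list" where
  "solution_data fs cs x y = map y fs @ [x i j. i \<leftarrow> fs, j \<leftarrow> cs]"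

definition instance_data ::
  "'p list \<Rightarrow> 'p list \<Rightarrow> ('p \<Rightarrow> 'p \<Rightarrow> real) \<Rightarrow> real \<Rightarrow> real
    \<Rightarrow> ('p \<Rightarrow> 'p \<Rightarrow> real) \<Rightarrow> ('p \<Rightarrow> real) \<Rightarrow> real \<Rightarrow> real list" where
  "instance_data fs cs d T k x y \<epsilon> =
     [real (length fs), real (length cs), T, k, \<epsilon>]
     @ [d p q. p \<leftarrow> fs @ cs, q \<leftarrow> fs @ cs] @ solution_data fs cs x y"

end

theory Submission
  imports Defs
begin

text \<open>
  Write \<open>\<delta> = \<epsilon>/3\<close>. Let \<open>radius i\<close> be the least radius whose ball around the facility \<open>i\<close> has
  \<open>y\<close>-mass at least \<open>1 - \<delta>\<close>, and discard every assignment \<open>x\<^sub>i\<^sub>j\<close> with \<open>2 d(i,j) < radius i\<close>; each client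
  keeps mass \<open>\<delta>\<close>. Every remaining client of \<open>i\<close> can be moved to any facility within \<open>2 radius i\<close> of \<open>i\<close>
  while its distance grows by a factor of at most 5. Facilities are clustered greedily by increasing radius: \<open>i\<close> joins a
  cluster of mass below \<open>1/\<delta>\<close> with a centre within \<open>2 radius i\<close>, or else becomes a centre. At most
  \<open>\<delta> k\<close> clusters reach mass \<open>1/\<delta>\<close>, and the centres of the others have disjoint balls, so
  at most \<open>(\<delta> + 1/(1 - \<delta>)) k\<close> facilities open. Their fractional loads are \<open>O(T/\<delta>)\<close>, and
  \<open>O(T/\<delta>\<^sup>2)\<close> after scaling all client masses up to 1.

  To round the assignment, the clients at a centre are split into boxes by the dyadic scale of their
  distance, and a box may exceed its fractional mass by less than one client. A matching of clients to
  boxes is found by an auction with integral prices. For the running time it suffices that all loops have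
  polynomially many iterations and that all memory cells keep polynomial size.
\<close>

section \<open>Sizes of rationals and resource bounds for programs\<close>

text \<open>Dropping assignments that are short compared with the radius is what makes clients
  movable: the detour of a remaining client is proportional to a distance that it pays anyway. The
  order by increasing radius gives older centres the smaller radii, so a distance above twice the
  new radius separates both balls. The cap on the mass of a cluster bounds the load of its centre.
  Boxes are needed because a client placed in a slot may be farther away than the clients whose
  fractions pay for it. Inside a dyadic box all distances agree up to a factor 2, and the unpaid
  clients, fewer than one per box beyond the paid ones, cost only a geometric series. Integral
  prices give the auction a potential that is polynomial in the numbers of clients and boxes,
  whatever the magnitudes in the input. As rationals are charged by bit length, exact arithmetic
  must not blow up. All stored numbers are integer multiples of \<open>1 / Q\<close> for one common
  denominator \<open>Q\<close> of the input; products of fractions occur only inside tests and are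
  never stored.\<close>

lemma nat_bitlen_le_iff: "nat (bitlen a) \<le> w \<longleftrightarrow> a < 2 ^ w"
  using bitlen_le_iff_power[of a "int w"] bitlen_nonneg[of a] by (auto simp: nat_le_iff)

lemma less_power_nat_bitlen: "a < 2 ^ nat (bitlen a)"
  using nat_bitlen_le_iff by blast

lemma nat_bitlen_mono: "a \<le> b \<Longrightarrow> nat (bitlen a) \<le> nat (bitlen b)"
  unfolding nat_bitlen_le_iff using less_power_nat_bitlen[of b] by linarith

lemma nat_bitlen_mult:
  assumes "0 \<le> a" "0 \<le> b"
  shows "nat (bitlen (a * b)) \<le> nat (bitlen a) + nat (bitlen b)"
  unfolding nat_bitlen_le_iff power_add
  using assms by (intro mult_strict_mono' less_power_nat_bitlen)

text \<open>\<open>quotient_of\<close> yields the reduced fraction, and cancelling can only shrink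
  numerator and denominator. Any convenient unreduced fraction therefore gives an upper
  bound.\<close>

lemma rat_size_quotient:
  assumes r: "r = of_int a / of_int b" and b: "b \<noteq> 0"
  shows "rat_size r \<le> 1 + nat (bitlen \<bar>a\<bar>) + nat (bitlen \<bar>b\<bar>)"
proof -
  obtain p q where pq: "quotient_of r = (p, q)" by force
  have q: "q > 0" and cop: "coprime p q" and r': "r = of_int p / of_int q"
    using quotient_of_denom_pos[OF pq] quotient_of_coprime[OF pq] quotient_of_div[OF pq] by auto
  have "of_int a / of_int b = (of_int p / of_int q :: rat)" using r r' by simp
  then have "(of_int (a * q) :: rat) = of_int (p * b)" using b q by (simp add: field_simps)
  then have eq: "a * q = p * b" by (simp only: of_int_eq_iff)
  then have "q dvd b" using cop by (metis coprime_commute coprime_dvd_mult_right_iff dvd_triv_right)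
  then obtain g where g: "b = q * g" by auto
  have "a = p * g" using eq g q by (simp add: algebra_simps)
  moreover have "g \<noteq> 0" using g b by auto
  ultimately have "\<bar>p\<bar> \<le> \<bar>a\<bar>" "q \<le> \<bar>b\<bar>"
    using g q mult_left_mono[of 1 "\<bar>g\<bar>" "\<bar>p\<bar>"] mult_left_mono[of 1 "\<bar>g\<bar>" q] by (auto simp: abs_mult)
  then show ?thesis using pq nat_bitlen_mono by (simp add: rat_size_def add_mono)
qed

lemma rat_size_cases:
  obtains p q where "r = of_int p / of_int q" "0 < q" "1 \<le> nat (bitlen q)"
    "rat_size r = 1 + nat (bitlen \<bar>p\<bar>) + nat (bitlen q)"
proof -
  obtain p q where pq: "quotient_of r = (p, q)" by force
  then have q: "q > 0" by (rule quotient_of_denom_pos)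
  then have "1 \<le> nat (bitlen q)" using nat_bitlen_le_iff[of q 0] by simp
  with that[of p q] pq q quotient_of_div[OF pq] show ?thesis by (simp add: rat_size_def)
qed

lemma rat_size_ge_2: "2 \<le> rat_size r"
  by (rule rat_size_cases[of r]) simp

lemma rat_size_uminus: "rat_size (- r) = rat_size r"
  by (cases "quotient_of r") (simp add: rat_size_def rat_uminus_code)

text \<open>In \<open>(p v + u q) / (q v)\<close> each of the two denominators enters both parts,
  whence the factor 2. The other operations use the same factor, which keeps
  \<open>size_factor\<close> uniform.\<close>

lemma rat_size_add: "rat_size (r + s) \<le> 2 * (rat_size r + rat_size s)"
proof -
  obtain p q where r: "r = of_int p / of_int q" "0 < q"
    "rat_size r = 1 + nat (bitlen \<bar>p\<bar>) + nat (bitlen q)" by (rule rat_size_cases)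
  obtain u v where s: "s = of_int u / of_int v" "0 < v"
    "rat_size s = 1 + nat (bitlen \<bar>u\<bar>) + nat (bitlen v)" by (rule rat_size_cases)
  let ?l = "\<lambda>a. nat (bitlen a)"
  let ?w = "?l \<bar>p\<bar> + ?l q + ?l \<bar>u\<bar> + ?l v"
  have "r + s = of_int (p * v + u * q) / of_int (q * v)" using r s by (simp add: field_simps)
  then have "rat_size (r + s) \<le> 1 + ?l \<bar>p * v + u * q\<bar> + ?l \<bar>q * v\<bar>"
    by (rule rat_size_quotient) (use r s in simp)
  moreover have "?l \<bar>p * v + u * q\<bar> \<le> Suc ?w"
    unfolding nat_bitlen_le_iff
  proof -
    have "\<bar>p\<bar> * v < 2 ^ (?l \<bar>p\<bar> + ?l v)" "\<bar>u\<bar> * q < 2 ^ (?l \<bar>u\<bar> + ?l q)"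
      using nat_bitlen_mult[of "\<bar>p\<bar>" v, unfolded nat_bitlen_le_iff]
        nat_bitlen_mult[of "\<bar>u\<bar>" q, unfolded nat_bitlen_le_iff] r(2) s(2) by auto
    moreover have "(2::int) ^ (?l \<bar>p\<bar> + ?l v) \<le> 2 ^ ?w" "(2::int) ^ (?l \<bar>u\<bar> + ?l q) \<le> 2 ^ ?w"
      by (intro power_increasing; simp)+
    moreover have "\<bar>p * v + u * q\<bar> \<le> \<bar>p\<bar> * v + \<bar>u\<bar> * q"
      using abs_triangle_ineq[of "p * v" "u * q"] r s by (simp add: abs_mult)
    ultimately show "\<bar>p * v + u * q\<bar> < 2 ^ Suc ?w" unfolding power_Suc by linarith
  qed
  moreover have "?l \<bar>q * v\<bar> \<le> ?l q + ?l v" using nat_bitlen_mult[of q v] r s by simp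
  ultimately show ?thesis using r s by simp
qed

lemma rat_size_diff: "rat_size (r - s) \<le> 2 * (rat_size r + rat_size s)"
  using rat_size_add[of r "- s"] by (simp add: rat_size_uminus)

lemma rat_size_mult: "rat_size (r * s) \<le> 2 * (rat_size r + rat_size s)"
proof -
  obtain p q where r: "r = of_int p / of_int q" "0 < q"
    "rat_size r = 1 + nat (bitlen \<bar>p\<bar>) + nat (bitlen q)" by (rule rat_size_cases)
  obtain u v where s: "s = of_int u / of_int v" "0 < v"
    "rat_size s = 1 + nat (bitlen \<bar>u\<bar>) + nat (bitlen v)" by (rule rat_size_cases)
  have "r * s = of_int (p * u) / of_int (q * v)" using r s by simp
  then have "rat_size (r * s) \<le> 1 + nat (bitlen \<bar>p * u\<bar>) + nat (bitlen \<bar>q * v\<bar>)"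
    by (rule rat_size_quotient) (use r s in simp)
  then show ?thesis
    using nat_bitlen_mult[of "\<bar>p\<bar>" "\<bar>u\<bar>"] nat_bitlen_mult[of q v] r s by (simp add: abs_mult)
qed

lemma rat_size_divide: "rat_size (r / s) \<le> 2 * (rat_size r + rat_size s)"
proof (cases "s = 0")
  case True
  then show ?thesis using rat_size_ge_2[of r] by (simp add: rat_size_def)
next
  case False
  obtain p q where r: "r = of_int p / of_int q" "0 < q"
    "rat_size r = 1 + nat (bitlen \<bar>p\<bar>) + nat (bitlen q)" by (rule rat_size_cases)
  obtain u v where s: "s = of_int u / of_int v" "0 < v"
    "rat_size s = 1 + nat (bitlen \<bar>u\<bar>) + nat (bitlen v)" by (rule rat_size_cases)
  have u: "u \<noteq> 0" using s False by auto
  have "r / s = of_int (p * v) / of_int (q * u)" using r s u by simp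
  then have "rat_size (r / s) \<le> 1 + nat (bitlen \<bar>p * v\<bar>) + nat (bitlen \<bar>q * u\<bar>)"
    by (rule rat_size_quotient) (use r u in simp)
  then show ?thesis
    using nat_bitlen_mult[of "\<bar>p\<bar>" v] nat_bitlen_mult[of q "\<bar>u\<bar>"] r s by (simp add: abs_mult)
qed

text \<open>The new denominator 1 still takes one bit, and \<open>1 \<le> nat (bitlen q)\<close>
  pays for it. Rounding towards minus infinity never passes \<open>p\<close>, because
  \<open>q \<ge> 1\<close>.\<close>

lemma rat_size_floor: "rat_size (of_int \<lfloor>r\<rfloor>) \<le> rat_size r"
proof -
  obtain p q where r: "r = of_int p / of_int q" "0 < q" "1 \<le> nat (bitlen q)"
    "rat_size r = 1 + nat (bitlen \<bar>p\<bar>) + nat (bitlen q)" by (rule rat_size_cases)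
  have fl: "\<lfloor>r\<rfloor> = p div q" using r by (simp add: floor_divide_of_int_eq)
  have "\<bar>p div q\<bar> \<le> \<bar>p\<bar>"
  proof (cases "0 \<le> p")
    case True
    then show ?thesis
      using r(2) zdiv_mono2[of p 1 q] pos_imp_zdiv_nonneg_iff[of q p] by simp
  next
    case False
    have "p \<le> p div q" using False r(2) zdiv_mono2_neg[of p 1 q] by simp
    moreover have "p div q < 0" using False r(2) by (simp add: pos_imp_zdiv_neg_iff)
    ultimately show ?thesis by simp
  qed
  moreover have "rat_size (of_int \<lfloor>r\<rfloor>) \<le> 1 + nat (bitlen \<bar>\<lfloor>r\<rfloor>\<bar>) + nat (bitlen \<bar>1\<bar>)"
    by (rule rat_size_quotient) auto
  moreover have "nat (bitlen 1) = 1" by (simp add: compute_bitlen)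
  ultimately show ?thesis using r fl nat_bitlen_mono[of "\<bar>p div q\<bar>" "\<bar>p\<bar>"] by simp
qed

section \<open>Size and cost factors of expressions and programs\<close>

text \<open>If all memory cells have size at most \<open>B\<close>, the value of \<open>e\<close> has size at most
  \<open>size_factor e * B\<close>, and evaluating \<open>e\<close> costs at most \<open>cost_factor e * B\<close>.\<close>

fun size_factor :: "aexp \<Rightarrow> nat" where
  "size_factor (Const c) = rat_size c"
| "size_factor (Read a e) = 1"
| "size_factor (Plus e f) = 2 * (size_factor e + size_factor f)"
| "size_factor (Minus e f) = 2 * (size_factor e + size_factor f)"
| "size_factor (Times e f) = 2 * (size_factor e + size_factor f)"
| "size_factor (Divide e f) = 2 * (size_factor e + size_factor f)"
| "size_factor (Floor e) = size_factor e"

fun cost_factor :: "aexp \<Rightarrow> nat" where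
  "cost_factor (Const c) = rat_size c"
| "cost_factor (Read a e) = cost_factor e + 1"
| "cost_factor (Plus e f) = cost_factor e + cost_factor f + size_factor (Plus e f)"
| "cost_factor (Minus e f) = cost_factor e + cost_factor f + size_factor (Minus e f)"
| "cost_factor (Times e f) = cost_factor e + cost_factor f + size_factor (Times e f)"
| "cost_factor (Divide e f) = cost_factor e + cost_factor f + size_factor (Divide e f)"
| "cost_factor (Floor e) = cost_factor e + size_factor (Floor e)"

fun bcost_factor :: "bexp \<Rightarrow> nat" where
  "bcost_factor (Less e f) = 1 + cost_factor e + cost_factor f"
| "bcost_factor (Neg b) = 1 + bcost_factor b"
| "bcost_factor (Conj b c) = 1 + bcost_factor b + bcost_factor c"

text \<open>The cost of a program, in units of \<open>B\<close>, when every execution of a loop makes at most \<open>b\<close>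
  iterations.\<close>

fun com_factor :: "nat \<Rightarrow> com \<Rightarrow> nat" where
  "com_factor b Skip = 1"
| "com_factor b (Write a e f) = 1 + cost_factor e + cost_factor f"
| "com_factor b (Seq c c') = 1 + com_factor b c + com_factor b c'"
| "com_factor b (Cond g c c') = 1 + bcost_factor g + com_factor b c + com_factor b c'"
| "com_factor b (While g c) = (b + 1) * (1 + bcost_factor g + com_factor b c)"

text \<open>Every loop contributes one factor \<open>b + 1\<close>, so the degree is bounded by the
  nesting depth of loops, which the program text fixes.\<close>

lemma com_factor_poly: "\<exists>p. \<forall>b. poly p b = com_factor b c"
proof (induction c)
  case Skip
  show ?case by (intro exI[of _ "[:1:]"]) simp
next
  case (Write a e f)
  show ?case by (intro exI[of _ "[:1 + cost_factor e + cost_factor f:]"]) simp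
next
  case (Seq c c')
  then obtain p q where "\<forall>b. poly p b = com_factor b c" "\<forall>b. poly q b = com_factor b c'" by blast
  then show ?case by (intro exI[of _ "[:1:] + p + q"]) simp
next
  case (Cond g c c')
  then obtain p q where "\<forall>b. poly p b = com_factor b c" "\<forall>b. poly q b = com_factor b c'" by blast
  then show ?case by (intro exI[of _ "[:1 + bcost_factor g:] + p + q"]) simp
next
  case (While g c)
  then obtain p where "\<forall>b. poly p b = com_factor b c" by blast
  then show ?case by (intro exI[of _ "[:1, 1:] * ([:1 + bcost_factor g:] + p)"]) (simp add: algebra_simps)
qed

fun mods :: "com \<Rightarrow> nat set" where
  "mods Skip = {}"
| "mods (Write a e f) = {a}"
| "mods (Seq c c') = mods c \<union> mods c'"
| "mods (Cond g c c') = mods c \<union> mods c'"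
| "mods (While g c) = mods c"

text \<open>Frame conditions are tracked per array. For this reason every scalar of the program gets
  an array of its own and lives in its cell 0.\<close>

lemma exec_mods: "exec c s t s' \<Longrightarrow> a \<notin> mods c \<Longrightarrow> s' a = s a"
  by (induction rule: exec.induct) auto

text \<open>\<open>sem\<close> is meaningful for loop-free programs only.\<close>

fun sem :: "com \<Rightarrow> memory \<Rightarrow> memory" where
  "sem Skip s = s"
| "sem (Write a e f) s = s(a := (s a)(nat \<lfloor>aval e s\<rfloor> := aval f s))"
| "sem (Seq c c') s = sem c' (sem c s)"
| "sem (Cond g c c') s = (if bval g s then sem c s else sem c' s)"
| "sem (While g c) s = undefined"

section \<open>Registers and loop schemes\<close>

abbreviation Reg :: "nat \<Rightarrow> aexp" where "Reg v \<equiv> Read v (Const 0)"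
abbreviation Assign :: "nat \<Rightarrow> aexp \<Rightarrow> com" where "Assign v f \<equiv> Write v (Const 0) f"
abbreviation Leq :: "aexp \<Rightarrow> aexp \<Rightarrow> bexp" where "Leq e f \<equiv> Neg (Less f e)"

definition Eq :: "aexp \<Rightarrow> aexp \<Rightarrow> bexp" where
  "Eq e f = Conj (Leq e f) (Leq f e)"

lemma bval_Eq [simp]: "bval (Eq e f) s \<longleftrightarrow> aval e s = aval f s"
  by (auto simp: Eq_def)

definition For :: "nat \<Rightarrow> nat \<Rightarrow> com \<Rightarrow> com" where
  "For v u c = Seq (Assign v (Const 0))
     (While (Less (Reg v) (Reg u)) (Seq c (Assign v (Plus (Reg v) (Const 1)))))"

lemma mods_For [simp]: "mods (For v u c) = insert v (mods c)"
  by (auto simp: For_def)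

definition Sum_loop :: "nat \<Rightarrow> nat \<Rightarrow> nat \<Rightarrow> bexp \<Rightarrow> aexp \<Rightarrow> com" where
  "Sum_loop acc v u g f = Seq (Assign acc (Const 0)) (For v u (Cond g (Assign acc (Plus (Reg acc) f)) Skip))"

text \<open>There is no early exit, so the last index that passes the test survives. The upper bound
  itself stands for the absence of such an index.\<close>

definition Find_loop :: "nat \<Rightarrow> nat \<Rightarrow> nat \<Rightarrow> bexp \<Rightarrow> com" where
  "Find_loop acc v u g = Seq (Assign acc (Reg u)) (For v u (Cond g (Assign acc (Reg v)) Skip))"

text \<open>\<open>acc\<close> starts at the upper bound as a mark that nothing has been found.
  \<open>val\<close> matters only once \<open>acc\<close> is below that bound, so it needs no
  initial value.\<close>

definition Arg_min_loop :: "nat \<Rightarrow> nat \<Rightarrow> nat \<Rightarrow> nat \<Rightarrow> bexp \<Rightarrow> aexp \<Rightarrow> com" where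
  "Arg_min_loop acc val v u g f = Seq (Assign acc (Reg u)) (For v u
     (Cond (Conj g (Neg (Conj (Less (Reg acc) (Reg u)) (Leq (Reg val) f))))
       (Seq (Assign acc (Reg v)) (Assign val f)) Skip))"

lemma mods_loops [simp]:
  "mods (Sum_loop acc v u g f) = {acc, v}"
  "mods (Find_loop acc v u g) = {acc, v}"
  "mods (Arg_min_loop acc val v u g f) = {acc, val, v}"
  by (auto simp: Sum_loop_def Find_loop_def Arg_min_loop_def)

text \<open>\<open>B\<close> limits the size of stored values, \<open>b\<close> the number of
  iterations of a loop. The assumption links them: loop counters are stored as well and range up to
  \<open>b\<close>.\<close>

locale resource_bounds =
  fixes B b :: nat
  assumes rat_size_of_nat: "k \<le> b \<Longrightarrow> rat_size (of_nat k) \<le> B"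
begin

definition bounded :: "memory \<Rightarrow> bool" where
  "bounded s \<longleftrightarrow> (\<forall>a i. rat_size (s a i) \<le> B)"

lemma rat_size_Suc: "k < b \<Longrightarrow> rat_size (of_nat k + 1) \<le> B"
  using rat_size_of_nat[of "Suc k"] by (simp add: add.commute)

lemma B_ge_2: "2 \<le> B"
  using rat_size_of_nat[of 0] rat_size_ge_2[of 0] by simp

lemma boundedD: "bounded s \<Longrightarrow> rat_size (s a i) \<le> B"
  by (simp add: bounded_def)

lemma bounded_update: "bounded s \<Longrightarrow> rat_size r \<le> B \<Longrightarrow> bounded (s(a := (s a)(i := r)))"
  by (simp add: bounded_def)

lemma rat_size_aval: "bounded s \<Longrightarrow> rat_size (aval e s) \<le> size_factor e * B"
proof (induction e)
  case (Const c)
  then show ?case using B_ge_2 by simp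
next
  case (Read a e)
  then show ?case by (simp add: bounded_def)
next
  case (Plus e f)
  then show ?case using rat_size_add[of "aval e s" "aval f s"] by (simp add: algebra_simps)
next
  case (Minus e f)
  then show ?case using rat_size_diff[of "aval e s" "aval f s"] by (simp add: algebra_simps)
next
  case (Times e f)
  then show ?case using rat_size_mult[of "aval e s" "aval f s"] by (simp add: algebra_simps)
next
  case (Divide e f)
  then show ?case using rat_size_divide[of "aval e s" "aval f s"] by (simp add: algebra_simps)
next
  case (Floor e)
  then show ?case using rat_size_floor[of "aval e s"] by simp
qed

lemma acost_le: "bounded s \<Longrightarrow> acost e s \<le> cost_factor e * B"
proof (induction e)
  case (Const c)
  then show ?case using B_ge_2 by simp
next
  case (Read a e)
  then show ?case using rat_size_aval[of s "Read a e"] by (simp add: algebra_simps)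
next
  case (Plus e f)
  then show ?case using rat_size_aval[of s "Plus e f"] by (simp add: algebra_simps)
next
  case (Minus e f)
  then show ?case using rat_size_aval[of s "Minus e f"] by (simp add: algebra_simps)
next
  case (Times e f)
  then show ?case using rat_size_aval[of s "Times e f"] by (simp add: algebra_simps)
next
  case (Divide e f)
  then show ?case using rat_size_aval[of s "Divide e f"] by (simp add: algebra_simps)
next
  case (Floor e)
  then show ?case using rat_size_aval[of s "Floor e"] by (simp add: algebra_simps)
qed

lemma bcost_le: "bounded s \<Longrightarrow> bcost g s \<le> bcost_factor g * B"
proof (induction g)
  case (Less e f)
  then show ?case using acost_le[of s e] acost_le[of s f] B_ge_2 by (simp add: algebra_simps)
qed (use B_ge_2 in \<open>auto simp: algebra_simps\<close>)

section \<open>Bounded executions of loop-free code and of loops\<close>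

definition run :: "memory \<Rightarrow> com \<Rightarrow> memory \<Rightarrow> bool" where
  "run s c s' \<longleftrightarrow> bounded s' \<and> (\<exists>t. exec c s t s' \<and> t \<le> com_factor b c * B)"

lemma run_bounded: "run s c s' \<Longrightarrow> bounded s'"
  by (simp add: run_def)

lemma run_frame: "run s c s' \<Longrightarrow> a \<notin> mods c \<Longrightarrow> s' a = s a"
  by (auto simp: run_def exec_mods)

lemma run_Seq:
  assumes "run s c s'" "run s' c' s''"
  shows "run s (Seq c c') s''"
proof -
  obtain t t' where "exec c s t s'" "t \<le> com_factor b c * B" "exec c' s' t' s''" "t' \<le> com_factor b c' * B"
    using assms unfolding run_def by blast
  then show ?thesis
    using assms(2) B_ge_2 unfolding run_def
    by (intro conjI exI[of _ "1 + t + t'"] exec.Seq) (auto simp: algebra_simps)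
qed

lemma run_Cond:
  assumes "bounded s" "bval g s \<Longrightarrow> run s c s'" "\<not> bval g s \<Longrightarrow> run s c' s'"
  shows "run s (Cond g c c') s'"
proof (cases "bval g s")
  case True
  then obtain t where "exec c s t s'" "t \<le> com_factor b c * B" using assms unfolding run_def by blast
  then show ?thesis
    using assms True B_ge_2 bcost_le[of s g] unfolding run_def
    by (intro conjI exI[of _ "1 + bcost g s + t"] exec.CondTrue) (auto simp: algebra_simps)
next
  case False
  then obtain t where "exec c' s t s'" "t \<le> com_factor b c' * B" using assms unfolding run_def by blast
  then show ?thesis
    using assms False B_ge_2 bcost_le[of s g] unfolding run_def
    by (intro conjI exI[of _ "1 + bcost g s + t"] exec.CondFalse) (auto simp: algebra_simps)
qed

text \<open>Only values that are written need size at most \<open>B\<close>; intermediate results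
  are covered by \<open>size_factor\<close>. The value False for loops confines
  \<open>run_sem\<close> to loop-free code.\<close>

fun safe :: "com \<Rightarrow> memory \<Rightarrow> bool" where
  "safe Skip s \<longleftrightarrow> True"
| "safe (Write a e f) s \<longleftrightarrow> rat_size (aval f s) \<le> B"
| "safe (Seq c c') s \<longleftrightarrow> safe c s \<and> safe c' (sem c s)"
| "safe (Cond g c c') s \<longleftrightarrow> (if bval g s then safe c s else safe c' s)"
| "safe (While g c) s \<longleftrightarrow> False"

lemma run_sem: "bounded s \<Longrightarrow> safe c s \<Longrightarrow> run s c (sem c s)"
proof (induction c arbitrary: s)
  case Skip
  then show ?case using exec.Skip[of s] B_ge_2 by (auto simp: run_def)
next
  case (Write a e f)
  then show ?case
    using exec.Write[of a e f s] acost_le[of s e] acost_le[of s f] B_ge_2 bounded_update[of s "aval f s" a]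
    unfolding run_def by (intro conjI exI[of _ "1 + acost e s + acost f s"]) (auto simp: algebra_simps)
next
  case (Seq c c')
  then show ?case by (auto intro: run_Seq dest: run_bounded)
next
  case (Cond g c c')
  then show ?case by (intro run_Cond) (auto split: if_splits)
qed simp

text \<open>The execution is supplied as a trace \<open>S\<close> of memories. The guard is
  evaluated once more than the body, hence \<open>b + 1\<close> in
  \<open>com_factor\<close>.\<close>

lemma run_While:
  assumes "\<And>k. k < N \<Longrightarrow> bounded (S k) \<and> bval g (S k) \<and> run (S k) c (S (Suc k))"
    and "bounded (S N)" "\<not> bval g (S N)" "N \<le> b"
  shows "run (S 0) (While g c) (S N)"
proof -
  let ?u = "1 + bcost_factor g + com_factor b c"
  \<comment> \<open>\<open>k\<close> counts the iterations still to come, since \<open>exec\<close>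
    splits a loop into its first iteration and the remaining loop.\<close>
  have "k \<le> N \<Longrightarrow> \<exists>t. exec (While g c) (S (N - k)) t (S N) \<and> t \<le> (k + 1) * (?u * B)" for k
  proof (induction k)
    case 0
    have "1 + bcost g (S N) \<le> ?u * B"
      using bcost_le[OF assms(2), of g] B_ge_2 by (simp add: algebra_simps)
    then show ?case using exec.WhileFalse[OF assms(3)] by auto
  next
    case (Suc k)
    define l where "l = N - Suc k"
    have l: "l < N" "Suc l = N - k" using Suc.prems by (auto simp: l_def)
    obtain t' where t': "exec (While g c) (S (Suc l)) t' (S N)" "t' \<le> (k + 1) * (?u * B)"
      using Suc l by auto
    obtain t where t: "exec c (S l) t (S (Suc l))" "t \<le> com_factor b c * B"
      using assms(1)[OF l(1)] unfolding run_def by blast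
    have "exec (While g c) (S l) (1 + bcost g (S l) + t + t') (S N)"
      using assms(1)[OF l(1)] t t' by (intro exec.WhileTrue) auto
    moreover have "1 + bcost g (S l) + t \<le> ?u * B"
      using t bcost_le[of "S l" g] assms(1)[OF l(1)] B_ge_2 by (simp add: algebra_simps)
    then have "1 + bcost g (S l) + t + t' \<le> (Suc k + 1) * (?u * B)" using t' by simp
    ultimately show ?case unfolding l_def by blast
  qed
  from this[of N] obtain t where t: "exec (While g c) (S 0) t (S N)" "t \<le> (N + 1) * (?u * B)" by auto
  have "(N + 1) * (?u * B) \<le> (b + 1) * (?u * B)" using assms(4) by (intro mult_right_mono) auto
  moreover have "com_factor b (While g c) * B = (b + 1) * (?u * B)"
    by (simp only: com_factor.simps mult.assoc)
  ultimately show ?thesis using t assms(2) unfolding run_def by (metis order_trans)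
qed

text \<open>The body changes neither counter nor bound, so there are exactly \<open>N\<close>
  iterations. \<open>step\<close> asks only for the existence of a successor memory; thus the
  existential facts about inner loops can be plugged in directly.\<close>

lemma run_For:
  assumes s: "bounded s" and u: "s u 0 = of_nat N" "N \<le> b" "u \<noteq> v" "u \<notin> mods c" "v \<notin> mods c"
    and I0: "I 0 (s(v := (s v)(0 := 0)))"
    and step: "\<And>k s1. \<lbrakk>k < N; I k s1; s1 v 0 = of_nat k; bounded s1; \<forall>a. a \<notin> insert v (mods c) \<longrightarrow> s1 a = s a\<rbrakk> \<Longrightarrow>
      \<exists>s2. run s1 c s2 \<and> I (Suc k) (s2(v := (s2 v)(0 := of_nat (Suc k))))"
  obtains s' where "run s (For v u c) s'" "I N s'" "\<forall>a. a \<notin> insert v (mods c) \<longrightarrow> s' a = s a"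
proof -
  let ?body = "Seq c (Assign v (Plus (Reg v) (Const 1)))"
  let ?g = "Less (Reg v) (Reg u)"
  define Q where "Q k s1 \<longleftrightarrow> I k s1 \<and> s1 v 0 = of_nat k \<and> bounded s1 \<and>
    (\<forall>a. a \<notin> insert v (mods c) \<longrightarrow> s1 a = s a)" for k s1
  have Q_step: "\<exists>s2. run s1 ?body s2 \<and> Q (Suc k) s2" if k: "k < N" "Q k s1" for k s1
  proof -
    obtain s2 where s2: "run s1 c s2" "I (Suc k) (s2(v := (s2 v)(0 := of_nat (Suc k))))"
      using step[OF k(1), of s1] k(2) unfolding Q_def by blast
    let ?s3 = "s2(v := (s2 v)(0 := of_nat (Suc k)))"
    have v: "s2 v 0 = of_nat k" using run_frame[OF s2(1) u(5)] that by (simp add: Q_def)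
    have size: "rat_size (of_nat (Suc k)) \<le> B" using rat_size_of_nat[of "Suc k"] that u by simp
    have "run s2 (Assign v (Plus (Reg v) (Const 1))) (sem (Assign v (Plus (Reg v) (Const 1))) s2)"
      using run_bounded[OF s2(1)] size v by (intro run_sem) (auto simp: add.commute)
    then have "run s1 ?body ?s3" using v s2(1) by (auto intro: run_Seq simp: add.commute)
    moreover have "Q (Suc k) ?s3"
      using s2 that run_bounded[OF \<open>run s1 ?body ?s3\<close>] run_frame[OF s2(1)] by (auto simp: Q_def)
    ultimately show ?thesis by blast
  qed
  \<comment> \<open>The trace required by \<open>run_While\<close> is chosen from the existential
    step.\<close>
  define S where "S = rec_nat (s(v := (s v)(0 := 0))) (\<lambda>k s1. SOME s2. run s1 ?body s2 \<and> Q (Suc k) s2)"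
  have S0: "S 0 = s(v := (s v)(0 := 0))" by (simp add: S_def)
  have bounded_S0: "bounded (S 0)"
    unfolding S0 using rat_size_of_nat[of 0] by (intro bounded_update[OF s]) simp
  have Q: "k \<le> N \<Longrightarrow> Q k (S k)" for k
  proof (induction k)
    case 0
    then show ?case using I0 bounded_S0 unfolding Q_def S0 by auto
  next
    case (Suc k)
    then have "\<exists>s2. run (S k) ?body s2 \<and> Q (Suc k) s2" by (intro Q_step) auto
    then have "run (S k) ?body (S (Suc k)) \<and> Q (Suc k) (S (Suc k))"
      using someI_ex[of "\<lambda>s2. run (S k) ?body s2 \<and> Q (Suc k) s2"] by (simp add: S_def)
    then show ?case by blast
  qed
  have run_S: "run (S k) ?body (S (Suc k))" if "k < N" for k
    using someI_ex[OF Q_step[OF that Q]] that by (simp add: S_def)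
  have guard: "bval ?g (S k) \<longleftrightarrow> k < N" if "k \<le> N" for k
    using Q[OF that] u by (auto simp: Q_def)
  have "run (S 0) (While ?g ?body) (S N)"
    using Q run_S guard u by (intro run_While) (auto simp: Q_def)
  moreover have "run s (Assign v (Const 0)) (S 0)"
    using run_sem[OF s, of "Assign v (Const 0)"] rat_size_of_nat[of 0] by (simp add: S0)
  ultimately have "run s (For v u c) (S N)" unfolding For_def by (rule run_Seq[rotated])
  then show ?thesis using that Q[of N] by (simp add: Q_def)
qed

text \<open>\<open>eval\<close> ranges over all memories that differ from \<open>s\<close> only in
  the registers of the loop, so a caller evaluates guard and summand without knowing the state of
  the loop. Sizes are required of all partial sums because each of them is stored.\<close>

lemma run_Sum_loop:
  assumes s: "bounded s" and u: "s u 0 = of_nat N" "N \<le> b" "u \<noteq> v" "u \<noteq> acc" "v \<noteq> acc"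
    and eval: "\<And>k s1. \<lbrakk>k < N; s1 v 0 = of_nat k; \<forall>a. a \<noteq> v \<longrightarrow> a \<noteq> acc \<longrightarrow> s1 a = s a\<rbrakk> \<Longrightarrow>
      (bval g s1 \<longleftrightarrow> G k) \<and> (G k \<longrightarrow> aval f s1 = F k)"
    and size: "\<And>k. k \<le> N \<Longrightarrow> rat_size (\<Sum>i<k. if G i then F i else 0) \<le> B"
  obtains s' where "run s (Sum_loop acc v u g f) s'" "s' acc 0 = (\<Sum>i<N. if G i then F i else 0)"
    "\<forall>a. a \<noteq> v \<longrightarrow> a \<noteq> acc \<longrightarrow> s' a = s a"
proof -
  let ?s0 = "s(acc := (s acc)(0 := 0))"
  have r0: "run s (Assign acc (Const 0)) ?s0"
    using run_sem[OF s, of "Assign acc (Const 0)"] rat_size_of_nat[of 0] by simp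
  obtain s' where s': "run ?s0 (For v u (Cond g (Assign acc (Plus (Reg acc) f)) Skip)) s'"
      "s' acc 0 = (\<Sum>i<N. if G i then F i else 0)" "\<forall>a. a \<notin> {v, acc} \<longrightarrow> s' a = ?s0 a"
  proof (rule run_For[where I = "\<lambda>k s1. s1 acc 0 = (\<Sum>i<k. if G i then F i else 0)" and s = ?s0 and N = N
        and v = v and u = u and c = "Cond g (Assign acc (Plus (Reg acc) f)) Skip"])
    fix k s1
    assume k: "k < N" and acc: "s1 acc 0 = (\<Sum>i<k. if G i then F i else 0)" and v: "s1 v 0 = of_nat k"
      and s1: "bounded s1"
      and fr: "\<forall>a. a \<notin> insert v (mods (Cond g (Assign acc (Plus (Reg acc) f)) Skip)) \<longrightarrow> s1 a = ?s0 a"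
    have ev: "bval g s1 \<longleftrightarrow> G k" "G k \<Longrightarrow> aval f s1 = F k" using eval[of k s1] k v fr by auto
    have "run s1 (Cond g (Assign acc (Plus (Reg acc) f)) Skip)
        (sem (Cond g (Assign acc (Plus (Reg acc) f)) Skip) s1)"
      using s1 ev acc size[of "Suc k"] k by (intro run_sem) auto
    then show "\<exists>s2. run s1 (Cond g (Assign acc (Plus (Reg acc) f)) Skip) s2 \<and>
        (s2(v := (s2 v)(0 := of_nat (Suc k)))) acc 0 = (\<Sum>i<Suc k. if G i then F i else 0)"
      using ev acc u by (intro exI[of _ "sem (Cond g (Assign acc (Plus (Reg acc) f)) Skip) s1"] conjI) auto
  qed (use run_bounded[OF r0] u in auto)
  then show ?thesis using that[of s'] run_Seq[OF r0 s'(1)] by (auto simp: Sum_loop_def)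
qed

lemma run_Find_loop:
  assumes s: "bounded s" and u: "s u 0 = of_nat N" "N \<le> b" "u \<noteq> v" "u \<noteq> acc" "v \<noteq> acc"
    and eval: "\<And>k s1. \<lbrakk>k < N; s1 v 0 = of_nat k; \<forall>a. a \<noteq> v \<longrightarrow> a \<noteq> acc \<longrightarrow> s1 a = s a\<rbrakk> \<Longrightarrow>
      bval g s1 \<longleftrightarrow> G k"
  obtains s' r where "run s (Find_loop acc v u g) s'" "s' acc 0 = of_nat r"
    "r < N \<and> G r \<or> r = N \<and> (\<forall>k<N. \<not> G k)"
    "\<forall>a. a \<noteq> v \<longrightarrow> a \<noteq> acc \<longrightarrow> s' a = s a"
proof -
  let ?s0 = "s(acc := (s acc)(0 := of_nat N))"
  let ?c = "Cond g (Assign acc (Reg v)) Skip"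
  have r0: "run s (Assign acc (Reg u)) ?s0"
    using run_sem[OF s, of "Assign acc (Reg u)"] boundedD[OF s, of u 0] u by simp
  obtain s' where s': "run ?s0 (For v u ?c) s'"
      "\<exists>r. s' acc 0 = of_nat r \<and> (r < N \<and> G r \<or> r = N \<and> (\<forall>k<N. \<not> G k))" "\<forall>a. a \<notin> {v, acc} \<longrightarrow> s' a = ?s0 a"
  proof (rule run_For[where I = "\<lambda>k s1. \<exists>r. s1 acc 0 = of_nat r \<and> (r < N \<and> G r \<or> r = N \<and> (\<forall>i<k. \<not> G i))"
        and s = ?s0 and N = N and v = v and u = u and c = ?c])
    fix k s1
    assume k: "k < N" and acc: "\<exists>r. s1 acc 0 = of_nat r \<and> (r < N \<and> G r \<or> r = N \<and> (\<forall>i<k. \<not> G i))"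
      and v: "s1 v 0 = of_nat k" and s1: "bounded s1"
      and fr: "\<forall>a. a \<notin> insert v (mods ?c) \<longrightarrow> s1 a = ?s0 a"
    have ev: "bval g s1 \<longleftrightarrow> G k" using eval[of k s1] k v fr by auto
    have "run s1 ?c (sem ?c s1)"
      using s1 boundedD[OF s1] by (intro run_sem) auto
    then show "\<exists>s2. run s1 ?c s2 \<and> (\<exists>r. (s2(v := (s2 v)(0 := of_nat (Suc k)))) acc 0 = of_nat r \<and>
        (r < N \<and> G r \<or> r = N \<and> (\<forall>i<Suc k. \<not> G i)))"
      using ev acc u k v by (intro exI[of _ "sem ?c s1"] conjI) (auto simp: less_Suc_eq)
  qed (use run_bounded[OF r0] u in auto)
  then show ?thesis using that[of s'] run_Seq[OF r0 s'(1)] by (auto simp: Find_loop_def)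
qed

lemma run_Arg_min_loop:
  assumes s: "bounded s" and u: "s u 0 = of_nat N" "N \<le> b" "u \<noteq> v" "u \<noteq> acc" "v \<noteq> acc"
      "val \<noteq> u" "val \<noteq> v" "val \<noteq> acc"
    and eval: "\<And>k s1. \<lbrakk>k < N; s1 v 0 = of_nat k; \<forall>a. a \<noteq> v \<longrightarrow> a \<noteq> acc \<longrightarrow> a \<noteq> val \<longrightarrow> s1 a = s a\<rbrakk> \<Longrightarrow>
      (bval g s1 \<longleftrightarrow> G k) \<and> aval f s1 = F k"
    and size: "\<And>k. k < N \<Longrightarrow> rat_size (F k) \<le> B"
  obtains s' r where "run s (Arg_min_loop acc val v u g f) s'" "s' acc 0 = of_nat r"
    "r < N \<and> G r \<and> (\<forall>k<N. G k \<longrightarrow> F r \<le> F k) \<or> r = N \<and> (\<forall>k<N. \<not> G k)"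
    "\<forall>a. a \<noteq> v \<longrightarrow> a \<noteq> acc \<longrightarrow> a \<noteq> val \<longrightarrow> s' a = s a"
proof -
  let ?s0 = "s(acc := (s acc)(0 := of_nat N))"
  let ?c = "Cond (Conj g (Neg (Conj (Less (Reg acc) (Reg u)) (Leq (Reg val) f))))
       (Seq (Assign acc (Reg v)) (Assign val f)) Skip"
  let ?I = "\<lambda>k s1. \<exists>r. s1 acc 0 = of_nat r \<and>
    (r < N \<and> G r \<and> s1 val 0 = F r \<and> (\<forall>i<k. G i \<longrightarrow> F r \<le> F i) \<or> r = N \<and> (\<forall>i<k. \<not> G i))"
  have r0: "run s (Assign acc (Reg u)) ?s0"
    using run_sem[OF s, of "Assign acc (Reg u)"] boundedD[OF s, of u 0] u by simp
  obtain s' where s': "run ?s0 (For v u ?c) s'" "?I N s'" "\<forall>a. a \<notin> {v, acc, val} \<longrightarrow> s' a = ?s0 a"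
  proof (rule run_For[where I = ?I and s = ?s0 and N = N and v = v and u = u and c = ?c])
    fix k s1
    assume k: "k < N" and I: "?I k s1" and v: "s1 v 0 = of_nat k" and s1: "bounded s1"
      and fr: "\<forall>a. a \<notin> insert v (mods ?c) \<longrightarrow> s1 a = ?s0 a"
    have ev: "bval g s1 \<longleftrightarrow> G k" "aval f s1 = F k" using eval[of k s1] k v fr by auto
    let ?t = "s1(acc := (s1 acc)(0 := of_nat k))"
    \<comment> \<open>\<open>f\<close> is evaluated after \<open>acc\<close> has been overwritten;
      \<open>eval\<close> covers this, as it leaves the contents of \<open>acc\<close> open.\<close>
    have ev': "aval f ?t = F k" using eval[of k ?t] k v fr u by auto
    have su: "s1 u 0 = of_nat N" using fr u by auto
    have "run s1 ?c (sem ?c s1)"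
      using s1 boundedD[OF s1, of v 0] ev' v size[OF k] by (intro run_sem) auto
    moreover have "?I (Suc k) ((sem ?c s1)(v := (sem ?c s1 v)(0 := of_nat (Suc k))))"
    proof (cases "bval (Conj g (Neg (Conj (Less (Reg acc) (Reg u)) (Leq (Reg val) f)))) s1")
      case True
      then have sem: "sem ?c s1 = ?t(val := (?t val)(0 := F k))" using ev' v by simp
      have Gk: "G k" using True ev by simp
      have "F k \<le> F i" if "i < Suc k" "G i" for i
        using I True su ev that by (auto simp: less_Suc_eq intro: order_trans less_imp_le dest: order.strict_implies_order)
      then show ?thesis unfolding sem using u k Gk by (intro exI[of _ k]) auto
    next
      case False
      then have sem: "sem ?c s1 = s1" by (simp only: sem.simps if_False)
      obtain r where r: "s1 acc 0 = of_nat r"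
        "r < N \<and> G r \<and> s1 val 0 = F r \<and> (\<forall>i<k. G i \<longrightarrow> F r \<le> F i) \<or> r = N \<and> (\<forall>i<k. \<not> G i)"
        using I by blast
      show ?thesis unfolding sem using u r False ev su by (intro exI[of _ r]) (auto simp: less_Suc_eq)
    qed
    ultimately show "\<exists>s2. run s1 ?c s2 \<and> ?I (Suc k) (s2(v := (s2 v)(0 := of_nat (Suc k))))"
      by blast
  qed (use run_bounded[OF r0] u in auto)
  obtain r where "s' acc 0 = of_nat r"
    "r < N \<and> G r \<and> s' val 0 = F r \<and> (\<forall>k<N. G k \<longrightarrow> F r \<le> F k) \<or> r = N \<and> (\<forall>k<N. \<not> G k)"
    using s'(2) by blast
  then show ?thesis using that[of s' r] run_Seq[OF r0 s'(1)] s'(3) by (auto simp: Arg_min_loop_def)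
qed

end

section \<open>Assigning clients to boxes\<close>

lemma index_div_mod:
  fixes s l N :: nat
  assumes "l < N"
  shows "(s * N + l) div N = s" "(s * N + l) mod N = l"
  using assms by auto

lemma index_less:
  fixes s l N :: nat
  assumes "s < m" "l < N"
  shows "s * N + l < m * N"
proof -
  have "s * N + l < Suc s * N" using assms by simp
  also have "\<dots> \<le> m * N" using assms by (intro mult_right_mono) auto
  finally show ?thesis .
qed

text \<open>A fractional assignment in which a client has mass at least \<open>\<delta>\<close>
  instead of 1. After division by \<open>\<delta>\<close>, box \<open>b\<close> is entitled to
  \<open>capacity b / \<delta>\<close> clients, up to rounding.\<close>

locale box_assignment =
  fixes n G :: nat and W :: "nat \<Rightarrow> nat \<Rightarrow> rat" and \<delta> :: rat
  assumes W_nonneg: "j < n \<Longrightarrow> b < G \<Longrightarrow> 0 \<le> W j b"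
    and \<delta>_pos: "0 < \<delta>"
    and W_total: "j < n \<Longrightarrow> \<delta> \<le> (\<Sum>b<G. W j b)"
begin

definition capacity :: "nat \<Rightarrow> rat" where
  "capacity b = (\<Sum>j<n. W j b)"

definition occupancy :: "(nat \<Rightarrow> nat) \<Rightarrow> nat \<Rightarrow> nat" where
  "occupancy H b = card {j. j < n \<and> H j = Suc b}"

text \<open>\<open>H j = Suc b\<close> places client \<open>j\<close> in box \<open>b\<close>,
  \<open>P\<close> holds the prices of the boxes, and the level \<open>p j\<close> of a placed
  client is one more than the price at which it entered. The first two conditions are approximate
  complementary slackness: the price paid is within 1 of the cheapest usable box, and the level is
  \<open>P b\<close> or \<open>P b + 1\<close>. A box with spare room costs nothing, so a positive
  price certifies a full box.\<close>

definition auction_inv :: "(nat \<Rightarrow> nat) \<Rightarrow> (nat \<Rightarrow> nat) \<Rightarrow> (nat \<Rightarrow> nat) \<Rightarrow> bool" where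
  "auction_inv H p P \<longleftrightarrow>
     (\<forall>j<n. \<forall>b. H j = Suc b \<longrightarrow> b < G \<and> 0 < W j b \<and> 1 \<le> p j \<and> P b \<le> p j) \<and>
     (\<forall>j<n. \<forall>b<G. 0 < W j b \<longrightarrow> p j \<le> Suc (P b)) \<and>
     (\<forall>j<n. H j = 0 \<longrightarrow> p j = 0) \<and>
     (\<forall>b<G. of_nat (occupancy H b) * \<delta> < capacity b \<longrightarrow> P b = 0) \<and>
     (\<forall>b<G. of_nat (occupancy H b) * \<delta> < capacity b + \<delta>) \<and>
     (\<forall>b<G. P b \<le> Suc G) \<and> (\<forall>j<n. p j \<le> Suc G)"

definition potential :: "(nat \<Rightarrow> nat) \<Rightarrow> (nat \<Rightarrow> nat) \<Rightarrow> nat" where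
  "potential p P = (\<Sum>j<n. p j) + (\<Sum>b<G. P b)"

lemma capacity_nonneg: "b < G \<Longrightarrow> 0 \<le> capacity b"
  unfolding capacity_def by (intro sum_nonneg) (use W_nonneg in auto)

lemma auction_inv_start: "auction_inv (\<lambda>_. 0) (\<lambda>_. 0) (\<lambda>_. 0)"
  using capacity_nonneg \<delta>_pos by (auto simp: auction_inv_def occupancy_def add_nonneg_pos)

lemma potential_le:
  assumes "auction_inv H p P"
  shows "potential p P \<le> (n + G) * Suc G"
proof -
  have "(\<Sum>j<n. p j) \<le> (\<Sum>j<n. Suc G)" "(\<Sum>b<G. P b) \<le> (\<Sum>b<G. Suc G)"
    using assms by (auto intro!: sum_mono simp: auction_inv_def simp del: sum_constant)
  then show ?thesis by (simp add: potential_def algebra_simps)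
qed

text \<open>Some price level \<open>g \<le> G\<close> is not taken by any of the \<open>G\<close> boxes. If the cheapest box of an
  unassigned client were above it, the boxes above \<open>g\<close> would violate Hall's condition.\<close>

lemma price_le:
  assumes inv: "auction_inv H p P" and j0: "j0 < n" "H j0 = 0"
    and cheap: "\<And>b. b < G \<Longrightarrow> 0 < W j0 b \<Longrightarrow> v \<le> P b"
  shows "v \<le> G"
proof (rule ccontr)
  assume "\<not> v \<le> G"
  have "\<exists>g\<le>G. g \<notin> P ` {..<G}"
  proof (rule ccontr)
    assume "\<not> ?thesis"
    then have "{..G} \<subseteq> P ` {..<G}" by auto
    then have "card {..G} \<le> card (P ` {..<G})" by (intro card_mono) auto
    also have "\<dots> \<le> G" using card_image_le[of "{..<G}" P] by simp
    finally show False by simp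
  qed
  then obtain g where g: "g \<le> G" "\<And>b. b < G \<Longrightarrow> P b \<noteq> g" by auto
  define R where "R = {b. b < G \<and> g < P b}"
  define J where "J = {j. j < n \<and> (\<exists>b\<in>R. H j = Suc b)}"
  have fin: "finite R" "finite J" by (auto simp: R_def J_def)
  \<comment> \<open>The clients of \<open>J\<close> can use no box below the gap: their level
    exceeds \<open>g\<close>, so slackness leaves only prices of at least \<open>g\<close>, and no
    box has price \<open>g\<close>.\<close>
  have nbR: "b \<in> R" if nb: "j \<in> insert j0 J" "b < G" "0 < W j b" for j b
  proof (cases "j = j0")
    case True
    then have "v \<le> P b" using cheap that by simp
    then show ?thesis using \<open>\<not> v \<le> G\<close> g(1) that by (simp add: R_def)
  next
    case False
    then obtain b' where b': "j < n" "b' < G" "g < P b'" "H j = Suc b'"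
      using nb(1) unfolding J_def R_def by blast
    then have "P b' \<le> p j" "p j \<le> Suc (P b)"
      using inv that unfolding auction_inv_def by blast+
    then have "g \<le> P b" using b' by simp
    then show ?thesis using g(2)[of b] that by (simp add: R_def)
  qed
  have J_n: "\<And>j. j \<in> insert j0 J \<Longrightarrow> j < n" using j0 by (auto simp: J_def)
  have j0J: "j0 \<notin> J" using j0 by (auto simp: J_def)
  have "(\<Sum>j\<in>insert j0 J. \<delta>) \<le> (\<Sum>j\<in>insert j0 J. \<Sum>b\<in>R. W j b)"
  proof (rule sum_mono)
    fix j assume j: "j \<in> insert j0 J"
    have "(\<Sum>b<G. W j b) = (\<Sum>b\<in>R. W j b)"
    proof (rule sum.mono_neutral_right)
      show "\<forall>b\<in>{..<G} - R. W j b = 0"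
        using nbR[OF j] W_nonneg[OF J_n[OF j]] by (metis DiffD1 DiffD2 lessThan_iff order_le_less)
    qed (auto simp: R_def)
    then show "\<delta> \<le> (\<Sum>b\<in>R. W j b)" using W_total[OF J_n[OF j]] by simp
  qed
  also have "\<dots> = (\<Sum>b\<in>R. \<Sum>j\<in>insert j0 J. W j b)" by (rule sum.swap)
  also have "\<dots> \<le> (\<Sum>b\<in>R. capacity b)"
    unfolding capacity_def
    by (intro sum_mono sum_mono2) (use J_n W_nonneg in \<open>auto simp: R_def\<close>)
  \<comment> \<open>Boxes above the gap have positive price and hence are full.\<close>
  also have "\<dots> \<le> (\<Sum>b\<in>R. of_nat (occupancy H b) * \<delta>)"
  proof (rule sum_mono)
    fix b assume "b \<in> R"
    then have "P b \<noteq> 0" "b < G" by (auto simp: R_def)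
    then show "capacity b \<le> of_nat (occupancy H b) * \<delta>"
      using inv unfolding auction_inv_def by (meson not_le)
  qed
  also have "\<dots> = of_nat (\<Sum>b\<in>R. occupancy H b) * \<delta>" by (simp add: sum_distrib_right)
  also have "(\<Sum>b\<in>R. occupancy H b) = card J"
  proof -
    have "J = (\<Union>b\<in>R. {j. j < n \<and> H j = Suc b})" by (auto simp: J_def)
    then show ?thesis
      unfolding occupancy_def using fin by (simp add: card_UN_disjoint disjoint_iff)
  qed
  finally have "of_nat (Suc (card J)) * \<delta> \<le> of_nat (card J) * \<delta>" using fin j0J by simp
  then show False using \<delta>_pos by (simp add: algebra_simps)
qed

section \<open>The three outcomes of a bid\<close>

lemma occupancy_insert:
  assumes "j < n" "H j = 0"
  shows "occupancy (H(j := Suc b)) b' = occupancy H b' + (if b' = b then 1 else 0)"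
proof -
  have "{i. i < n \<and> (H(j := Suc b)) i = Suc b'} =
      (if b' = b then insert j {i. i < n \<and> H i = Suc b'} else {i. i < n \<and> H i = Suc b'})"
    using assms by auto
  then show ?thesis using assms by (auto simp: occupancy_def)
qed

lemma occupancy_replace:
  assumes "j < n" "H j = 0" "v < n" "H v = Suc b"
  shows "occupancy (H(v := 0, j := Suc b)) b' = occupancy H b'"
proof -
  have eq: "{i. i < n \<and> (H(v := 0, j := Suc b)) i = Suc b'} =
      (if b' = b then insert j ({i. i < n \<and> H i = Suc b'} - {v}) else {i. i < n \<and> H i = Suc b'})"
    using assms by auto
  show ?thesis
    using assms card_Suc_Diff1[of "{i. i < n \<and> H i = Suc b}" v] unfolding occupancy_def eq
    by (auto simp del: card_Diff_insert)
qed

context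
  fixes H p P j b
  assumes inv: "auction_inv H p P" and j: "j < n" "H j = 0"
    and b: "b < G" "0 < W j b"
    and cheap: "\<And>b'. b' < G \<Longrightarrow> 0 < W j b' \<Longrightarrow> P b \<le> P b'"
begin

lemma cheapest_price_le: "P b \<le> G"
  using price_le[OF inv j cheap] .

text \<open>A box with room has price 0. The client rises from level 0 to level 1 and nobody else
  moves.\<close>

lemma auction_assign:
  assumes room: "of_nat (occupancy H b) * \<delta> < capacity b"
  shows "auction_inv (H(j := Suc b)) (p(j := Suc (P b))) P"
    and "potential (p(j := Suc (P b))) P > potential p P"
proof -
  have P0: "P b = 0" using inv room b unfolding auction_inv_def by blast
  have pj: "p j = 0" using inv j unfolding auction_inv_def by blast
  show "auction_inv (H(j := Suc b)) (p(j := Suc (P b))) P"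
    using inv j b cheap room P0 unfolding auction_inv_def
    by (auto simp: occupancy_insert algebra_simps split: if_splits)
  have "(\<Sum>i<n. p i) < (\<Sum>i<n. (p(j := Suc (P b))) i)"
    by (rule sum_strict_mono_ex1) (use j pj in auto)
  then show "potential (p(j := Suc (P b))) P > potential p P" by (simp add: potential_def)
qed

text \<open>An occupant at level \<open>P b\<close> entered at a lower price and may be displaced by
  a client at level \<open>P b + 1\<close>. The potential loses \<open>P b\<close> and gains
  \<open>P b + 1\<close>.\<close>

lemma auction_evict:
  assumes v: "v < n" "H v = Suc b" "p v = P b"
  shows "auction_inv (H(v := 0, j := Suc b)) (p(v := 0, j := Suc (P b))) P"
    and "potential (p(v := 0, j := Suc (P b))) P > potential p P"
proof -
  have vj: "v \<noteq> j" using v j by auto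
  have pj: "p j = 0" using inv j unfolding auction_inv_def by blast
  show "auction_inv (H(v := 0, j := Suc b)) (p(v := 0, j := Suc (P b))) P"
    using inv j b cheap v vj cheapest_price_le unfolding auction_inv_def
    by (auto simp: occupancy_replace)
  have "(\<Sum>i<n. (p(v := 0, j := Suc (P b))) i) = Suc (P b) + (\<Sum>i\<in>{..<n}-{j}-{v}. p i)"
    using v j vj by (simp add: sum.remove[of _ j] sum.remove[of _ v])
  moreover have "(\<Sum>i<n. p i) = P b + (\<Sum>i\<in>{..<n}-{j}-{v}. p i)"
    using v j vj pj by (simp add: sum.remove[of _ j] sum.remove[of _ v])
  ultimately show "potential (p(v := 0, j := Suc (P b))) P > potential p P"
    by (simp add: potential_def)
qed

text \<open>All occupants are above level \<open>P b\<close>, so \<open>P b \<le> p v\<close>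
  survives the raise. Fullness justifies a positive price, and the bound \<open>G\<close> on the
  price of the cheapest box keeps the new one within \<open>Suc G\<close>.\<close>

lemma auction_raise:
  assumes full: "\<not> of_nat (occupancy H b) * \<delta> < capacity b"
    and none: "\<And>v. v < n \<Longrightarrow> H v = Suc b \<Longrightarrow> p v \<noteq> P b"
  shows "auction_inv H p (P(b := Suc (P b)))"
    and "potential p (P(b := Suc (P b))) > potential p P"
proof -
  have gt: "Suc (P b) \<le> p v" if "v < n" "H v = Suc b" for v
    using inv that none[OF that] unfolding auction_inv_def
    by (metis le_neq_implies_less Suc_leI)
  show "auction_inv H p (P(b := Suc (P b)))"
    using inv full gt cheapest_price_le unfolding auction_inv_def
    by (auto intro: le_SucI)
  have "(\<Sum>i<G. P i) < (\<Sum>i<G. (P(b := Suc (P b))) i)"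
    by (rule sum_strict_mono_ex1) (use b in auto)
  then show "potential p (P(b := Suc (P b))) > potential p P" by (simp add: potential_def)
qed

end

end

section \<open>Rounding the fractional solution\<close>

text \<open>Points are numbered by their positions in the input, so client \<open>j\<close> is the
  point \<open>m + j\<close>. All data are rational because the machine computes with rationals;
  \<open>of_rat\<close> carries the results back to the reals.\<close>

locale star_lp =
  fixes m n :: nat and d :: "nat \<Rightarrow> nat \<Rightarrow> rat" and x :: "nat \<Rightarrow> nat \<Rightarrow> rat"
    and y :: "nat \<Rightarrow> rat" and T k \<epsilon> :: rat
  assumes d_nonneg: "p < m + n \<Longrightarrow> q < m + n \<Longrightarrow> 0 \<le> d p q"
    and d_refl: "p < m + n \<Longrightarrow> d p p = 0"
    and d_sym: "p < m + n \<Longrightarrow> q < m + n \<Longrightarrow> d p q = d q p"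
    and d_triangle: "p < m + n \<Longrightarrow> q < m + n \<Longrightarrow> r < m + n \<Longrightarrow> d p r \<le> d p q + d q r"
    and T_pos: "0 < T" and k_pos: "0 < k" and \<epsilon>_pos: "0 < \<epsilon>" and \<epsilon>_less_1: "\<epsilon> < 1"
    and load_le: "i < m \<Longrightarrow> (\<Sum>j<n. d i (m + j) * x i j) \<le> T * y i"
    and y_sum: "(\<Sum>i<m. y i) \<le> k"
    and x_sum: "j < n \<Longrightarrow> (\<Sum>i<m. x i j) = 1"
    and x_le_y: "i < m \<Longrightarrow> j < n \<Longrightarrow> x i j \<le> y i"
    and y_nonneg: "i < m \<Longrightarrow> 0 \<le> y i" and y_le_1: "i < m \<Longrightarrow> y i \<le> 1"
    and x_nonneg: "i < m \<Longrightarrow> j < n \<Longrightarrow> 0 \<le> x i j"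
    and x_far: "i < m \<Longrightarrow> j < n \<Longrightarrow> T < d i (m + j) \<Longrightarrow> x i j = 0"
begin

text \<open>A single client already receives total mass 1 from values below \<open>y\<close>. This
  is the source of balls with mass at least \<open>1 - \<epsilon> / 3\<close>.\<close>

lemma y_sum_ge_1: "0 < n \<Longrightarrow> 1 \<le> (\<Sum>i<m. y i)"
  using x_sum[of 0] sum_mono[of "{..<m}" "\<lambda>i. x i 0" y] x_le_y[of _ 0] by force

section \<open>Balls, radii and discarded assignments\<close>

definition open_mass :: "nat \<Rightarrow> rat \<Rightarrow> rat" where
  "open_mass i \<rho> = (\<Sum>i'<m. if d i i' < \<rho> then y i' else 0)"

definition ball_mass :: "nat \<Rightarrow> rat \<Rightarrow> rat" where
  "ball_mass i \<rho> = (\<Sum>i'<m. if d i i' \<le> \<rho> then y i' else 0)"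

primrec radius_upto :: "nat \<Rightarrow> nat \<Rightarrow> rat" where
  "radius_upto i 0 = 0"
| "radius_upto i (Suc l) =
     (if open_mass i (d i l) < 1 - \<epsilon> / 3 \<and> radius_upto i l < d i l then d i l else radius_upto i l)"

text \<open>The least radius whose closed ball around \<open>i\<close> has mass at least \<open>1 - \<epsilon>/3\<close>, computed as the
  greatest distance from \<open>i\<close> whose open ball is lighter than that.\<close>

definition radius :: "nat \<Rightarrow> rat" where
  "radius i = radius_upto i m"

lemma radius_upto_nonneg: "i < m \<Longrightarrow> l \<le> m \<Longrightarrow> 0 \<le> radius_upto i l"
  by (induction l) (auto simp: d_nonneg)

lemma radius_nonneg: "i < m \<Longrightarrow> 0 \<le> radius i"
  by (simp add: radius_def radius_upto_nonneg)

lemma le_radius_upto: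
  "l' < l \<Longrightarrow> open_mass i (d i l') < 1 - \<epsilon> / 3 \<Longrightarrow> d i l' \<le> radius_upto i l"
  by (induction l) (auto simp: less_Suc_eq)

lemma radius_upto_cases:
  "radius_upto i l = 0 \<or>
    (\<exists>l'<l. radius_upto i l = d i l' \<and> open_mass i (d i l') < 1 - \<epsilon> / 3)"
  by (induction l) (auto simp: less_Suc_eq)

text \<open>A positive \<open>radius i\<close> is a distance whose open ball is too light, and for
  smaller \<open>\<rho>\<close> the closed ball lies inside that open ball.\<close>

lemma radius_le:
  assumes "0 \<le> \<rho>" "1 - \<epsilon> / 3 \<le> ball_mass i \<rho>"
  shows "radius i \<le> \<rho>"
proof (rule ccontr)
  assume gt: "\<not> radius i \<le> \<rho>"
  then have "open_mass i (radius i) < 1 - \<epsilon> / 3"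
    using radius_upto_cases[of i m] assms(1) by (auto simp: radius_def)
  moreover have "ball_mass i \<rho> \<le> open_mass i (radius i)"
    unfolding ball_mass_def open_mass_def by (intro sum_mono) (use gt y_nonneg in auto)
  ultimately show False using assms(2) by simp
qed

text \<open>Were the closed ball too light, so would be the open ball that reaches to the nearest
  facility outside. The distance of this facility would then have been a candidate for the
  maximum.\<close>

lemma ball_mass_radius:
  assumes "i < m" "0 < n"
  shows "1 - \<epsilon> / 3 \<le> ball_mass i (radius i)"
proof (rule ccontr)
  assume lt: "\<not> ?thesis"
  define Z where "Z = {i'. i' < m \<and> radius i < d i i'}"
  have "Z \<noteq> {}"
  proof
    assume "Z = {}"
    then have "ball_mass i (radius i) = (\<Sum>i'<m. y i')"
      unfolding ball_mass_def by (intro sum.cong) (fastforce simp: Z_def)+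
    then show False using lt y_sum_ge_1[OF assms(2)] \<epsilon>_pos by simp
  qed
  moreover have "finite Z" by (simp add: Z_def)
  ultimately obtain z where z: "z \<in> Z" "\<And>z'. z' \<in> Z \<Longrightarrow> d i z \<le> d i z'"
    using arg_min_if_finite[of Z "d i"] by (metis linorder_not_le)
  have "open_mass i (d i z) \<le> ball_mass i (radius i)"
    unfolding ball_mass_def open_mass_def
    by (intro sum_mono) (use z y_nonneg in \<open>force simp: Z_def\<close>)
  then have "d i z \<le> radius i"
    using le_radius_upto[of z m i] z lt by (auto simp: radius_def Z_def)
  then show False using z by (simp add: Z_def)
qed

text \<open>The factor 2 comes from the triangle inequality through the client: facilities at
  distance at most \<open>r\<close> from \<open>j\<close> are at distance at most \<open>2 r\<close>
  from each other.\<close>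

definition keep :: "nat \<Rightarrow> nat \<Rightarrow> bool" where
  "keep i j \<longleftrightarrow> radius i \<le> 2 * d i (m + j)"

text \<open>If the discarded facilities of \<open>j\<close> had mass above \<open>1 - \<epsilon>/3\<close>, then a ball around the farthest of
  them would contain all of them, and that facility would not have been discarded.\<close>

lemma kept_mass:
  assumes j: "j < n"
  shows "\<epsilon> / 3 \<le> (\<Sum>i<m. if keep i j then x i j else 0)"
proof (rule ccontr)
  assume lt: "\<not> ?thesis"
  define Z where "Z = {i. i < m \<and> \<not> keep i j}"
  have "(\<Sum>i<m. x i j) = (\<Sum>i<m. if keep i j then x i j else 0) + (\<Sum>i<m. if keep i j then 0 else x i j)"
    by (subst sum.distrib[symmetric], rule sum.cong) auto
  then have rest: "1 - \<epsilon> / 3 < (\<Sum>i<m. if keep i j then 0 else x i j)"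
    using lt x_sum[OF j] by simp
  have "Z \<noteq> {}"
  proof
    assume "Z = {}"
    then have "(\<Sum>i<m. if keep i j then 0 else x i j) = 0" by (auto simp: Z_def)
    then show False using rest \<epsilon>_less_1 by simp
  qed
  moreover have "finite Z" by (simp add: Z_def)
  ultimately obtain z where z: "z \<in> Z" "\<And>i. i \<in> Z \<Longrightarrow> d i (m + j) \<le> d z (m + j)"
    using arg_min_if_finite[of Z "\<lambda>i. - d i (m + j)"] by (metis linorder_not_le neg_less_iff_less)
  have zm: "z < m" using z by (simp add: Z_def)
  have "(\<Sum>i<m. if keep i j then 0 else x i j) \<le> ball_mass z (2 * d z (m + j))"
    unfolding ball_mass_def
  proof (intro sum_mono)
    fix i assume "i \<in> {..<m}"
    then have i: "i < m" by simp
    show "(if keep i j then 0 else x i j) \<le> (if d z i \<le> 2 * d z (m + j) then y i else 0)"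
    proof (cases "keep i j")
      case False
      then have "d i (m + j) \<le> d z (m + j)" using z(2) i by (simp add: Z_def)
      moreover have "d z i \<le> d z (m + j) + d (m + j) i" using d_triangle i j zm by simp
      moreover have "d (m + j) i = d i (m + j)" using d_sym i j by simp
      ultimately show ?thesis using False x_le_y[OF i j] by simp
    qed (use y_nonneg[OF i] in auto)
  qed
  then have "radius z \<le> 2 * d z (m + j)"
    using rest d_nonneg[of z "m + j"] zm j by (intro radius_le) auto
  then show False using z by (simp add: Z_def keep_def)
qed

section \<open>Greedy clustering\<close>

text \<open>A state \<open>c\<close> of the greedy clustering maps \<open>i\<close> to \<open>Suc s\<close> if \<open>i\<close> belongs to the cluster with
  centre \<open>s\<close>, and to \<open>0\<close> if \<open>i\<close> is not yet processed.\<close>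

definition cluster_mass :: "(nat \<Rightarrow> nat) \<Rightarrow> nat \<Rightarrow> rat" where
  "cluster_mass c s = (\<Sum>i<m. if c i = Suc s then y i else 0)"

text \<open>\<open>t\<close> counts the processed facilities. The mass bound exceeds
  \<open>3 / \<epsilon>\<close> by 1 because the last facility to join may overshoot by
  \<open>y i \<le> 1\<close>. Separation concerns light centres only: a heavy cluster admits nobody,
  so a new centre may arise next to it.\<close>

definition cluster_inv :: "nat \<Rightarrow> (nat \<Rightarrow> nat) \<Rightarrow> bool" where
  "cluster_inv t c \<longleftrightarrow>
     card {i. i < m \<and> c i \<noteq> 0} = t \<and>
     (\<forall>i<m. \<forall>s. c i = Suc s \<longrightarrow> s < m \<and> c s = Suc s \<and> d i s \<le> 2 * radius i) \<and>
     (\<forall>i<m. \<forall>i'<m. c i \<noteq> 0 \<longrightarrow> c i' = 0 \<longrightarrow> radius i \<le> radius i') \<and>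
     (\<forall>s<m. cluster_mass c s \<le> 3 / \<epsilon> + 1) \<and>
     (\<forall>s<m. \<forall>s'<m. c s = Suc s \<longrightarrow> c s' = Suc s' \<longrightarrow> s \<noteq> s' \<longrightarrow>
        cluster_mass c s * \<epsilon> < 3 \<longrightarrow> cluster_mass c s' * \<epsilon> < 3 \<longrightarrow> radius s + radius s' < d s s')"

lemma
  assumes "cluster_inv t c"
  shows cluster_inv_card: "card {i. i < m \<and> c i \<noteq> 0} = t"
    and cluster_inv_centre: "i < m \<Longrightarrow> c i = Suc s \<Longrightarrow> s < m \<and> c s = Suc s \<and> d i s \<le> 2 * radius i"
    and cluster_inv_order: "i < m \<Longrightarrow> i' < m \<Longrightarrow> c i \<noteq> 0 \<Longrightarrow> c i' = 0 \<Longrightarrow> radius i \<le> radius i'"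
    and cluster_inv_mass: "s < m \<Longrightarrow> cluster_mass c s \<le> 3 / \<epsilon> + 1"
    and cluster_inv_apart: "s < m \<Longrightarrow> s' < m \<Longrightarrow> c s = Suc s \<Longrightarrow> c s' = Suc s' \<Longrightarrow> s \<noteq> s' \<Longrightarrow>
      cluster_mass c s * \<epsilon> < 3 \<Longrightarrow> cluster_mass c s' * \<epsilon> < 3 \<Longrightarrow> radius s + radius s' < d s s'"
  using assms unfolding cluster_inv_def by blast+

lemma cluster_inv_start: "cluster_inv 0 (\<lambda>_. 0)"
  using \<epsilon>_pos by (auto simp: cluster_inv_def cluster_mass_def)

lemma cluster_mass_update:
  assumes "i < m" "c i = 0"
  shows "cluster_mass (c(i := Suc s)) s' = cluster_mass c s' + (if s' = s then y i else 0)"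
proof -
  have "cluster_mass (c(i := Suc s)) s' =
      (\<Sum>l<m. (if c l = Suc s' then y l else 0) + (if l = i then if s' = s then y i else 0 else 0))"
    unfolding cluster_mass_def by (intro sum.cong) (use assms in auto)
  also have "\<dots> = cluster_mass c s' + (if s' = s then y i else 0)"
    using assms by (simp add: sum.distrib cluster_mass_def)
  finally show ?thesis .
qed

text \<open>Members of a cluster refer to a processed centre. A new centre therefore starts from
  mass 0, below the cap.\<close>

lemma cluster_mass_unprocessed:
  assumes "cluster_inv t c" "i < m" "c i = 0"
  shows "cluster_mass c i = 0"
  unfolding cluster_mass_def
proof (intro sum.neutral ballI)
  fix l assume "l \<in> {..<m}"
  then show "(if c l = Suc i then y l else 0) = 0"
    using cluster_inv_centre[OF assms(1), of l i] assms(3) by (auto split: if_splits)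
qed

lemma cluster_inv_step:
  assumes inv: "cluster_inv t c" and i: "i < m" "c i = 0"
    and least: "\<And>i'. i' < m \<Longrightarrow> c i' = 0 \<Longrightarrow> radius i \<le> radius i'"
    and s: "s < m \<and> c s = Suc s \<and> cluster_mass c s * \<epsilon> < 3 \<and> d i s \<le> 2 * radius i \<or>
      s = i \<and> (\<forall>s'<m. c s' = Suc s' \<longrightarrow> cluster_mass c s' * \<epsilon> < 3 \<longrightarrow> 2 * radius i < d i s')"
  shows "cluster_inv (Suc t) (c(i := Suc s))"
proof -
  let ?c = "c(i := Suc s)"
  have card: "card {l. l < m \<and> ?c l \<noteq> 0} = Suc t"
  proof -
    have "{l. l < m \<and> ?c l \<noteq> 0} = insert i {l. l < m \<and> c l \<noteq> 0}" using i by auto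
    then show ?thesis using cluster_inv_card[OF inv] i by simp
  qed
  have centre: "s < m \<and> d i s \<le> 2 * radius i \<and> ?c s = Suc s"
    using s i d_refl[of i] radius_nonneg[of i] by auto
  have a: "\<forall>l<m. \<forall>u. ?c l = Suc u \<longrightarrow> u < m \<and> ?c u = Suc u \<and> d l u \<le> 2 * radius l"
  proof (intro allI impI)
    fix l u assume l: "l < m" "?c l = Suc u"
    show "u < m \<and> ?c u = Suc u \<and> d l u \<le> 2 * radius l"
    proof (cases "l = i")
      case False
      then have "u < m \<and> c u = Suc u \<and> d l u \<le> 2 * radius l"
        using cluster_inv_centre[OF inv, of l u] l by simp
      then show ?thesis using i by (metis fun_upd_other nat.distinct(1))
    qed (use l centre in auto)
  qed
  have b: "\<forall>l<m. \<forall>l'<m. ?c l \<noteq> 0 \<longrightarrow> ?c l' = 0 \<longrightarrow> radius l \<le> radius l'"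
    using cluster_inv_order[OF inv] least i by auto
  have e: "cluster_mass c s \<le> 3 / \<epsilon>"
  proof -
    have "cluster_mass c s * \<epsilon> \<le> 3"
      using s cluster_mass_unprocessed[OF inv i] by auto
    then show ?thesis using \<epsilon>_pos by (simp add: field_simps)
  qed
  have f: "\<forall>u<m. cluster_mass ?c u \<le> 3 / \<epsilon> + 1"
    using cluster_inv_mass[OF inv] e y_le_1[OF i(1)] \<epsilon>_pos
    unfolding cluster_mass_update[of i c s, OF i] by auto
  \<comment> \<open>Masses only grow, so a cluster that is light after the step was light before it,
    and old pairs of light centres stay separated.\<close>
  have mono: "cluster_mass c u \<le> cluster_mass ?c u" for u
    using y_nonneg[OF i(1)] by (simp add: cluster_mass_update[of i c s, OF i])
  have old: "radius u + radius u' < d u u'"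
    if "u < m" "u' < m" "c u = Suc u" "c u' = Suc u'" "u \<noteq> u'"
      "cluster_mass ?c u * \<epsilon> < 3" "cluster_mass ?c u' * \<epsilon> < 3" for u u'
  proof -
    have "cluster_mass c u * \<epsilon> < 3" "cluster_mass c u' * \<epsilon> < 3"
      using that(6,7) mono \<epsilon>_pos by (meson le_less_trans mult_right_mono less_imp_le)+
    then show ?thesis using cluster_inv_apart[OF inv] that by blast
  qed
  \<comment> \<open>The order of processing gives \<open>radius u \<le> radius i\<close>; together
    with the refusal \<open>2 * radius i < d i u\<close> this yields separation.\<close>
  have new: "radius i + radius u < d i u"
    if "s = i" "u < m" "c u = Suc u" "cluster_mass ?c u * \<epsilon> < 3" for u
  proof -
    have "cluster_mass c u * \<epsilon> < 3"
      using that(4) mono \<epsilon>_pos by (meson le_less_trans mult_right_mono less_imp_le)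
    then have "2 * radius i < d i u" using s that i by auto
    moreover have "radius u \<le> radius i" using cluster_inv_order[OF inv that(2) i(1)] i that by simp
    ultimately show ?thesis by simp
  qed
  have g: "\<forall>u<m. \<forall>u'<m. ?c u = Suc u \<longrightarrow> ?c u' = Suc u' \<longrightarrow> u \<noteq> u' \<longrightarrow>
        cluster_mass ?c u * \<epsilon> < 3 \<longrightarrow> cluster_mass ?c u' * \<epsilon> < 3 \<longrightarrow> radius u + radius u' < d u u'"
  proof (intro allI impI)
    fix u u' assume h: "u < m" "u' < m" "?c u = Suc u" "?c u' = Suc u'" "u \<noteq> u'"
      "cluster_mass ?c u * \<epsilon> < 3" "cluster_mass ?c u' * \<epsilon> < 3"
    consider "u \<noteq> i" "u' \<noteq> i" | "u = i" "u' \<noteq> i" | "u \<noteq> i" "u' = i" using h by auto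
    then show "radius u + radius u' < d u u'"
    proof cases
      case 1
      then show ?thesis using old h by auto
    next
      case 2
      then show ?thesis using new[of u'] h by auto
    next
      case 3
      then show ?thesis using new[of u] h d_sym[of u u'] by (auto simp: add.commute)
    qed
  qed
  show ?thesis unfolding cluster_inv_def using card a b f g by blast
qed

lemma cluster_inv_all:
  assumes "cluster_inv m c" "i < m"
  shows "c i \<noteq> 0"
proof -
  have "{i. i < m \<and> c i \<noteq> 0} = {..<m}"
    by (rule card_subset_eq) (use cluster_inv_card[OF assms(1)] in auto)
  then show ?thesis using assms(2) by auto
qed

text \<open>Heavy clusters have mass at least \<open>3/\<epsilon>\<close> each; the balls around the centres of the light ones
  are disjoint and have mass at least \<open>1 - \<epsilon>/3\<close> each.\<close>

lemma card_centres:
  assumes inv: "cluster_inv m c" and n: "0 < n"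
  shows "of_nat (card {s. s < m \<and> c s = Suc s}) \<le> (1 + \<epsilon>) * k"
proof -
  define S where "S = {s. s < m \<and> c s = Suc s}"
  define L where "L = {s\<in>S. cluster_mass c s * \<epsilon> < 3}"
  define A where "A = S - L"
  have fin: "finite S" "finite L" "finite A" by (auto simp: S_def L_def A_def)
  have "of_nat (card A) * (3 / \<epsilon>) \<le> (\<Sum>s\<in>A. cluster_mass c s)"
  proof -
    have "(\<Sum>s\<in>A. 3 / \<epsilon>) \<le> (\<Sum>s\<in>A. cluster_mass c s)"
      by (intro sum_mono) (use \<epsilon>_pos in \<open>auto simp: A_def L_def S_def field_simps\<close>)
    then show ?thesis by simp
  qed
  also have "\<dots> = (\<Sum>i<m. \<Sum>s\<in>A. if c i = Suc s then y i else 0)"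
    unfolding cluster_mass_def by (rule sum.swap)
  also have "\<dots> \<le> (\<Sum>i<m. y i)"
  proof (intro sum_mono)
    fix i assume i: "i \<in> {..<m}"
    \<comment> \<open>At most one cluster contains \<open>i\<close>, and its centre is
      \<open>c i - 1\<close>. For \<open>c i = 0\<close> the filtered set is empty and the truncated
      difference only enlarges the bound.\<close>
    have "(\<Sum>s\<in>A. if c i = Suc s then y i else 0) \<le> (\<Sum>s\<in>{c i - 1}. y i)"
      by (subst sum.inter_filter[symmetric, OF fin(3)], rule sum_mono2) (use y_nonneg i in auto)
    then show "(\<Sum>s\<in>A. if c i = Suc s then y i else 0) \<le> y i" by simp
  qed
  also have "\<dots> \<le> k" by (rule y_sum)
  finally have A: "of_nat (card A) \<le> (\<epsilon> / 3) * k" using \<epsilon>_pos by (simp add: field_simps)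
  have "of_nat (card L) * (1 - \<epsilon> / 3) \<le> (\<Sum>s\<in>L. ball_mass s (radius s))"
  proof -
    have "(\<Sum>s\<in>L. 1 - \<epsilon> / 3) \<le> (\<Sum>s\<in>L. ball_mass s (radius s))"
      by (intro sum_mono ball_mass_radius) (use n in \<open>auto simp: L_def S_def\<close>)
    then show ?thesis by simp
  qed
  also have "\<dots> = (\<Sum>i<m. \<Sum>s\<in>L. if d s i \<le> radius s then y i else 0)"
    unfolding ball_mass_def by (rule sum.swap)
  also have "\<dots> \<le> (\<Sum>i<m. y i)"
  proof (intro sum_mono)
    fix i assume "i \<in> {..<m}"
    then have i: "i < m" by simp
    have uniq: "s = s'" if h: "s \<in> L" "s' \<in> L" "d s i \<le> radius s" "d s' i \<le> radius s'" for s s'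
    proof (rule ccontr)
      assume "s \<noteq> s'"
      then have "radius s + radius s' < d s s'"
        using cluster_inv_apart[OF inv] h unfolding L_def S_def by blast
      moreover have "d s s' \<le> d s i + d i s'" "d i s' = d s' i"
        using h i d_triangle[of s i s'] d_sym[of i s'] by (auto simp: L_def S_def)
      ultimately show False using h by simp
    qed
    have "(\<Sum>s\<in>L. if d s i \<le> radius s then y i else 0) = of_nat (card {s\<in>L. d s i \<le> radius s}) * y i"
      by (subst sum.inter_filter[symmetric, OF fin(2)]) simp
    also have "\<dots> \<le> 1 * y i"
    proof (intro mult_right_mono)
      have "card {s\<in>L. d s i \<le> radius s} \<le> 1"
        by (subst card_le_Suc0_iff_eq[unfolded One_nat_def[symmetric]]) (use fin uniq in auto)
      then show "of_nat (card {s\<in>L. d s i \<le> radius s}) \<le> (1::rat)" by simp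
    qed (use y_nonneg i in auto)
    finally show "(\<Sum>s\<in>L. if d s i \<le> radius s then y i else 0) \<le> y i" by simp
  qed
  also have "\<dots> \<le> k" by (rule y_sum)
  finally have L0: "of_nat (card L) * (1 - \<epsilon> / 3) \<le> k" .
  \<comment> \<open>\<open>1 + 2 * \<epsilon> / 3\<close> is what the share
    \<open>\<epsilon> / 3\<close> of the heavy clusters leaves of \<open>1 + \<epsilon>\<close>. The
    claim amounts to \<open>0 \<le> k * \<epsilon> * (3 - 2 * \<epsilon>)\<close>.\<close>
  have "k \<le> (1 + 2 * \<epsilon> / 3) * k * (1 - \<epsilon> / 3)"
  proof -
    have "0 \<le> k * \<epsilon> * (3 - 2 * \<epsilon>)" using k_pos \<epsilon>_pos \<epsilon>_less_1 by simp
    then show ?thesis by (simp add: field_simps)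
  qed
  then have L: "of_nat (card L) \<le> (1 + 2 * \<epsilon> / 3) * k"
    using L0 \<epsilon>_less_1 by (meson diff_gt_0_iff_gt less_trans mult_right_le_imp_le order_trans
        divide_less_eq_1_pos zero_less_numeral one_less_numeral_iff semiring_norm(77))
  have "card S = card A + card L"
    unfolding A_def using fin by (subst card_Diff_subset) (auto simp: L_def card_mono)
  then have "of_nat (card S) = (of_nat (card A) + of_nat (card L) :: rat)" by simp
  also have "\<dots> \<le> (1 + \<epsilon>) * k" using A L by (simp add: algebra_simps)
  finally show ?thesis by (simp add: S_def)
qed

section \<open>Flow from clients to centres\<close>

definition flow :: "(nat \<Rightarrow> nat) \<Rightarrow> nat \<Rightarrow> nat \<Rightarrow> rat" where
  "flow c s j = (\<Sum>i<m. if c i = Suc s \<and> keep i j then x i j else 0)"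

lemma flow_nonneg: "j < n \<Longrightarrow> 0 \<le> flow c s j"
  unfolding flow_def by (intro sum_nonneg) (use x_nonneg in auto)

text \<open>After \<open>m\<close> steps each facility lies in exactly one cluster, so summing over
  the centres returns the kept mass. The flow is not rescaled; the auction works with total mass
  \<open>\<epsilon> / 3\<close> directly.\<close>

lemma flow_total:
  assumes inv: "cluster_inv m c" and j: "j < n"
  shows "\<epsilon> / 3 \<le> (\<Sum>s<m. flow c s j)"
proof -
  have "(\<Sum>s<m. flow c s j) = (\<Sum>i<m. \<Sum>s<m. if c i = Suc s \<and> keep i j then x i j else 0)"
    unfolding flow_def by (rule sum.swap)
  also have "\<dots> = (\<Sum>i<m. if keep i j then x i j else 0)"
  proof (intro sum.cong refl)
    fix i assume "i \<in> {..<m}"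
    then obtain s where s: "c i = Suc s" "s < m"
      using cluster_inv_all[OF inv, of i] cluster_inv_centre[OF inv]
      by (metis lessThan_iff not0_implies_Suc)
    then show "(\<Sum>s<m. if c i = Suc s \<and> keep i j then x i j else 0) = (if keep i j then x i j else 0)"
      by (auto simp: sum.delta)
  qed
  finally show ?thesis using kept_mass[OF j] by simp
qed

text \<open>The detour is at most \<open>2 * radius i\<close>, which \<open>keep\<close> bounds by
  \<open>4 * d i (m + j)\<close>.\<close>

lemma kept_distance:
  assumes inv: "cluster_inv m c" and "i < m" "j < n" "c i = Suc s" "keep i j"
  shows "d s (m + j) \<le> 5 * d i (m + j)"
proof -
  have s: "s < m" "d i s \<le> 2 * radius i" using cluster_inv_centre[OF inv] assms by blast+
  then have "d s (m + j) \<le> d s i + d i (m + j)" "d s i = d i s"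
    using d_triangle[of s i "m + j"] d_sym[of s i] assms by auto
  then show ?thesis using s assms by (simp add: keep_def)
qed

text \<open>Mass travels only along pairs at distance at most \<open>T\<close>. This is where the
  largest scale \<open>5 * T\<close> of the levels comes from.\<close>

lemma flow_pos:
  assumes inv: "cluster_inv m c" and j: "j < n" and pos: "0 < flow c s j"
  shows "s < m" "c s = Suc s" "d s (m + j) \<le> 5 * T"
proof -
  have "\<exists>i<m. c i = Suc s \<and> keep i j \<and> x i j \<noteq> 0"
  proof (rule ccontr)
    assume "\<not> ?thesis"
    then have "flow c s j = 0" unfolding flow_def by (intro sum.neutral) auto
    then show False using pos by simp
  qed
  then obtain i where i: "i < m" "c i = Suc s" "keep i j" "x i j \<noteq> 0" by blast
  then show "s < m" "c s = Suc s" using cluster_inv_centre[OF inv] by blast+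
  have "d i (m + j) \<le> T" using x_far[OF i(1) j] i by force
  then show "d s (m + j) \<le> 5 * T" using kept_distance[OF inv i(1) j i(2,3)] by simp
qed

text \<open>With the sums exchanged, each member \<open>i\<close> of the cluster is charged at most
  5 times its own load \<open>T * y i\<close>; what remains is the mass of the cluster.\<close>

lemma flow_load:
  assumes inv: "cluster_inv m c" and s: "s < m"
  shows "(\<Sum>j<n. d s (m + j) * flow c s j) \<le> 5 * T * (3 / \<epsilon> + 1)"
proof -
  have "(\<Sum>j<n. d s (m + j) * flow c s j) =
      (\<Sum>i<m. \<Sum>j<n. if c i = Suc s \<and> keep i j then d s (m + j) * x i j else 0)"
    unfolding flow_def sum_distrib_left
    by (subst sum.swap, intro sum.cong refl) auto
  also have "\<dots> \<le> (\<Sum>i<m. if c i = Suc s then 5 * T * y i else 0)"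
  proof (intro sum_mono)
    fix i assume "i \<in> {..<m}"
    then have i: "i < m" by simp
    show "(\<Sum>j<n. if c i = Suc s \<and> keep i j then d s (m + j) * x i j else 0) \<le>
        (if c i = Suc s then 5 * T * y i else 0)"
    proof (cases "c i = Suc s")
      case True
      have "(\<Sum>j<n. if c i = Suc s \<and> keep i j then d s (m + j) * x i j else 0) \<le>
          (\<Sum>j<n. 5 * (d i (m + j) * x i j))"
      proof (intro sum_mono)
        fix j assume "j \<in> {..<n}"
        then have j: "j < n" by simp
        show "(if c i = Suc s \<and> keep i j then d s (m + j) * x i j else 0) \<le> 5 * (d i (m + j) * x i j)"
          using kept_distance[OF inv i j True] x_nonneg[OF i j] d_nonneg[of i "m + j"] i j
            mult_right_mono[of "d s (m + j)" "5 * d i (m + j)" "x i j"] by auto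
      qed
      also have "\<dots> \<le> 5 * (T * y i)"
        using load_le[OF i] by (simp add: sum_distrib_left[symmetric])
      finally show ?thesis using True by simp
    qed auto
  qed
  also have "\<dots> = 5 * T * cluster_mass c s"
    unfolding cluster_mass_def sum_distrib_left by (intro sum.cong) auto
  also have "\<dots> \<le> 5 * T * (3 / \<epsilon> + 1)"
    using cluster_inv_mass[OF inv s] T_pos by (intro mult_left_mono) auto
  finally show ?thesis .
qed

section \<open>Dyadic levels and boxes\<close>

definition level :: "nat \<Rightarrow> nat \<Rightarrow> nat" where
  "level s j = (\<Sum>t<n. if d s (m + j) * 2 ^ Suc t \<le> 5 * T then 1 else 0)"

lemma level_le: "level s j \<le> n"
  using sum_mono[of "{..<n}" "\<lambda>t. if d s (m + j) * 2 ^ Suc t \<le> 5 * T then 1 else 0" "\<lambda>_. 1::nat"]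
  by (simp add: level_def)

text \<open>The indices that pass the test form an initial segment, so counting them finds the
  scale. The count is capped at \<open>n\<close>; in particular distance 0 has level
  \<open>n\<close>, where no lower bound on the distance is claimed.\<close>

lemma level_bounds:
  assumes "s < m" "j < n"
  shows "d s (m + j) \<le> 5 * T \<Longrightarrow> d s (m + j) * 2 ^ level s j \<le> 5 * T"
    and "level s j < n \<Longrightarrow> 5 * T < d s (m + j) * 2 ^ Suc (level s j)"
proof -
  let ?D = "d s (m + j)"
  have D: "0 \<le> ?D" using d_nonneg assms by simp
  define A where "A = {t. t < n \<and> ?D * 2 ^ Suc t \<le> 5 * T}"
  have down: "t \<in> A" if "u \<in> A" "t \<le> u" for t u
  proof -
    have "?D * 2 ^ Suc t \<le> ?D * 2 ^ Suc u"
      using that(2) D by (intro mult_left_mono power_increasing) auto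
    also have "\<dots> \<le> 5 * T" using that(1) unfolding A_def by blast
    finally show ?thesis using that unfolding A_def by simp
  qed
  have fin: "finite A" by (simp add: A_def)
  have card: "level s j = card A"
    unfolding level_def A_def by (subst sum.inter_filter[symmetric]) (auto intro: arg_cong[of _ _ card])
  have "{..<card A} = A"
  proof (rule card_subset_eq[OF fin])
    show "{..<card A} \<subseteq> A"
    proof (rule ccontr)
      assume "\<not> ?thesis"
      then obtain t where t: "t < card A" "t \<notin> A" by auto
      then have "A \<subseteq> {..<t}" using down by (metis lessThan_iff not_le subsetI)
      then have "card A \<le> t" using card_mono[of "{..<t}" A] by simp
      then show False using t by simp
    qed
  qed simp
  then have A: "t \<in> A \<longleftrightarrow> t < card A" for t by blast
  show "?D * 2 ^ level s j \<le> 5 * T" if "?D \<le> 5 * T"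
  proof (cases "card A")
    case (Suc l)
    then have "l \<in> A" using A by simp
    then show ?thesis unfolding card Suc by (simp add: A_def)
  qed (use that card in simp)
  show "5 * T < ?D * 2 ^ Suc (level s j)" if "level s j < n"
  proof -
    have "card A \<notin> A" using A by simp
    then show ?thesis using that unfolding card by (auto simp: A_def)
  qed
qed

definition box :: "nat \<Rightarrow> nat \<Rightarrow> nat" where
  "box s j = s * Suc n + level s j"

lemma box_div: "box s j div Suc n = s" and box_mod: "box s j mod Suc n = level s j"
  unfolding box_def using level_le[of s j] by (rule index_div_mod[OF le_imp_less_Suc])+

lemma box_less: "s < m \<Longrightarrow> box s j < m * Suc n"
  unfolding box_def by (rule index_less) (simp_all add: level_le le_imp_less_Suc)

lemma box_eq_iff: "box s j = box s' j' \<longleftrightarrow> s = s' \<and> level s j = level s' j'"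
  using box_div[of s j] box_div[of s' j'] box_mod[of s j] box_mod[of s' j'] by (auto simp: box_def)

text \<open>This is \<open>flow\<close> re-indexed by boxes: a client has exactly one box at each
  centre, determined by its level there.\<close>

definition weight :: "(nat \<Rightarrow> nat) \<Rightarrow> nat \<Rightarrow> nat \<Rightarrow> rat" where
  "weight c j b = (\<Sum>s<m. if box s j = b then flow c s j else 0)"

lemma weight_box: "s < m \<Longrightarrow> weight c j (box s j) = flow c s j"
  by (simp add: weight_def box_eq_iff sum.delta cong: conj_cong)

lemma weight_pos:
  assumes "j < n" "0 < weight c j b"
  obtains s where "s < m" "b = box s j" "0 < flow c s j"
proof -
  have "\<exists>s<m. box s j = b"
  proof (rule ccontr)
    assume "\<not> ?thesis"
    then have "weight c j b = 0" unfolding weight_def by (intro sum.neutral) auto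
    then show False using assms by simp
  qed
  then show ?thesis using that assms weight_box by metis
qed

lemma box_assignment:
  assumes inv: "cluster_inv m c"
  shows "box_assignment n (m * Suc n) (weight c) (\<epsilon> / 3)"
proof
  fix j b assume "j < n"
  then show "0 \<le> weight c j b"
    unfolding weight_def by (intro sum_nonneg) (simp add: flow_nonneg)
next
  fix j assume j: "j < n"
  have "(\<Sum>b<m * Suc n. weight c j b) = (\<Sum>s<m. \<Sum>b<m * Suc n. if box s j = b then flow c s j else 0)"
    unfolding weight_def by (rule sum.swap)
  also have "\<dots> = (\<Sum>s<m. flow c s j)"
    by (intro sum.cong refl) (use box_less in auto)
  finally show "\<epsilon> / 3 \<le> (\<Sum>b<m * Suc n. weight c j b)" using flow_total[OF inv j] by simp
qed (use \<epsilon>_pos in simp)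

text \<open>Every box holds less than one client more than its capacity over \<open>\<epsilon>/3\<close>. The excess clients of
  a facility cost at most \<open>5T (1 + 1/2 + 1/4 + \<dots>)\<close>, those in the last level at most \<open>5T n / 2\<^sup>n\<close>.\<close>

lemma assigned_load:
  assumes inv: "cluster_inv m c" and s: "s < m"
    and H: "\<And>j. j < n \<Longrightarrow> H j = Suc (box s j) \<Longrightarrow> 0 < flow c s j"
    and occ: "\<And>b. b < m * Suc n \<Longrightarrow>
      of_nat (card {j. j < n \<and> H j = Suc b}) * (\<epsilon> / 3) < (\<Sum>j<n. weight c j b) + \<epsilon> / 3"
  shows "(\<Sum>j<n. if H j = Suc (box s j) then d s (m + j) else 0) \<le> 135 * T / \<epsilon>\<^sup>2"
proof -
  define J where "J l = {j. j < n \<and> H j = Suc (box s j) \<and> level s j = l}" for l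
  have fin: "finite (J l)" for l by (simp add: J_def)
  have J_n: "card (J l) \<le> n" for l
    using card_mono[of "{..<n}" "J l"] by (auto simp: J_def)
  have J_D: "d s (m + j) \<le> 5 * T / 2 ^ l" if "j \<in> J l" for j l
  proof -
    have j: "j < n" "H j = Suc (box s j)" "level s j = l" using that by (auto simp: J_def)
    have "d s (m + j) * 2 ^ l \<le> 5 * T"
      using level_bounds(1)[OF s j(1)] flow_pos(3)[OF inv j(1) H[OF j(1,2)]] j(3) by simp
    then show ?thesis by (simp add: field_simps)
  qed
  define V where "V l = (\<Sum>j<n. if level s j = l then flow c s j else 0)" for l
  \<comment> \<open>The occupancy bound of a single box, divided by \<open>\<epsilon> / 3\<close>:
    the summand 1 is the excess client, and \<open>V l\<close> is the capacity of the box.\<close>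
  have J_V: "of_nat (card (J l)) \<le> 1 + V l * (3 / \<epsilon>)" if "l \<le> n" for l
  proof -
    let ?b = "s * Suc n + l"
    have b_div: "?b div Suc n = s" "?b mod Suc n = l"
      using that by (intro index_div_mod; simp)+
    have "?b < m * Suc n" using s that by (intro index_less) auto
    moreover have "J l \<subseteq> {j. j < n \<and> H j = Suc ?b}" by (auto simp: J_def box_def)
    then have "card (J l) \<le> card {j. j < n \<and> H j = Suc ?b}" by (intro card_mono) auto
    moreover have "weight c j ?b = (if level s j = l then flow c s j else 0)" for j
    proof -
      have "box s' j = ?b \<longleftrightarrow> s' = s \<and> level s j = l" for s'
        using b_div box_div[of s' j] box_mod[of s' j] by (auto simp: box_def)
      then have "weight c j ?b = (\<Sum>s'<m. if s' = s then if level s j = l then flow c s j else 0 else 0)"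
        unfolding weight_def by (intro sum.cong) auto
      then show ?thesis using s by simp
    qed
    ultimately have "of_nat (card {j. j < n \<and> H j = Suc ?b}) * (\<epsilon> / 3) < V l + \<epsilon> / 3"
      and le: "(of_nat (card (J l)) :: rat) \<le> of_nat (card {j. j < n \<and> H j = Suc ?b})"
      using occ[of ?b] unfolding V_def by simp_all
    moreover have "of_nat (card (J l)) * (\<epsilon> / 3) \<le> of_nat (card {j. j < n \<and> H j = Suc ?b}) * (\<epsilon> / 3)"
      using le \<epsilon>_pos by (intro mult_right_mono) auto
    ultimately have "of_nat (card (J l)) * (\<epsilon> / 3) \<le> V l + \<epsilon> / 3" by linarith
    then show ?thesis using \<epsilon>_pos by (simp add: field_simps)
  qed
  have V_nonneg: "0 \<le> V l" for l
    unfolding V_def by (intro sum_nonneg) (simp add: flow_nonneg)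
  \<comment> \<open>Splits a sum over clients by level. It serves twice: with the clients placed at
    \<open>s\<close>, and with the trivial condition True for the whole flow.\<close>
  have group: "(\<Sum>j<n. f j * (if P j then 1 else 0)) = (\<Sum>l\<le>n. \<Sum>j<n. if P j \<and> level s j = l then f j else 0)"
    for f :: "nat \<Rightarrow> rat" and P
  proof (subst sum.swap, intro sum.cong refl)
    fix j
    have "(\<Sum>l\<le>n. if P j \<and> level s j = l then f j else 0) = (\<Sum>l\<le>n. if l = level s j then if P j then f j else 0 else 0)"
      by (intro sum.cong) auto
    then show "f j * (if P j then 1 else 0) = (\<Sum>l\<le>n. if P j \<and> level s j = l then f j else 0)"
      using level_le[of s j] by simp
  qed
  have "(\<Sum>j<n. if H j = Suc (box s j) then d s (m + j) else 0) =
      (\<Sum>j<n. d s (m + j) * (if H j = Suc (box s j) then 1 else 0))" by (intro sum.cong) auto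
  also have "\<dots> = (\<Sum>l\<le>n. \<Sum>j\<in>J l. d s (m + j))"
  proof -
    have "J l = {j \<in> {..<n}. H j = Suc (box s j) \<and> level s j = l}" for l by (auto simp: J_def)
    then show ?thesis unfolding group by (simp only: sum.inter_filter[OF finite_lessThan])
  qed
  also have "\<dots> \<le> (\<Sum>l\<le>n. of_nat (card (J l)) * (5 * T / 2 ^ l))"
    by (intro sum_mono sum_bounded_above J_D)
  also have "\<dots> = (\<Sum>l<n. of_nat (card (J l)) * (5 * T / 2 ^ l)) + of_nat (card (J n)) * (5 * T / 2 ^ n)"
    by (simp add: lessThan_Suc_atMost[symmetric])
  \<comment> \<open>The lower end of level \<open>l\<close> is \<open>5 * T / 2 ^ Suc l\<close>;
    passing to it doubles the factor \<open>5 * 3\<close> to 30.\<close>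
  also have "\<dots> \<le> (\<Sum>l<n. 5 * T / 2 ^ l + 30 * T / \<epsilon> * (V l / 2 ^ Suc l)) + 5 * T"
  proof (intro add_mono sum_mono)
    fix l assume "l \<in> {..<n}"
    then have "of_nat (card (J l)) * (5 * T / 2 ^ l) \<le> (1 + V l * (3 / \<epsilon>)) * (5 * T / 2 ^ l)"
      using J_V[of l] T_pos by (intro mult_right_mono) auto
    then show "of_nat (card (J l)) * (5 * T / 2 ^ l) \<le> 5 * T / 2 ^ l + 30 * T / \<epsilon> * (V l / 2 ^ Suc l)"
      using \<epsilon>_pos by (simp add: field_simps)
  next
    \<comment> \<open>The last level has no lower distance bound to charge against, but its at most
      \<open>n \<le> 2 ^ n\<close> clients cost \<open>5 * T\<close> in total.\<close>
    have "of_nat (card (J n)) \<le> (2 ^ n :: rat)"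
      using J_n[of n] of_nat_less_two_power[of n] by (metis less_le_trans less_imp_le of_nat_mono order_trans)
    then have "of_nat (card (J n)) * (5 * T / 2 ^ n) \<le> 2 ^ n * (5 * T / 2 ^ n)"
      using T_pos by (intro mult_right_mono) auto
    then show "of_nat (card (J n)) * (5 * T / 2 ^ n) \<le> 5 * T" by simp
  qed
  also have "\<dots> = 5 * T * (\<Sum>l<n. (1 / 2) ^ l) + (30 / \<epsilon>) * (\<Sum>l<n. T * V l / 2 ^ Suc l) + 5 * T"
    by (simp add: sum.distrib sum_distrib_left power_divide algebra_simps)
  also have "\<dots> \<le> 5 * T * 2 + (30 / \<epsilon>) * (T * (3 / \<epsilon> + 1)) + 5 * T"
  proof (intro add_mono mult_left_mono)
    have "(\<Sum>l<N. (1 / 2 :: rat) ^ l) = 2 * (1 - (1 / 2) ^ N)" for N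
      by (induction N) (auto simp: algebra_simps)
    then have "(\<Sum>l<n. (1 / 2 :: rat) ^ l) = 2 * (1 - (1 / 2) ^ n)" .
    also have "\<dots> \<le> 2" by simp
    finally show "(\<Sum>l<n. (1 / 2 :: rat) ^ l) \<le> 2" .
    have "5 * (\<Sum>l<n. T * V l / 2 ^ Suc l) = (\<Sum>l<n. \<Sum>j<n. if True \<and> level s j = l then 5 * T / 2 ^ Suc l * flow c s j else 0)"
      unfolding V_def sum_distrib_left sum_divide_distrib by (intro sum.cong refl) auto
    also have "\<dots> \<le> (\<Sum>l<n. \<Sum>j<n. if True \<and> level s j = l then d s (m + j) * flow c s j else 0)"
    proof (intro sum_mono)
      fix l j assume l: "l \<in> {..<n}" and "j \<in> {..<n}"
      then have j: "j < n" by simp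
      show "(if True \<and> level s j = l then 5 * T / 2 ^ Suc l * flow c s j else 0) \<le>
          (if True \<and> level s j = l then d s (m + j) * flow c s j else 0)"
      proof (cases "level s j = l")
        case True
        then have "5 * T / 2 ^ Suc l \<le> d s (m + j)"
          using level_bounds(2)[OF s j] l by (simp add: divide_le_eq less_imp_le)
        then have "5 * T / 2 ^ Suc l * flow c s j \<le> d s (m + j) * flow c s j"
          by (rule mult_right_mono) (rule flow_nonneg[OF j])
        then show ?thesis using True by simp
      qed simp
    qed
    also have "\<dots> \<le> (\<Sum>l\<le>n. \<Sum>j<n. if True \<and> level s j = l then d s (m + j) * flow c s j else 0)"
      by (intro sum_mono2 sum_nonneg) (use flow_nonneg d_nonneg s in auto)
    also have "\<dots> = (\<Sum>j<n. d s (m + j) * flow c s j)"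
      unfolding group[symmetric] by simp
    also have "\<dots> \<le> 5 * T * (3 / \<epsilon> + 1)" by (rule flow_load[OF inv s])
    finally show "(\<Sum>l<n. T * V l / 2 ^ Suc l) \<le> T * (3 / \<epsilon> + 1)" by simp
  qed (use T_pos \<epsilon>_pos in auto)
  \<comment> \<open>The excess clients cost at most \<open>10 * T\<close>, the last level
    \<open>5 * T\<close>, and the paid part
    \<open>T * (30 / \<epsilon> + 90 / \<epsilon>\<^sup>2)\<close>. As
    \<open>\<epsilon> < 1\<close>, the constant is \<open>15 + 30 + 90 = 135\<close>.\<close>
  also have "\<dots> = T * (15 * \<epsilon>\<^sup>2 + 30 * \<epsilon> + 90) / \<epsilon>\<^sup>2"
    using \<epsilon>_pos by (simp add: field_simps power2_eq_square)
  also have "\<dots> \<le> T * 135 / \<epsilon>\<^sup>2"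
  proof (intro divide_right_mono mult_left_mono)
    have "\<epsilon>\<^sup>2 \<le> 1" using \<epsilon>_pos \<epsilon>_less_1 by (simp add: power_le_one)
    then show "15 * \<epsilon>\<^sup>2 + 30 * \<epsilon> + 90 \<le> 135" using \<epsilon>_less_1 by simp
  qed (use T_pos in auto)
  finally show ?thesis by (simp add: mult.commute)
qed

end

section \<open>The program\<close>

text \<open>Addresses are rational values read through \<open>nat\<close> and floor. These rules
  return row-major addresses to natural numbers.\<close>

lemma floor_index [simp]:
  "\<lfloor>of_nat i * of_nat l + of_nat j :: rat\<rfloor> = int (i * l + j)"
  "\<lfloor>of_nat a + (of_nat i * of_nat l + of_nat j) :: rat\<rfloor> = int (a + (i * l + j))"
  by (metis floor_of_nat of_nat_add of_nat_mult)+

lemma nat_index [simp]: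
  "nat (int i * int l + int j) = i * l + j"
  "nat (int a + (int i * int l + int j)) = a + (i * l + j)"
  by (metis nat_int of_nat_add of_nat_mult)+

definition At2 :: "nat \<Rightarrow> aexp \<Rightarrow> aexp \<Rightarrow> aexp \<Rightarrow> aexp" where
  "At2 a e l f = Read a (Plus (Times e l) f)"

lemma aval_At2:
  "aval e s = of_nat i \<Longrightarrow> aval l s = of_nat n \<Longrightarrow> aval f s = of_nat j \<Longrightarrow>
    aval (At2 a e l f) s = s a (i * n + j)"
  by (simp add: At2_def)

text \<open>The offset 5 skips the header with \<open>m\<close>, \<open>n\<close>, \<open>T\<close>,
  \<open>k\<close> and \<open>\<epsilon>\<close>. Register 4 holds \<open>m + n\<close>, the row
  length of the distance matrix.\<close>

definition dist_exp :: "aexp \<Rightarrow> aexp \<Rightarrow> aexp" where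
  "dist_exp e f = Read 0 (Plus (Const 5) (Plus (Times e (Reg 4)) f))"

definition y_exp :: "aexp \<Rightarrow> aexp" where
  "y_exp e = Read 0 (Plus (Const 5) (Plus (Times (Reg 4) (Reg 4)) e))"

definition x_exp :: "aexp \<Rightarrow> aexp \<Rightarrow> aexp" where
  "x_exp e f = Read 0 (Plus (Const 5) (Plus (Times (Reg 4) (Reg 4))
     (Plus (Reg 2) (Plus (Times e (Reg 3)) f))))"

abbreviation T_exp :: aexp where "T_exp \<equiv> Read 0 (Const 2)"
abbreviation eps_exp :: aexp where "eps_exp \<equiv> Read 0 (Const 4)"

text \<open>Arrays 2 to 7 hold the number \<open>m\<close> of facilities, the number \<open>n\<close> of clients, \<open>m + n\<close>, \<open>m n\<close>, the number
  \<open>m (n + 1)\<close> of boxes and the number of auction rounds; 8 to 10 are loop counters, 11 to 18 scratch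
  registers. Array 20 holds the radii, 21 the clustering, 22 and 23 the flow and the box of the pair
  \<open>(i, j)\<close> at index \<open>i n + j\<close>, 24 the capacities of the boxes, and 25, 26, 27 the boxes and levels
  of the clients and the prices of the boxes. In 21 and 25, \<open>Suc s\<close> stands for \<open>s\<close>, and 0 for an undefined value.\<close>

definition setup_com :: com where
  "setup_com = Seq (Assign 2 (Read 0 (Const 0))) (Seq (Assign 3 (Read 0 (Const 1)))
     (Seq (Assign 4 (Plus (Reg 2) (Reg 3))) (Seq (Assign 5 (Times (Reg 2) (Reg 3)))
     (Seq (Assign 6 (Plus (Reg 5) (Reg 2)))
     (Assign 7 (Plus (Times (Plus (Reg 3) (Reg 6)) (Plus (Reg 6) (Const 1))) (Const 1)))))))"

definition radius_com :: com where
  "radius_com = For 8 2 (For 9 2 (Seq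
     (Sum_loop 11 10 2 (Less (dist_exp (Reg 8) (Reg 10)) (dist_exp (Reg 8) (Reg 9))) (y_exp (Reg 10)))
     (Cond (Conj (Less (Reg 11) (Minus (Const 1) (Divide eps_exp (Const 3))))
                 (Less (Read 20 (Reg 8)) (dist_exp (Reg 8) (Reg 9))))
        (Write 20 (Reg 8) (dist_exp (Reg 8) (Reg 9))) Skip)))"

text \<open>Register 14 starts as the selected facility itself and is overwritten by any acceptable
  centre, so opening a new cluster is the default.\<close>

definition cluster_com :: com where
  "cluster_com = For 8 2 (Seq
     (Arg_min_loop 12 13 10 2 (Less (Read 21 (Reg 10)) (Const 1)) (Read 20 (Reg 10))) (Seq
     (Assign 14 (Reg 12)) (Seq
     (For 9 2 (Seq
        (Sum_loop 11 10 2 (Eq (Read 21 (Reg 10)) (Plus (Reg 9) (Const 1))) (y_exp (Reg 10)))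
        (Cond (Conj (Eq (Read 21 (Reg 9)) (Plus (Reg 9) (Const 1)))
               (Conj (Less (Times (Reg 11) eps_exp) (Const 3))
                     (Leq (dist_exp (Reg 12) (Reg 9)) (Times (Const 2) (Read 20 (Reg 12))))))
           (Assign 14 (Reg 9)) Skip)))
     (Write 21 (Reg 12) (Plus (Reg 14) (Const 1))))))"

text \<open>No logarithm is computed: register 17 doubles the distance \<open>n\<close> times, and
  register 16 counts how often it is still at most \<open>5 * T\<close>.\<close>

definition edge_com :: com where
  "edge_com = For 8 2 (For 9 3 (Seq
     (Sum_loop 11 10 2
        (Conj (Eq (Read 21 (Reg 10)) (Plus (Reg 8) (Const 1)))
              (Leq (Read 20 (Reg 10)) (Times (Const 2) (dist_exp (Reg 10) (Plus (Reg 2) (Reg 9))))))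
        (x_exp (Reg 10) (Reg 9))) (Seq
     (Seq (Write 22 (Plus (Times (Reg 8) (Reg 3)) (Reg 9)) (Reg 11))
       (Seq (Assign 17 (dist_exp (Reg 8) (Plus (Reg 2) (Reg 9)))) (Assign 16 (Const 0)))) (Seq
     (For 10 3 (Seq (Assign 17 (Times (Reg 17) (Const 2)))
        (Cond (Leq (Reg 17) (Times (Const 5) T_exp)) (Assign 16 (Plus (Reg 16) (Const 1))) Skip)))
     (Write 23 (Plus (Times (Reg 8) (Reg 3)) (Reg 9))
        (Plus (Times (Reg 8) (Plus (Reg 3) (Const 1))) (Reg 16)))))))"

definition capacity_com :: com where
  "capacity_com = For 8 6 (Seq
     (Sum_loop 11 10 5 (Eq (Read 23 (Reg 10)) (Reg 8)) (Read 22 (Reg 10)))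
     (Write 24 (Reg 8) (Reg 11)))"

text \<open>The search for the cheapest box runs over the centres, since a client has a single box
  at each of them.\<close>

definition bid_com :: com where
  "bid_com = Seq
     (Arg_min_loop 12 13 10 2 (Less (Const 0) (At2 22 (Reg 10) (Reg 3) (Reg 18)))
        (Read 27 (At2 23 (Reg 10) (Reg 3) (Reg 18)))) (Seq
     (Assign 15 (At2 23 (Reg 12) (Reg 3) (Reg 18))) (Seq
     (Sum_loop 11 10 3 (Eq (Read 25 (Reg 10)) (Plus (Reg 15) (Const 1))) (Const 1))
     (Cond (Less (Times (Reg 11) (Divide eps_exp (Const 3))) (Read 24 (Reg 15)))
        (Seq (Write 25 (Reg 18) (Plus (Reg 15) (Const 1)))
             (Write 26 (Reg 18) (Plus (Read 27 (Reg 15)) (Const 1))))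
        (Seq
          (Find_loop 16 10 3 (Conj (Eq (Read 25 (Reg 10)) (Plus (Reg 15) (Const 1)))
                                   (Eq (Read 26 (Reg 10)) (Read 27 (Reg 15)))))
          (Cond (Less (Reg 16) (Reg 3))
             (Seq (Seq (Write 25 (Reg 16) (Const 0)) (Write 26 (Reg 16) (Const 0)))
                  (Seq (Write 25 (Reg 18) (Plus (Reg 15) (Const 1)))
                       (Write 26 (Reg 18) (Plus (Read 27 (Reg 15)) (Const 1)))))
             (Write 27 (Reg 15) (Plus (Read 27 (Reg 15)) (Const 1))))))))"

definition auction_com :: com where
  "auction_com = For 8 7 (Seq (Find_loop 18 10 3 (Less (Read 25 (Reg 10)) (Const 1)))
     (Cond (Less (Reg 18) (Reg 3)) bid_com Skip))"

definition output_com :: com where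
  "output_com = For 8 2 (For 9 3 (Cond
     (Eq (Read 25 (Reg 9)) (Plus (At2 23 (Reg 8) (Reg 3) (Reg 9)) (Const 1)))
     (Seq (Write 1 (Reg 8) (Const 1))
          (Write 1 (Plus (Reg 2) (Plus (Times (Reg 8) (Reg 3)) (Reg 9))) (Const 1)))
     Skip))"

definition rounding_com :: com where
  "rounding_com = Seq setup_com (Seq radius_com (Seq cluster_com (Seq edge_com
     (Seq capacity_com (Seq auction_com output_com)))))"

lemma mods_bid [simp]: "mods bid_com = {10, 11, 12, 13, 15, 16, 25, 26, 27}"
  by (auto simp: bid_com_def)

text \<open>Fractions are stored as multiples of \<open>1 / Q\<close>. \<open>M\<close> has to cover
  their magnitudes: partial sums of \<open>y\<close> and of \<open>x\<close> stay below
  \<open>m\<close>, partial capacities add at most \<open>m * n\<close> flows of size at most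
  \<open>m\<close>, and distances are doubled up to \<open>n\<close> times. \<open>b\<close> must
  cover the longest loop, the rounds of the auction.\<close>

locale rounding = star_lp + resource_bounds B b for B b :: nat +
  fixes Q :: int and M :: rat
  assumes size_le: "r * of_int Q \<in> \<int> \<Longrightarrow> \<bar>r\<bar> \<le> M \<Longrightarrow> rat_size r \<le> B"
    and d_den: "p < m + n \<Longrightarrow> q < m + n \<Longrightarrow> d p q * of_int Q \<in> \<int>"
    and y_den: "i < m \<Longrightarrow> y i * of_int Q \<in> \<int>"
    and x_den: "i < m \<Longrightarrow> j < n \<Longrightarrow> x i j * of_int Q \<in> \<int>"
    and M_mass: "of_nat (m * n * m) \<le> M" "of_nat m \<le> M"
    and M_dist: "p < m + n \<Longrightarrow> q < m + n \<Longrightarrow> d p q * 2 ^ n \<le> M"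
    and b_ge: "(n + m * Suc n) * Suc (m * Suc n) + 1 \<le> b"
begin

lemma b_bounds: "m \<le> b" "n \<le> b" "m + n \<le> b" "m * n \<le> b" "m * Suc n \<le> b" "Suc (m * Suc n) \<le> b"
proof -
  have "n + m * Suc n \<le> (n + m * Suc n) * Suc (m * Suc n)" by simp
  then have a: "n + m * Suc n + 1 \<le> b" using b_ge by linarith
  then show "m \<le> b" "n \<le> b" "m + n \<le> b" "m * n \<le> b" "m * Suc n \<le> b" "Suc (m * Suc n) \<le> b"
    by simp_all
qed

section \<open>Memory layout and access to the input\<close>

definition loaded :: "memory \<Rightarrow> bool" where
  "loaded s \<longleftrightarrow> s 0 0 = of_nat m \<and> s 0 1 = of_nat n \<and> s 0 2 = T \<and> s 0 4 = \<epsilon> \<and>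
     (\<forall>p<m+n. \<forall>q<m+n. s 0 (5 + (p * (m + n) + q)) = d p q) \<and>
     (\<forall>i<m. s 0 (5 + ((m + n) * (m + n) + i)) = y i) \<and>
     (\<forall>i<m. \<forall>j<n. s 0 (5 + ((m + n) * (m + n) + (m + (i * n + j)))) = x i j)"

definition ready :: "memory \<Rightarrow> bool" where
  "ready s \<longleftrightarrow> loaded s \<and> s 2 0 = of_nat m \<and> s 3 0 = of_nat n \<and> s 4 0 = of_nat (m + n) \<and>
     s 5 0 = of_nat (m * n) \<and> s 6 0 = of_nat (m * Suc n) \<and>
     s 7 0 = of_nat ((n + m * Suc n) * Suc (m * Suc n) + 1)"

lemma ready_frame:
  assumes "ready s" "\<And>a. a \<in> {0, 2, 3, 4, 5, 6, 7} \<Longrightarrow> s' a = s a"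
  shows "ready s'"
  using assms(1) unfolding ready_def loaded_def by (simp add: assms(2))

lemma ready_reg:
  assumes "ready s"
  shows "s 2 0 = of_nat m" "s 3 0 = of_nat n" "s 4 0 = of_nat (m + n)"
    "s 5 0 = of_nat (m * n)" "s 6 0 = of_nat (m * Suc n)"
    "s 7 0 = of_nat ((n + m * Suc n) * Suc (m * Suc n) + 1)" "s 0 2 = T" "s 0 4 = \<epsilon>"
  using assms by (auto simp: ready_def loaded_def)

lemma aval_dist_exp:
  assumes "ready s" "aval e s = of_nat p" "aval f s = of_nat q" "p < m + n" "q < m + n"
  shows "aval (dist_exp e f) s = d p q"
proof -
  have idx: "nat \<lfloor>5 + (of_nat p * of_nat (m + n) + of_nat q) :: rat\<rfloor> = 5 + (p * (m + n) + q)"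
    using floor_index(2)[of 5 p "m + n" q] by (simp only: of_nat_numeral nat_int)
  have "aval (dist_exp e f) s = s 0 (nat \<lfloor>5 + (aval e s * s 4 0 + aval f s)\<rfloor>)"
    by (simp add: dist_exp_def)
  then have "aval (dist_exp e f) s = s 0 (5 + (p * (m + n) + q))"
    by (simp only: assms(2,3) ready_reg(3)[OF assms(1)] idx)
  then show ?thesis using assms unfolding ready_def loaded_def by metis
qed

lemma aval_y_exp:
  assumes "ready s" "aval e s = of_nat i" "i < m"
  shows "aval (y_exp e) s = y i"
proof -
  have idx: "nat \<lfloor>5 + (of_nat (m + n) * of_nat (m + n) + of_nat i) :: rat\<rfloor> = 5 + ((m + n) * (m + n) + i)"
    using floor_index(2)[of 5 "m + n" "m + n" i] by (simp only: of_nat_numeral nat_int)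
  have "aval (y_exp e) s = s 0 (nat \<lfloor>5 + (s 4 0 * s 4 0 + aval e s)\<rfloor>)"
    by (simp add: y_exp_def)
  then have "aval (y_exp e) s = s 0 (5 + ((m + n) * (m + n) + i))"
    by (simp only: assms(2) ready_reg(3)[OF assms(1)] idx)
  then show ?thesis using assms unfolding ready_def loaded_def by metis
qed

lemma aval_x_exp:
  assumes "ready s" "aval e s = of_nat i" "aval f s = of_nat j" "i < m" "j < n"
  shows "aval (x_exp e f) s = x i j"
proof -
  have sum: "of_nat m + (of_nat i * of_nat n + of_nat j) = (of_nat (m + (i * n + j)) :: rat)" by simp
  have idx: "nat \<lfloor>5 + (of_nat (m + n) * of_nat (m + n) + of_nat (m + (i * n + j))) :: rat\<rfloor> =
      5 + ((m + n) * (m + n) + (m + (i * n + j)))"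
    using floor_index(2)[of 5 "m + n" "m + n" "m + (i * n + j)"] by (simp only: of_nat_numeral nat_int)
  have "aval (x_exp e f) s =
      s 0 (nat \<lfloor>5 + (s 4 0 * s 4 0 + (s 2 0 + (aval e s * s 3 0 + aval f s)))\<rfloor>)"
    by (simp add: x_exp_def)
  then have "aval (x_exp e f) s = s 0 (5 + ((m + n) * (m + n) + (m + (i * n + j))))"
    by (simp only: assms(2,3) ready_reg(1-3)[OF assms(1)] sum idx)
  then show ?thesis using assms unfolding ready_def loaded_def by metis
qed

lemma size_sum:
  assumes "\<And>i. i < l \<Longrightarrow> G i \<Longrightarrow> F i * of_int Q \<in> \<int> \<and> 0 \<le> F i \<and> F i \<le> c"
    and "of_nat l * c \<le> M" "0 \<le> c"
  shows "rat_size (\<Sum>i<l. if G i then F i else 0) \<le> B"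
    and "(\<Sum>i<l. if G i then F i else 0) * of_int Q \<in> \<int>"
    and "(\<Sum>i<l. if G i then F i else 0) \<le> of_nat l * c"
proof -
  let ?s = "\<Sum>i<l. if G i then F i else 0"
  show den: "?s * of_int Q \<in> \<int>"
    unfolding sum_distrib_right by (intro Ints_sum) (use assms(1) in auto)
  have "?s \<le> (\<Sum>i<l. c)" by (intro sum_mono) (use assms in auto)
  then show le: "?s \<le> of_nat l * c" by simp
  have "0 \<le> ?s" by (intro sum_nonneg) (use assms in auto)
  then show "rat_size ?s \<le> B" using den le assms(2) by (intro size_le) auto
qed

lemma size_mass: "l \<le> m \<Longrightarrow> rat_size (\<Sum>i<l. if G i then y i else 0) \<le> B"
  using y_den y_nonneg y_le_1 M_mass(2) by (intro size_sum(1)[where c = 1]) auto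

section \<open>Setup, radii, clusters, flow and capacities\<close>

lemma run_setup:
  assumes s: "bounded s" "loaded s"
  obtains s' where "run s setup_com s'" "ready s'" "\<forall>a. 7 < a \<or> a = 1 \<longrightarrow> s' a = s a"
proof -
  let ?it = "(n + m * Suc n) * Suc (m * Suc n) + 1"
  have sizes: "rat_size (of_nat m) \<le> B" "rat_size (of_nat n) \<le> B" "rat_size (of_nat (m + n)) \<le> B"
    "rat_size (of_nat (m * n)) \<le> B" "rat_size (of_nat (m * n + m)) \<le> B" "rat_size (of_nat ?it) \<le> B"
    using b_bounds b_ge by (auto intro!: rat_size_of_nat simp del: of_nat_add of_nat_mult of_nat_Suc)
  have in01: "s 0 0 = of_nat m" "s 0 (Suc 0) = of_nat n" using s by (auto simp: loaded_def)
  have it: "of_nat ?it =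
      ((of_nat n + (of_nat m * of_nat n + of_nat m)) * (of_nat m * of_nat n + of_nat m + 1) + 1 :: rat)"
    by (simp add: algebra_simps)
  have "safe setup_com s"
    using in01 sizes[unfolded it] unfolding setup_com_def by simp
  then have "run s setup_com (sem setup_com s)" by (rule run_sem[OF s(1)])
  moreover have "ready (sem setup_com s)"
    using s(2) in01 it by (simp add: ready_def loaded_def setup_com_def add.commute)
  ultimately show ?thesis by (rule that) (simp add: setup_com_def)
qed

lemma d_size: "p < m + n \<Longrightarrow> q < m + n \<Longrightarrow> rat_size (d p q) \<le> B"
proof (rule size_le)
  assume pq: "p < m + n" "q < m + n"
  have "d p q * 1 \<le> d p q * 2 ^ n" using d_nonneg[OF pq] by (intro mult_left_mono) auto
  then show "\<bar>d p q\<bar> \<le> M" using d_nonneg[OF pq] M_dist[OF pq] by simp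
qed (rule d_den)

lemma run_radius:
  assumes s: "bounded s" "ready s" and zero: "\<forall>i. s 20 i = 0"
  obtains s' where "run s radius_com s'" "\<forall>i<m. s' 20 i = radius i"
    "\<forall>a. a \<notin> {8, 9, 10, 11, 20} \<longrightarrow> s' a = s a"
proof -
  let ?sum = "Sum_loop 11 10 2 (Less (dist_exp (Reg 8) (Reg 10)) (dist_exp (Reg 8) (Reg 9))) (y_exp (Reg 10))"
  let ?upd = "Cond (Conj (Less (Reg 11) (Minus (Const 1) (Divide eps_exp (Const 3))))
                 (Less (Read 20 (Reg 8)) (dist_exp (Reg 8) (Reg 9))))
        (Write 20 (Reg 8) (dist_exp (Reg 8) (Reg 9))) Skip"
  let ?I = "\<lambda>i s1. \<forall>i'. s1 20 i' = (if i' < i then radius i' else 0)"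
  obtain s' where s': "run s (For 8 2 (For 9 2 (Seq ?sum ?upd))) s'" "?I m s'"
    "\<forall>a. a \<notin> insert 8 (mods (For 9 2 (Seq ?sum ?upd))) \<longrightarrow> s' a = s a"
  proof (rule run_For[where I = ?I and s = s and N = m and v = 8 and u = 2 and c = "For 9 2 (Seq ?sum ?upd)"])
    fix i s1
    assume i: "i < m" and I: "?I i s1" and reg8: "s1 8 0 = of_nat i" and s1: "bounded s1"
      and fr: "\<forall>a. a \<notin> insert 8 (mods (For 9 2 (Seq ?sum ?upd))) \<longrightarrow> s1 a = s a"
    have ready1: "ready s1" by (rule ready_frame[OF s(2)]) (use fr in auto)
    \<comment> \<open>Cell \<open>i\<close> carries the running maximum. Memory initialised with 0
      supplies \<open>radius_upto i 0\<close>.\<close>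
    let ?J = "\<lambda>l s2. \<forall>i'. s2 20 i' = (if i' < i then radius i' else if i' = i then radius_upto i l else 0)"
    obtain s2 where s2: "run s1 (For 9 2 (Seq ?sum ?upd)) s2" "?J m s2"
      "\<forall>a. a \<notin> insert 9 (mods (Seq ?sum ?upd)) \<longrightarrow> s2 a = s1 a"
    proof (rule run_For[where I = ?J and s = s1 and N = m and v = 9 and u = 2 and c = "Seq ?sum ?upd"])
      fix l s3
      assume l: "l < m" and J: "?J l s3" and reg9: "s3 9 0 = of_nat l" and s3: "bounded s3"
        and fr3: "\<forall>a. a \<notin> insert 9 (mods (Seq ?sum ?upd)) \<longrightarrow> s3 a = s1 a"
      have ready3: "ready s3" by (rule ready_frame[OF ready1]) (use fr3 in auto)
      have reg8': "s3 8 0 = of_nat i" using fr3 reg8 by simp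
      obtain s4 where s4: "run s3 ?sum s4" "s4 11 0 = (\<Sum>v<m. if d i v < d i l then y v else 0)"
        "\<forall>a. a \<noteq> 10 \<longrightarrow> a \<noteq> 11 \<longrightarrow> s4 a = s3 a"
      proof (rule run_Sum_loop[where s = s3 and N = m and u = 2 and v = 10 and acc = 11
            and g = "Less (dist_exp (Reg 8) (Reg 10)) (dist_exp (Reg 8) (Reg 9))" and f = "y_exp (Reg 10)"
            and G = "\<lambda>v. d i v < d i l" and F = y])
        fix v s5
        assume v: "v < m" "s5 10 0 = of_nat v" and fr5: "\<forall>a. a \<noteq> 10 \<longrightarrow> a \<noteq> 11 \<longrightarrow> s5 a = s3 a"
        have "ready s5" by (rule ready_frame[OF ready3]) (use fr5 in auto)
        then show "(bval (Less (dist_exp (Reg 8) (Reg 10)) (dist_exp (Reg 8) (Reg 9))) s5 \<longleftrightarrow> d i v < d i l) \<and>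
            (d i v < d i l \<longrightarrow> aval (y_exp (Reg 10)) s5 = y v)"
          using v fr5 reg8' reg9 i l by (simp add: aval_dist_exp aval_y_exp)
      qed (use s3 ready_reg[OF ready3] b_bounds size_mass in auto)
      have ready4: "ready s4" by (rule ready_frame[OF ready3]) (use s4 in auto)
      have reg4: "s4 8 0 = of_nat i" "s4 9 0 = of_nat l" using s4 reg8' reg9 by auto
      have dist: "aval (dist_exp (Reg 8) (Reg 9)) s4 = d i l"
        using reg4 i l by (simp add: aval_dist_exp ready4)
      have "run s4 ?upd (sem ?upd s4)"
        using d_size[of i l] i l dist by (intro run_sem run_bounded[OF s4(1)]) simp
      moreover have "?J (Suc l) ((sem ?upd s4)(9 := (sem ?upd s4 9)(0 := of_nat (Suc l))))"
        using J s4 reg4 dist ready_reg[OF ready4] by (auto simp: open_mass_def)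
      ultimately show "\<exists>s4. run s3 (Seq ?sum ?upd) s4 \<and> ?J (Suc l) (s4(9 := (s4 9)(0 := of_nat (Suc l))))"
        using run_Seq[OF s4(1)] by blast
    qed (use s1 ready_reg[OF ready1] b_bounds I in auto)
    then have "?I (Suc i) (s2(8 := (s2 8)(0 := of_nat (Suc i))))"
      using s2(2) by (auto simp: radius_def less_Suc_eq)
    then show "\<exists>s2. run s1 (For 9 2 (Seq ?sum ?upd)) s2 \<and> ?I (Suc i) (s2(8 := (s2 8)(0 := of_nat (Suc i))))"
      using s2(1) by blast
  qed (use s ready_reg[OF s(2)] b_bounds zero in auto)
  then show ?thesis using that[of s'] by (auto simp: radius_com_def)
qed

end

lemma of_nat_eq_Suc [simp]:
  "(of_nat a :: rat) = of_nat l + 1 \<longleftrightarrow> a = Suc l"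
  "(of_nat a :: rat) = 1 + of_nat l \<longleftrightarrow> a = Suc l"
  by (metis add.commute of_nat_Suc of_nat_eq_iff)+

text \<open>The program accumulates a capacity in one pass over all pairs in row-major order,
  whereas \<open>weight\<close> speaks of a double sum.\<close>

lemma sum_div_mod:
  fixes f :: "nat \<Rightarrow> nat \<Rightarrow> 'a :: comm_monoid_add"
  shows "(\<Sum>e<m * n. f (e div n) (e mod n)) = (\<Sum>i<m. \<Sum>j<n. f i j)"
proof -
  have "(\<Sum>e<n * m. f (e div n) (e mod n)) = (\<Sum>i<m. \<Sum>e\<in>{n * i..<n * i + n}. f (e div n) (e mod n))"
    using sum.nat_group[of "\<lambda>e. f (e div n) (e mod n)" n m] by (simp add: mult.commute)
  also have "\<dots> = (\<Sum>i<m. \<Sum>j<n. f i j)"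
  proof (rule sum.cong[OF refl])
    fix i
    have "(\<Sum>e\<in>{n * i..<n * i + n}. f (e div n) (e mod n)) =
        (\<Sum>j\<in>{0..<n}. f ((n * i + j) div n) ((n * i + j) mod n))"
      using sum.shift_bounds_nat_ivl[of "\<lambda>e. f (e div n) (e mod n)" 0 "n * i" n]
      by (simp add: add.commute)
    also have "\<dots> = (\<Sum>j<n. f i j)" by (intro sum.cong) auto
    finally show "(\<Sum>e\<in>{n * i..<n * i + n}. f (e div n) (e mod n)) = (\<Sum>j<n. f i j)" .
  qed
  finally show ?thesis by (simp add: mult.commute)
qed

context rounding
begin

lemma run_cluster:
  assumes s: "bounded s" "ready s" and rad: "\<forall>i<m. s 20 i = radius i" and zero: "\<forall>i. s 21 i = 0"
  obtains s' c where "run s cluster_com s'" "\<forall>i<m. s' 21 i = of_nat (c i)" "cluster_inv m c"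
    "\<forall>a. a \<notin> {8, 9, 10, 11, 12, 13, 14, 21} \<longrightarrow> s' a = s a"
proof -
  let ?arg = "Arg_min_loop 12 13 10 2 (Less (Read 21 (Reg 10)) (Const 1)) (Read 20 (Reg 10))"
  let ?sum = "Sum_loop 11 10 2 (Eq (Read 21 (Reg 10)) (Plus (Reg 9) (Const 1))) (y_exp (Reg 10))"
  let ?upd = "Cond (Conj (Eq (Read 21 (Reg 9)) (Plus (Reg 9) (Const 1)))
               (Conj (Less (Times (Reg 11) eps_exp) (Const 3))
                     (Leq (dist_exp (Reg 12) (Reg 9)) (Times (Const 2) (Read 20 (Reg 12))))))
           (Assign 14 (Reg 9)) Skip"
  let ?for = "For 9 2 (Seq ?sum ?upd)"
  let ?put = "Write 21 (Reg 12) (Plus (Reg 14) (Const 1))"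
  let ?body = "Seq ?arg (Seq (Assign 14 (Reg 12)) (Seq ?for ?put))"
  let ?I = "\<lambda>t s1. \<exists>c. (\<forall>i<m. s1 21 i = of_nat (c i)) \<and> cluster_inv t c"
  obtain s' where s': "run s (For 8 2 ?body) s'" "?I m s'"
    "\<forall>a. a \<notin> insert 8 (mods ?body) \<longrightarrow> s' a = s a"
  proof (rule run_For[where I = ?I and s = s and N = m and v = 8 and u = 2 and c = ?body])
    fix t s1
    assume t: "t < m" and I: "?I t s1" and s1: "bounded s1"
      and fr: "\<forall>a. a \<notin> insert 8 (mods ?body) \<longrightarrow> s1 a = s a"
    obtain c where c: "\<forall>i<m. s1 21 i = of_nat (c i)" and inv: "cluster_inv t c" using I by blast
    have ready1: "ready s1" by (rule ready_frame[OF s(2)]) (use fr in auto)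
    have rad1: "\<forall>i<m. s1 20 i = radius i" using fr rad by auto
    obtain s2 i where s2: "run s1 ?arg s2" "s2 12 0 = of_nat i"
      "i < m \<and> c i = 0 \<and> (\<forall>k<m. c k = 0 \<longrightarrow> radius i \<le> radius k) \<or> i = m \<and> (\<forall>k<m. c k \<noteq> 0)"
      "\<forall>a. a \<noteq> 10 \<longrightarrow> a \<noteq> 12 \<longrightarrow> a \<noteq> 13 \<longrightarrow> s2 a = s1 a"
    proof (rule run_Arg_min_loop[where s = s1 and N = m and u = 2 and v = 10 and acc = 12 and val = 13
          and g = "Less (Read 21 (Reg 10)) (Const 1)" and f = "Read 20 (Reg 10)"
          and G = "\<lambda>i. c i = 0" and F = radius])
      fix k assume "k < m"
      then show "rat_size (radius k) \<le> B" using boundedD[OF s1, of 20 k] rad1 by simp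
    qed (use s1 ready_reg[OF ready1] b_bounds c rad1 in auto)
    \<comment> \<open>Only \<open>t < m\<close> facilities are processed, so the search cannot
      return the mark \<open>m\<close>.\<close>
    have "\<exists>k<m. c k = 0"
    proof (rule ccontr)
      assume "\<not> ?thesis"
      then have "{i. i < m \<and> c i \<noteq> 0} = {..<m}" by auto
      then show False using cluster_inv_card[OF inv] t by simp
    qed
    then have i: "i < m" "c i = 0" "\<And>k. k < m \<Longrightarrow> c k = 0 \<Longrightarrow> radius i \<le> radius k"
      using s2(3) by auto
    let ?s3 = "s2(14 := (s2 14)(0 := of_nat i))"
    have s3: "run s2 (Assign 14 (Reg 12)) ?s3"
      using run_sem[OF run_bounded[OF s2(1)], of "Assign 14 (Reg 12)"] s2(2)
        boundedD[OF run_bounded[OF s2(1)], of 12 0] by simp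
    have fr3: "?s3 a = s1 a" if "a \<notin> {10, 12, 13, 14}" for a using s2(4) that by simp
    have ready3: "ready ?s3" by (rule ready_frame[OF ready1]) (use fr3 in auto)
    define good where "good r \<longleftrightarrow> r < m \<and> c r = Suc r \<and> cluster_mass c r * \<epsilon> < 3 \<and> d i r \<le> 2 * radius i" for r
    \<comment> \<open>Either some acceptable centre is held, not necessarily the first or nearest,
      or \<open>i\<close> itself because none has been met. These are the two cases of
      \<open>cluster_inv_step\<close>.\<close>
    let ?J = "\<lambda>l s4. \<exists>r. s4 14 0 = of_nat r \<and> (good r \<or> r = i \<and> (\<forall>r'<l. \<not> good r'))"
    obtain s4 where s4: "run ?s3 ?for s4" "?J m s4"
      "\<forall>a. a \<notin> insert 9 (mods (Seq ?sum ?upd)) \<longrightarrow> s4 a = ?s3 a"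
    proof (rule run_For[where I = ?J and s = ?s3 and N = m and v = 9 and u = 2 and c = "Seq ?sum ?upd"])
      fix l s5
      assume l: "l < m" and J: "?J l s5" and reg9: "s5 9 0 = of_nat l" and s5: "bounded s5"
        and fr5: "\<forall>a. a \<notin> insert 9 (mods (Seq ?sum ?upd)) \<longrightarrow> s5 a = ?s3 a"
      have ready5: "ready s5" by (rule ready_frame[OF ready3]) (use fr5 in auto)
      have c5: "\<forall>i<m. s5 21 i = of_nat (c i)" and rad5: "\<forall>i<m. s5 20 i = radius i"
        and reg5: "s5 12 0 = of_nat i"
        using fr5 fr3 c rad1 s2(2) by auto
      obtain s6 where s6: "run s5 ?sum s6" "s6 11 0 = (\<Sum>v<m. if c v = Suc l then y v else 0)"
        "\<forall>a. a \<noteq> 10 \<longrightarrow> a \<noteq> 11 \<longrightarrow> s6 a = s5 a"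
      proof (rule run_Sum_loop[where s = s5 and N = m and u = 2 and v = 10 and acc = 11
            and g = "Eq (Read 21 (Reg 10)) (Plus (Reg 9) (Const 1))" and f = "y_exp (Reg 10)"
            and G = "\<lambda>v. c v = Suc l" and F = y])
        fix v s7
        assume v: "v < m" "s7 10 0 = of_nat v" and fr7: "\<forall>a. a \<noteq> 10 \<longrightarrow> a \<noteq> 11 \<longrightarrow> s7 a = s5 a"
        have "ready s7" by (rule ready_frame[OF ready5]) (use fr7 in auto)
        then show "(bval (Eq (Read 21 (Reg 10)) (Plus (Reg 9) (Const 1))) s7 \<longleftrightarrow> c v = Suc l) \<and>
            (c v = Suc l \<longrightarrow> aval (y_exp (Reg 10)) s7 = y v)"
          using v fr7 reg9 c5 by (simp add: aval_y_exp)
      qed (use s5 ready_reg[OF ready5] b_bounds size_mass in auto)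
      have ready6: "ready s6" by (rule ready_frame[OF ready5]) (use s6 in auto)
      have reg6: "s6 12 0 = of_nat i" "s6 9 0 = of_nat l" "s6 21 l = of_nat (c l)" "s6 20 i = radius i"
        using s6(3) reg5 reg9 c5 rad5 l i by auto
      have "aval (dist_exp (Reg 12) (Reg 9)) s6 = d i l"
        using reg6 i l by (simp add: aval_dist_exp ready6)
      then have test: "bval (Conj (Eq (Read 21 (Reg 9)) (Plus (Reg 9) (Const 1)))
               (Conj (Less (Times (Reg 11) eps_exp) (Const 3))
                     (Leq (dist_exp (Reg 12) (Reg 9)) (Times (Const 2) (Read 20 (Reg 12)))))) s6 \<longleftrightarrow> good l"
        using reg6 s6(2) l ready_reg[OF ready6] by (auto simp: good_def cluster_mass_def)
      have "run s6 ?upd (sem ?upd s6)"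
        using boundedD[OF run_bounded[OF s6(1)], of 9 0] by (intro run_sem run_bounded[OF s6(1)]) simp
      moreover have "?J (Suc l) ((sem ?upd s6)(9 := (sem ?upd s6 9)(0 := of_nat (Suc l))))"
      proof (cases "good l")
        case True
        then have "sem ?upd s6 = s6(14 := (s6 14)(0 := of_nat l))"
          using test reg6 by (simp only: sem.simps if_True) simp
        then show ?thesis using True by (intro exI[of _ l]) auto
      next
        case False
        then have "sem ?upd s6 = s6" using test by (simp only: sem.simps if_False)
        moreover have "s6 14 = s5 14" using s6(3) by simp
        ultimately show ?thesis using J False by (auto simp: less_Suc_eq)
      qed
      ultimately show "\<exists>s6. run s5 (Seq ?sum ?upd) s6 \<and> ?J (Suc l) (s6(9 := (s6 9)(0 := of_nat (Suc l))))"
        using run_Seq[OF s6(1)] by blast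
    qed (use run_bounded[OF s3] ready_reg[OF ready3] b_bounds in auto)
    obtain r where r: "s4 14 0 = of_nat r" "good r \<or> r = i \<and> (\<forall>r'<m. \<not> good r')" using s4(2) by blast
    have r_m: "r < m" using r(2) i(1) by (auto simp: good_def)
    have reg4: "s4 12 0 = of_nat i" "\<forall>i<m. s4 21 i = of_nat (c i)"
      using s4(3) fr3 c s2(2) by auto
    let ?s5 = "s4(21 := (s4 21)(i := of_nat r + 1))"
    have s5: "run s4 ?put ?s5"
      using run_sem[OF run_bounded[OF s4(1)], of ?put] reg4 r(1) rat_size_Suc[of r] r_m b_bounds by simp
    have "cluster_inv (Suc t) (c(i := Suc r))"
      by (rule cluster_inv_step[OF inv i]) (use r(2) in \<open>auto simp: good_def not_le\<close>)
    moreover have "\<forall>k<m. ?s5 21 k = of_nat ((c(i := Suc r)) k)" using reg4 by auto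
    ultimately have "?I (Suc t) (?s5(8 := (?s5 8)(0 := of_nat (Suc t))))"
      by (intro exI[of _ "c(i := Suc r)"]) simp
    moreover have "run s1 ?body ?s5" by (intro run_Seq[OF s2(1)] run_Seq[OF s3] run_Seq[OF s4(1)] s5)
    ultimately show "\<exists>s2. run s1 ?body s2 \<and> ?I (Suc t) (s2(8 := (s2 8)(0 := of_nat (Suc t))))" by blast
  next
    show "?I 0 (s(8 := (s 8)(0 := 0)))"
      using zero cluster_inv_start by (intro exI[of _ "\<lambda>_. 0"]) simp
  qed (use s ready_reg[OF s(2)] b_bounds in auto)
  then obtain c where "\<forall>i<m. s' 21 i = of_nat (c i)" "cluster_inv m c" by blast
  then show ?thesis using that[of s' c] s' by (auto simp: cluster_com_def)
qed

lemma aval_client: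
  assumes "ready s" "aval e s = of_nat p" "aval f s = of_nat j" "p < m + n" "j < n"
  shows "aval (dist_exp e (Plus (Reg 2) f)) s = d p (m + j)"
  using assms ready_reg[OF assms(1)] by (intro aval_dist_exp) auto

lemma flow_size:
  assumes "j < n"
  shows "(\<Sum>i<m. if c i = Suc s \<and> keep i j then x i j else 0) = flow c s j"
    and "\<And>l. l \<le> m \<Longrightarrow> rat_size (\<Sum>i<l. if c i = Suc s \<and> keep i j then x i j else 0) \<le> B"
    and "flow c s j * of_int Q \<in> \<int>" "flow c s j \<le> of_nat m"
proof -
  have x: "x i j * of_int Q \<in> \<int> \<and> 0 \<le> x i j \<and> x i j \<le> 1" if "i < m" for i
    using x_den x_nonneg x_le_y[OF that assms] y_le_1[OF that] that assms by force
  have l: "of_nat l * 1 \<le> M" if "l \<le> m" for l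
    using that M_mass(2) by (simp add: order_trans[OF of_nat_mono])
  show "rat_size (\<Sum>i<l. if c i = Suc s \<and> keep i j then x i j else 0) \<le> B" if "l \<le> m" for l
    by (rule size_sum(1)[where c = 1]) (use x l that in auto)
  show "flow c s j * of_int Q \<in> \<int>"
    unfolding flow_def by (rule size_sum(2)[where c = 1]) (use x l[of m] in auto)
  have "flow c s j \<le> of_nat m * 1"
    unfolding flow_def by (rule size_sum(3)[where c = 1]) (use x l[of m] in auto)
  then show "flow c s j \<le> of_nat m" by simp
qed (simp add: flow_def)

lemma run_edge:
  assumes s: "bounded s" "ready s" and rad: "\<forall>i<m. s 20 i = radius i"
    and c: "\<forall>i<m. s 21 i = of_nat (c i)"
  obtains s' where "run s edge_com s'"
    "\<forall>e<m * n. s' 22 e = flow c (e div n) (e mod n) \<and> s' 23 e = of_nat (box (e div n) (e mod n))"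
    "\<forall>a. a \<notin> {8, 9, 10, 11, 16, 17, 22, 23} \<longrightarrow> s' a = s a"
proof -
  let ?g = "Conj (Eq (Read 21 (Reg 10)) (Plus (Reg 8) (Const 1)))
              (Leq (Read 20 (Reg 10)) (Times (Const 2) (dist_exp (Reg 10) (Plus (Reg 2) (Reg 9)))))"
  let ?sum = "Sum_loop 11 10 2 ?g (x_exp (Reg 10) (Reg 9))"
  let ?put = "Seq (Write 22 (Plus (Times (Reg 8) (Reg 3)) (Reg 9)) (Reg 11))
       (Seq (Assign 17 (dist_exp (Reg 8) (Plus (Reg 2) (Reg 9)))) (Assign 16 (Const 0)))"
  let ?cnt = "Seq (Assign 17 (Times (Reg 17) (Const 2)))
        (Cond (Leq (Reg 17) (Times (Const 5) T_exp)) (Assign 16 (Plus (Reg 16) (Const 1))) Skip)"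
  let ?out = "Write 23 (Plus (Times (Reg 8) (Reg 3)) (Reg 9))
        (Plus (Times (Reg 8) (Plus (Reg 3) (Const 1))) (Reg 16))"
  let ?body = "Seq ?sum (Seq ?put (Seq (For 10 3 ?cnt) ?out))"
  let ?K = "\<lambda>u s1. \<forall>e<u. s1 22 e = flow c (e div n) (e mod n) \<and> s1 23 e = of_nat (box (e div n) (e mod n))"
  obtain s' where s': "run s (For 8 2 (For 9 3 ?body)) s'" "?K (m * n) s'"
    "\<forall>a. a \<notin> insert 8 (mods (For 9 3 ?body)) \<longrightarrow> s' a = s a"
  proof (rule run_For[where I = "\<lambda>i. ?K (i * n)" and s = s and N = m and v = 8 and u = 2 and c = "For 9 3 ?body"])
    fix i s1
    assume i: "i < m" and I: "?K (i * n) s1" and reg8: "s1 8 0 = of_nat i" and s1: "bounded s1"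
      and fr: "\<forall>a. a \<notin> insert 8 (mods (For 9 3 ?body)) \<longrightarrow> s1 a = s a"
    have ready1: "ready s1" by (rule ready_frame[OF s(2)]) (use fr in auto)
    obtain s2 where s2: "run s1 (For 9 3 ?body) s2" "?K (i * n + n) s2"
      "\<forall>a. a \<notin> insert 9 (mods ?body) \<longrightarrow> s2 a = s1 a"
    proof (rule run_For[where I = "\<lambda>j. ?K (i * n + j)" and s = s1 and N = n and v = 9 and u = 3 and c = ?body])
      fix j s3
      assume j: "j < n" and J: "?K (i * n + j) s3" and reg9: "s3 9 0 = of_nat j" and s3: "bounded s3"
        and fr3: "\<forall>a. a \<notin> insert 9 (mods ?body) \<longrightarrow> s3 a = s1 a"
      have ready3: "ready s3" by (rule ready_frame[OF ready1]) (use fr3 in auto)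
      have reg8': "s3 8 0 = of_nat i" using fr3 reg8 by simp
      have c3: "\<forall>i<m. s3 21 i = of_nat (c i)" and rad3: "\<forall>i<m. s3 20 i = radius i"
        using fr fr3 c rad by auto
      obtain s4 where s4: "run s3 ?sum s4" "s4 11 0 = flow c i j"
        "\<forall>a. a \<noteq> 10 \<longrightarrow> a \<noteq> 11 \<longrightarrow> s4 a = s3 a"
      proof (rule run_Sum_loop[where s = s3 and N = m and u = 2 and v = 10 and acc = 11
            and g = ?g and f = "x_exp (Reg 10) (Reg 9)"
            and G = "\<lambda>v. c v = Suc i \<and> keep v j" and F = "\<lambda>v. x v j"])
        fix v s5
        assume v: "v < m" "s5 10 0 = of_nat v" and fr5: "\<forall>a. a \<noteq> 10 \<longrightarrow> a \<noteq> 11 \<longrightarrow> s5 a = s3 a"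
        have "ready s5" by (rule ready_frame[OF ready3]) (use fr5 in auto)
        then show "(bval ?g s5 \<longleftrightarrow> c v = Suc i \<and> keep v j) \<and>
            (c v = Suc i \<and> keep v j \<longrightarrow> aval (x_exp (Reg 10) (Reg 9)) s5 = x v j)"
          using v fr5 reg9 reg8' c3 rad3 j by (auto simp: aval_x_exp aval_client keep_def)
      qed (use s3 ready_reg[OF ready3] b_bounds flow_size[OF j] in auto)
      have ready4: "ready s4" by (rule ready_frame[OF ready3]) (use s4 in auto)
      have reg4: "s4 8 0 = of_nat i" "s4 9 0 = of_nat j" using s4(3) reg9 reg8' by auto
      let ?D = "d i (m + j)"
      let ?s5 = "s4(22 := (s4 22)(i * n + j := flow c i j), 17 := (s4 17)(0 := ?D), 16 := (s4 16)(0 := 0))"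
      have sem5: "sem ?put s4 = ?s5" "safe ?put s4"
      proof -
        let ?t = "s4(22 := (s4 22)(i * n + j := flow c i j))"
        have "ready ?t" by (rule ready_frame[OF ready4]) auto
        then have "aval (dist_exp (Reg 8) (Plus (Reg 2) (Reg 9))) ?t = ?D"
          using reg4 i j by (intro aval_client) auto
        then show "sem ?put s4 = ?s5" "safe ?put s4"
          using reg4 s4(2) ready_reg[OF ready4] boundedD[OF run_bounded[OF s4(1)], of 11 0]
            d_size[of i "m + j"] i j rat_size_of_nat[of 0] by simp_all
      qed
      have s5: "run s4 ?put ?s5"
        using run_sem[OF run_bounded[OF s4(1)] sem5(2)] sem5(1) by simp
      have ready5: "ready ?s5" by (rule ready_frame[OF ready4]) auto
      define lev :: "nat \<Rightarrow> nat" where "lev l = (\<Sum>t<l. if ?D * 2 ^ Suc t \<le> 5 * T then 1 else 0)" for l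
      have lev_le: "lev l \<le> l" for l by (induction l) (auto simp: lev_def)
      obtain s6 where s6: "run ?s5 (For 10 3 ?cnt) s6" "s6 17 0 = ?D * 2 ^ n \<and> s6 16 0 = of_nat (lev n)"
        "\<forall>a. a \<notin> insert 10 (mods ?cnt) \<longrightarrow> s6 a = ?s5 a"
      proof (rule run_For[where I = "\<lambda>t s6. s6 17 0 = ?D * 2 ^ t \<and> s6 16 0 = of_nat (lev t)"
            and s = ?s5 and N = n and v = 10 and u = 3 and c = ?cnt])
        fix t s7
        assume t: "t < n" and L: "s7 17 0 = ?D * 2 ^ t \<and> s7 16 0 = of_nat (lev t)" and s7: "bounded s7"
          and fr7: "\<forall>a. a \<notin> insert 10 (mods ?cnt) \<longrightarrow> s7 a = ?s5 a"
        have T7: "s7 0 2 = T" using fr7 ready_reg[OF ready5] by simp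
        have D: "0 \<le> ?D" using d_nonneg i j by simp
        have "?D * 2 ^ Suc t \<le> ?D * 2 ^ n" using t D by (intro mult_left_mono power_increasing) auto
        also have "\<dots> \<le> M" using M_dist i j by simp
        finally have "\<bar>?D * 2 ^ Suc t\<bar> \<le> M" using D by (simp only: abs_of_nonneg mult_nonneg_nonneg zero_le_power zero_le_numeral)
        \<comment> \<open>Doubling multiplies by an integer, so the common denominator is
          preserved.\<close>
        moreover have "(?D * of_int Q) * of_nat (2 ^ Suc t) \<in> \<int>"
          by (intro Ints_mult d_den Ints_of_nat) (use i j in auto)
        then have "?D * 2 ^ Suc t * of_int Q \<in> \<int>" by (simp add: algebra_simps)
        ultimately have size: "rat_size (?D * 2 ^ Suc t) \<le> B" by (intro size_le)
        have dbl: "?D * 2 ^ t * 2 = ?D * 2 ^ Suc t" by simp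
        have "lev t < b" using lev_le[of t] t b_bounds by simp
        then have "run s7 ?cnt (sem ?cnt s7)"
          using s7 L size T7 rat_size_Suc[of "lev t"] unfolding dbl[symmetric] by (intro run_sem) simp_all
        then show "\<exists>s8. run s7 ?cnt s8 \<and> (s8(10 := (s8 10)(0 := of_nat (Suc t)))) 17 0 = ?D * 2 ^ Suc t \<and>
            (s8(10 := (s8 10)(0 := of_nat (Suc t)))) 16 0 = of_nat (lev (Suc t))"
          using L T7 by (intro exI[of _ "sem ?cnt s7"]) (auto simp: lev_def mult_ac)
      qed (use run_bounded[OF s5] ready_reg[OF ready5] b_bounds in \<open>auto simp: lev_def\<close>)
      have lev: "lev n = level i j" by (simp add: lev_def level_def)
      have ready6: "ready s6" by (rule ready_frame[OF ready5]) (use s6(3) in auto)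
      have reg6: "s6 8 0 = of_nat i" "s6 9 0 = of_nat j" using s6(3) reg4 by auto
      let ?s7 = "s6(23 := (s6 23)(i * n + j := of_nat (box i j)))"
      have val: "of_nat i * (of_nat n + 1) + of_nat (level i j) = (of_nat (box i j) :: rat)"
        by (simp add: box_def algebra_simps)
      have "box i j \<le> b" using box_less[OF i, of j] b_bounds by simp
      then have s7: "run s6 ?out ?s7"
        using run_sem[OF run_bounded[OF s6(1)], of ?out] reg6 s6(2) lev val ready_reg[OF ready6]
          rat_size_of_nat[of "box i j"] by simp
      have div: "(i * n + j) div n = i" "(i * n + j) mod n = j" using index_div_mod[OF j] by auto
      have "?K (i * n + Suc j) (?s7(9 := (?s7 9)(0 := of_nat (Suc j))))"
        using J s6(3) s4(3) div by (auto simp: less_Suc_eq)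
      moreover have "run s3 ?body ?s7" by (intro run_Seq[OF s4(1)] run_Seq[OF s5] run_Seq[OF s6(1)] s7)
      ultimately show "\<exists>s4. run s3 ?body s4 \<and> ?K (i * n + Suc j) (s4(9 := (s4 9)(0 := of_nat (Suc j))))"
        by blast
    qed (use s1 ready_reg[OF ready1] b_bounds I in auto)
    then show "\<exists>s2. run s1 (For 9 3 ?body) s2 \<and> ?K (Suc i * n) (s2(8 := (s2 8)(0 := of_nat (Suc i))))"
      by (intro exI[of _ s2]) (simp add: add.commute)
  qed (use s ready_reg[OF s(2)] b_bounds in auto)
  then show ?thesis using that[of s'] by (auto simp: edge_com_def)
qed

lemma run_capacity:
  assumes s: "bounded s" "ready s"
    and e: "\<forall>e<m * n. s 22 e = flow c (e div n) (e mod n) \<and> s 23 e = of_nat (box (e div n) (e mod n))"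
  obtains s' where "run s capacity_com s'" "\<forall>b<m * Suc n. s' 24 b = (\<Sum>j<n. weight c j b)"
    "\<forall>a. a \<notin> {8, 10, 11, 24} \<longrightarrow> s' a = s a"
proof -
  let ?sum = "Sum_loop 11 10 5 (Eq (Read 23 (Reg 10)) (Reg 8)) (Read 22 (Reg 10))"
  let ?body = "Seq ?sum (Write 24 (Reg 8) (Reg 11))"
  let ?I = "\<lambda>u s1. \<forall>b<u. s1 24 b = (\<Sum>j<n. weight c j b)"
  let ?F = "\<lambda>e. flow c (e div n) (e mod n)"
  obtain s' where s': "run s (For 8 6 ?body) s'" "?I (m * Suc n) s'"
    "\<forall>a. a \<notin> insert 8 (mods ?body) \<longrightarrow> s' a = s a"
  proof (rule run_For[where I = ?I and s = s and N = "m * Suc n" and v = 8 and u = 6 and c = ?body])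
    fix u s1
    assume u: "u < m * Suc n" and I: "?I u s1" and reg8: "s1 8 0 = of_nat u" and s1: "bounded s1"
      and fr: "\<forall>a. a \<notin> insert 8 (mods ?body) \<longrightarrow> s1 a = s a"
    have ready1: "ready s1" by (rule ready_frame[OF s(2)]) (use fr in auto)
    let ?G = "\<lambda>e. box (e div n) (e mod n) = u"
    obtain s2 where s2: "run s1 ?sum s2" "s2 11 0 = (\<Sum>e<m * n. if ?G e then ?F e else 0)"
      "\<forall>a. a \<noteq> 10 \<longrightarrow> a \<noteq> 11 \<longrightarrow> s2 a = s1 a"
    proof (rule run_Sum_loop[where s = s1 and N = "m * n" and u = 5 and v = 10 and acc = 11
          and g = "Eq (Read 23 (Reg 10)) (Reg 8)" and f = "Read 22 (Reg 10)" and G = ?G and F = ?F])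
      fix l assume l: "l \<le> m * n"
      show "rat_size (\<Sum>e<l. if ?G e then ?F e else 0) \<le> B"
      proof (rule size_sum(1)[where c = "of_nat m"])
        fix e assume "e < l"
        then have "0 < n" using l by (cases n) auto
        then have "e mod n < n" by simp
        then show "?F e * of_int Q \<in> \<int> \<and> 0 \<le> ?F e \<and> ?F e \<le> of_nat m"
          using flow_size(3,4) flow_nonneg by simp
      next
        have "of_nat l * of_nat m \<le> (of_nat (m * n) * of_nat m :: rat)"
          using l by (intro mult_right_mono of_nat_mono) auto
        then show "of_nat l * of_nat m \<le> M" using M_mass(1) by simp
      qed simp
    qed (use s1 ready_reg[OF ready1] b_bounds e fr reg8 in auto)
    have "(\<Sum>e<m * n. if ?G e then ?F e else 0) = (\<Sum>i<m. \<Sum>j<n. if box i j = u then flow c i j else 0)"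
      by (rule sum_div_mod)
    also have "\<dots> = (\<Sum>j<n. weight c j u)" unfolding weight_def by (rule sum.swap)
    finally have acc: "s2 11 0 = (\<Sum>j<n. weight c j u)" using s2(2) by simp
    let ?s3 = "s2(24 := (s2 24)(u := \<Sum>j<n. weight c j u))"
    have "run s2 (Write 24 (Reg 8) (Reg 11)) ?s3"
      using run_sem[OF run_bounded[OF s2(1)], of "Write 24 (Reg 8) (Reg 11)"] acc s2(3) reg8
        boundedD[OF run_bounded[OF s2(1)], of 11 0] by simp
    then have "run s1 ?body ?s3" by (rule run_Seq[OF s2(1)])
    moreover have "?I (Suc u) (?s3(8 := (?s3 8)(0 := of_nat (Suc u))))"
      using I s2(3) by (auto simp: less_Suc_eq)
    ultimately show "\<exists>s2. run s1 ?body s2 \<and> ?I (Suc u) (s2(8 := (s2 8)(0 := of_nat (Suc u))))" by blast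
  qed (use s ready_reg[OF s(2)] b_bounds in auto)
  then show ?thesis using that[of s'] by (auto simp: capacity_com_def)
qed

end

context rounding
begin

section \<open>Auction and output\<close>

definition edges_stored :: "(nat \<Rightarrow> nat) \<Rightarrow> memory \<Rightarrow> bool" where
  "edges_stored c s \<longleftrightarrow>
     (\<forall>e<m * n. s 22 e = flow c (e div n) (e mod n) \<and> s 23 e = of_nat (box (e div n) (e mod n))) \<and>
     (\<forall>b<m * Suc n. s 24 b = (\<Sum>j<n. weight c j b))"

lemma edges_storedD:
  assumes "edges_stored c s" "i < m" "j < n"
  shows "s 22 (i * n + j) = flow c i j" "s 23 (i * n + j) = of_nat (box i j)"
  using assms index_less[OF assms(2,3)] index_div_mod[OF assms(3), of i] by (auto simp: edges_stored_def)

lemma edges_stored_frame: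
  "edges_stored c s \<Longrightarrow> (\<And>a. a \<in> {22, 23, 24} \<Longrightarrow> s' a = s a) \<Longrightarrow> edges_stored c s'"
  by (simp add: edges_stored_def)

definition auction_stored :: "(nat \<Rightarrow> nat) \<Rightarrow> (nat \<Rightarrow> nat) \<Rightarrow> (nat \<Rightarrow> nat) \<Rightarrow> memory \<Rightarrow> bool" where
  "auction_stored H p P s \<longleftrightarrow>
     (\<forall>j<n. s 25 j = of_nat (H j) \<and> s 26 j = of_nat (p j)) \<and> (\<forall>b<m * Suc n. s 27 b = of_nat (P b))"

lemma auction_stored_frame:
  "auction_stored H p P s \<Longrightarrow> (\<And>a. a \<in> {25, 26, 27} \<Longrightarrow> s' a = s a) \<Longrightarrow> auction_stored H p P s'"
  by (simp add: auction_stored_def)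

lemma run_bid:
  assumes s: "bounded s" "ready s" and edges: "edges_stored c s" and c: "cluster_inv m c"
    and st: "auction_stored H p P s" and j: "s 18 0 = of_nat j" "j < n" "H j = 0"
    and inv: "box_assignment.auction_inv n (m * Suc n) (weight c) (\<epsilon> / 3) H p P"
  obtains s' H' p' P' where "run s bid_com s'" "auction_stored H' p' P' s'"
    "box_assignment.auction_inv n (m * Suc n) (weight c) (\<epsilon> / 3) H' p' P'"
    "box_assignment.potential n (m * Suc n) p P < box_assignment.potential n (m * Suc n) p' P'"
proof -
  interpret ba: box_assignment n "m * Suc n" "weight c" "\<epsilon> / 3" by (rule box_assignment[OF c])
  let ?g = "Less (Const 0) (At2 22 (Reg 10) (Reg 3) (Reg 18))"
  let ?f = "Read 27 (At2 23 (Reg 10) (Reg 3) (Reg 18))"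
  have size_P: "rat_size (of_nat (P b)) \<le> B" if "b < m * Suc n" for b
    using inv that b_bounds unfolding ba.auction_inv_def by (intro rat_size_of_nat) (meson order_trans)
  obtain s1 i where s1: "run s (Arg_min_loop 12 13 10 2 ?g ?f) s1" "s1 12 0 = of_nat i"
    "i < m \<and> 0 < flow c i j \<and> (\<forall>k<m. 0 < flow c k j \<longrightarrow> (of_nat (P (box i j)) :: rat) \<le> of_nat (P (box k j))) \<or>
      i = m \<and> (\<forall>k<m. \<not> 0 < flow c k j)"
    "\<forall>a. a \<noteq> 10 \<longrightarrow> a \<noteq> 12 \<longrightarrow> a \<noteq> 13 \<longrightarrow> s1 a = s a"
  proof (rule run_Arg_min_loop[where s = s and N = m and u = 2 and v = 10 and acc = 12 and val = 13
        and g = ?g and f = ?f and G = "\<lambda>k. 0 < flow c k j" and F = "\<lambda>k. of_nat (P (box k j))"])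
    fix k s2
    assume k: "k < m" "s2 10 0 = of_nat k" and fr: "\<forall>a. a \<noteq> 10 \<longrightarrow> a \<noteq> 12 \<longrightarrow> a \<noteq> 13 \<longrightarrow> s2 a = s a"
    have regs: "s2 3 0 = of_nat n" "s2 18 0 = of_nat j" using fr ready_reg[OF s(2)] j by auto
    have "aval (At2 22 (Reg 10) (Reg 3) (Reg 18)) s2 = s2 22 (k * n + j)"
      "aval (At2 23 (Reg 10) (Reg 3) (Reg 18)) s2 = s2 23 (k * n + j)"
      using k regs by (auto intro!: aval_At2)
    moreover have "s2 22 = s 22" "s2 23 = s 23" "s2 27 = s 27" using fr by auto
    ultimately show "(bval ?g s2 \<longleftrightarrow> 0 < flow c k j) \<and> aval ?f s2 = of_nat (P (box k j))"
      using edges_storedD[OF edges k(1) j(2)] st box_less[OF k(1), of j] by (simp add: auction_stored_def)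
  qed (use s ready_reg[OF s(2)] b_bounds size_P box_less in auto)
  have "\<exists>k<m. 0 < flow c k j"
  proof (rule ccontr)
    assume "\<not> ?thesis"
    then have "(\<Sum>k<m. flow c k j) \<le> 0" by (intro sum_nonpos) (fastforce simp: not_less)
    then show False using flow_total[OF c j(2)] \<epsilon>_pos by simp
  qed
  then have i: "i < m" "0 < flow c i j"
    and min: "\<And>k. k < m \<Longrightarrow> 0 < flow c k j \<Longrightarrow> P (box i j) \<le> P (box k j)"
    using s1(3) by auto
  define b' where "b' = box i j"
  have b: "b' < m * Suc n" "0 < weight c j b'"
    using box_less[OF i(1), of j] weight_box[OF i(1)] i(2) by (auto simp: b'_def)
  \<comment> \<open>A box of positive weight is the box of \<open>j\<close> at some centre, so the
    minimum over the centres is the minimum over all usable boxes.\<close>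
  have cheap: "P b' \<le> P b''" if "b'' < m * Suc n" "0 < weight c j b''" for b''
    using weight_pos[OF j(2) that(2)] min unfolding b'_def by metis
  note ctx = inv j(2,3) b cheap
  have P_le: "P b' \<le> m * Suc n" by (rule ba.cheapest_price_le[OF ctx])
  have ready1: "ready s1" by (rule ready_frame[OF s(2)]) (use s1 in auto)
  have fr1: "s1 a = s a" if "a \<notin> {10, 12, 13}" for a using s1(4) that by simp
  have bd1: "bounded s1" by (rule run_bounded[OF s1(1)])
  have at: "aval (At2 23 (Reg 12) (Reg 3) (Reg 18)) s1 = of_nat b'"
  proof -
    have "aval (At2 23 (Reg 12) (Reg 3) (Reg 18)) s1 = s1 23 (i * n + j)"
      using s1(2) ready_reg[OF ready1] fr1 j by (intro aval_At2) auto
    then show ?thesis using edges_storedD[OF edges i(1) j(2)] fr1 by (simp add: b'_def)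
  qed
  let ?s2 = "s1(15 := (s1 15)(0 := of_nat b'))"
  have s2: "run s1 (Assign 15 (At2 23 (Reg 12) (Reg 3) (Reg 18))) ?s2"
    using run_sem[OF bd1, of "Assign 15 (At2 23 (Reg 12) (Reg 3) (Reg 18))"] at b(1) b_bounds
      rat_size_of_nat[of b'] by simp
  have ready2: "ready ?s2" by (rule ready_frame[OF ready1]) auto
  have st2: "auction_stored H p P ?s2" by (rule auction_stored_frame[OF st]) (use fr1 in auto)
  let ?sum = "Sum_loop 11 10 3 (Eq (Read 25 (Reg 10)) (Plus (Reg 15) (Const 1))) (Const 1)"
  have count: "(\<Sum>v<l. if H v = Suc b' then 1 else 0) = (of_nat (card {v. v < l \<and> H v = Suc b'}) :: rat)" for l
  proof -
    have "(\<Sum>v<l. if H v = Suc b' then 1 else 0) = (\<Sum>v\<in>{v \<in> {..<l}. H v = Suc b'}. 1 :: rat)"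
      by (simp only: sum.inter_filter[OF finite_lessThan])
    then show ?thesis by simp
  qed
  obtain s3 where s3: "run ?s2 ?sum s3" "s3 11 0 = (\<Sum>v<n. if H v = Suc b' then 1 else 0)"
    "\<forall>a. a \<noteq> 10 \<longrightarrow> a \<noteq> 11 \<longrightarrow> s3 a = ?s2 a"
  proof (rule run_Sum_loop[where s = ?s2 and N = n and u = 3 and v = 10 and acc = 11
        and g = "Eq (Read 25 (Reg 10)) (Plus (Reg 15) (Const 1))" and f = "Const 1"
        and G = "\<lambda>v. H v = Suc b'" and F = "\<lambda>_. 1"])
    fix l assume "l \<le> n"
    moreover have "card {v. v < l \<and> H v = Suc b'} \<le> l"
      using card_mono[of "{..<l}" "{v. v < l \<and> H v = Suc b'}"] by auto
    ultimately show "rat_size (\<Sum>v<l. if H v = Suc b' then 1 else 0) \<le> B"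
      unfolding count using b_bounds by (intro rat_size_of_nat) simp
  qed (use run_bounded[OF s2] ready_reg[OF ready2] b_bounds st2 in \<open>auto simp: auction_stored_def\<close>)
  have acc: "s3 11 0 = of_nat (ba.occupancy H b')" unfolding s3(2) count ba.occupancy_def ..
  have ready3: "ready s3" by (rule ready_frame[OF ready2]) (use s3(3) in auto)
  have bd3: "bounded s3" by (rule run_bounded[OF s3(1)])
  have reg3: "s3 15 0 = of_nat b'" "s3 18 0 = of_nat j" using s3(3) fr1 j by auto
  have st3: "auction_stored H p P s3" by (rule auction_stored_frame[OF st2]) (use s3(3) in auto)
  have cap3: "s3 24 b' = ba.capacity b'"
    using edges b(1) s3(3) fr1 by (simp add: edges_stored_def ba.capacity_def)
  let ?room = "Less (Times (Reg 11) (Divide eps_exp (Const 3))) (Read 24 (Reg 15))"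
  let ?take = "Seq (Write 25 (Reg 18) (Plus (Reg 15) (Const 1)))
             (Write 26 (Reg 18) (Plus (Read 27 (Reg 15)) (Const 1)))"
  let ?find = "Find_loop 16 10 3 (Conj (Eq (Read 25 (Reg 10)) (Plus (Reg 15) (Const 1)))
                                   (Eq (Read 26 (Reg 10)) (Read 27 (Reg 15))))"
  let ?drop = "Seq (Write 25 (Reg 16) (Const 0)) (Write 26 (Reg 16) (Const 0))"
  let ?raise = "Write 27 (Reg 15) (Plus (Read 27 (Reg 15)) (Const 1))"
  let ?rest = "Cond ?room ?take (Seq ?find (Cond (Less (Reg 16) (Reg 3)) (Seq ?drop ?take) ?raise))"
  have room: "bval ?room s3 \<longleftrightarrow> of_nat (ba.occupancy H b') * (\<epsilon> / 3) < ba.capacity b'"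
    using acc reg3 cap3 ready_reg[OF ready3] by simp
  have sizes: "rat_size (of_nat b' + 1) \<le> B" "rat_size (of_nat (P b') + 1) \<le> B" "rat_size 0 \<le> B"
    using b(1) P_le b_bounds rat_size_of_nat[of 0] by (auto intro!: rat_size_Suc)
  \<comment> \<open>Stated for arbitrary \<open>H'\<close> and \<open>p'\<close>, since it is
    applied both to the current assignment and to the one left by an eviction.\<close>
  have take: "\<exists>s5. run s4 ?take s5 \<and> auction_stored (H'(j := Suc b')) (p'(j := Suc (P b'))) P s5"
    if "bounded s4" "s4 15 0 = of_nat b'" "s4 18 0 = of_nat j" "auction_stored H' p' P s4" for s4 H' p'
  proof -
    have "s4 27 b' = of_nat (P b')" using that(4) b(1) by (simp add: auction_stored_def)
    then have "run s4 ?take (s4(25 := (s4 25)(j := of_nat b' + 1), 26 := (s4 26)(j := of_nat (P b') + 1)))"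
      using run_sem[OF that(1), of ?take] that(2,3) sizes by simp
    moreover have "auction_stored (H'(j := Suc b')) (p'(j := Suc (P b'))) P
        (s4(25 := (s4 25)(j := of_nat b' + 1), 26 := (s4 26)(j := of_nat (P b') + 1)))"
      using that(4) by (auto simp: auction_stored_def)
    ultimately show ?thesis by blast
  qed
  have "\<exists>s' H' p' P'. run s3 ?rest s' \<and> auction_stored H' p' P' s' \<and> ba.auction_inv H' p' P' \<and>
      ba.potential p P < ba.potential p' P'"
  proof (cases "bval ?room s3")
    case True
    obtain s4 where s4: "run s3 ?take s4" "auction_stored (H(j := Suc b')) (p(j := Suc (P b'))) P s4"
      using take[OF bd3 reg3 st3] by blast
    have "run s3 ?rest s4" using True s4(1) by (intro run_Cond[OF bd3]) auto
    then show ?thesis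
      using s4(2) ba.auction_assign[OF ctx] True room by blast
  next
    case False
    obtain s4 v where s4: "run s3 ?find s4" "s4 16 0 = of_nat v"
      "v < n \<and> (H v = Suc b' \<and> p v = P b') \<or> v = n \<and> (\<forall>k<n. \<not> (H k = Suc b' \<and> p k = P b'))"
      "\<forall>a. a \<noteq> 10 \<longrightarrow> a \<noteq> 16 \<longrightarrow> s4 a = s3 a"
    proof (rule run_Find_loop[where s = s3 and N = n and u = 3 and v = 10 and acc = 16
          and g = "Conj (Eq (Read 25 (Reg 10)) (Plus (Reg 15) (Const 1)))
                     (Eq (Read 26 (Reg 10)) (Read 27 (Reg 15)))"
          and G = "\<lambda>k. H k = Suc b' \<and> p k = P b'"])
    qed (use bd3 ready_reg[OF ready3] b_bounds st3 reg3 b(1) in \<open>auto simp: auction_stored_def\<close>)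
    have bd4: "bounded s4" by (rule run_bounded[OF s4(1)])
    have reg4: "s4 15 0 = of_nat b'" "s4 18 0 = of_nat j" "s4 3 0 = of_nat n"
      using s4(4) reg3 ready_reg[OF ready3] by auto
    have st4: "auction_stored H p P s4" by (rule auction_stored_frame[OF st3]) (use s4(4) in auto)
    have test: "bval (Less (Reg 16) (Reg 3)) s4 \<longleftrightarrow> v < n" using reg4 s4(2) by simp
    have full: "\<not> of_nat (ba.occupancy H b') * (\<epsilon> / 3) < ba.capacity b'" using False room by blast
    show ?thesis
    proof (cases "v < n")
      case True
      then have v: "v < n" "H v = Suc b'" "p v = P b'" using s4(3) by auto
      let ?s5 = "s4(25 := (s4 25)(v := 0), 26 := (s4 26)(v := 0))"
      have s5: "run s4 ?drop ?s5" using run_sem[OF bd4, of ?drop] s4(2) sizes by simp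
      have "auction_stored (H(v := 0)) (p(v := 0)) P ?s5" using st4 by (auto simp: auction_stored_def)
      then obtain s6 where s6: "run ?s5 ?take s6"
        "auction_stored (H(v := 0, j := Suc b')) (p(v := 0, j := Suc (P b'))) P s6"
        using take[OF run_bounded[OF s5], of "H(v := 0)" "p(v := 0)"] reg4 by auto
      have "run s3 ?rest s6"
        using False test True run_Seq[OF s5 s6(1)] by (intro run_Cond[OF bd3] run_Seq[OF s4(1)] run_Cond[OF bd4]) auto
      then show ?thesis using s6(2) ba.auction_evict[OF ctx v] by blast
    next
      case none: False
      let ?s5 = "s4(27 := (s4 27)(b' := of_nat (P b') + 1))"
      have "s4 27 b' = of_nat (P b')" using st4 b(1) by (simp add: auction_stored_def)
      then have s5: "run s4 ?raise ?s5" using run_sem[OF bd4, of ?raise] reg4 sizes by simp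
      have "run s3 ?rest ?s5"
        using False test none s5 by (intro run_Cond[OF bd3] run_Seq[OF s4(1)] run_Cond[OF bd4]) auto
      moreover have "auction_stored H p (P(b' := Suc (P b'))) ?s5"
        using st4 by (auto simp: auction_stored_def)
      moreover have "p k \<noteq> P b'" if "k < n" "H k = Suc b'" for k using s4(3) none that by auto
      note ba.auction_raise[OF ctx full this]
      ultimately show ?thesis by blast
    qed
  qed
  then obtain s' H' p' P' where "run s3 ?rest s'" and res: "auction_stored H' p' P' s'" "ba.auction_inv H' p' P'"
      "ba.potential p P < ba.potential p' P'" by blast
  then have "run s bid_com s'"
    unfolding bid_com_def by (intro run_Seq[OF s1(1)] run_Seq[OF s2] run_Seq[OF s3(1)])
  then show ?thesis using that res by blast
qed

text \<open>Every bid increases the potential, which is at most \<open>(n + G) (G + 1)\<close> for \<open>G\<close> boxes; after one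
  more round all clients are assigned.\<close>

lemma run_auction:
  assumes s: "bounded s" "ready s" and edges: "edges_stored c s" and c: "cluster_inv m c"
    and zero: "\<forall>i. s 25 i = 0 \<and> s 26 i = 0 \<and> s 27 i = 0"
  obtains s' H p P where "run s auction_com s'" "\<forall>j<n. s' 25 j = of_nat (H j) \<and> H j \<noteq> 0"
    "box_assignment.auction_inv n (m * Suc n) (weight c) (\<epsilon> / 3) H p P"
    "\<forall>a. a \<notin> {8, 10, 11, 12, 13, 15, 16, 18, 25, 26, 27} \<longrightarrow> s' a = s a"
proof -
  interpret ba: box_assignment n "m * Suc n" "weight c" "\<epsilon> / 3" by (rule box_assignment[OF c])
  let ?N = "(n + m * Suc n) * Suc (m * Suc n) + 1"
  let ?find = "Find_loop 18 10 3 (Less (Read 25 (Reg 10)) (Const 1))"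
  let ?cond = "Cond (Less (Reg 18) (Reg 3)) bid_com Skip"
  \<comment> \<open>A round either makes a bid, which raises the potential, or finds all clients
    placed, after which further rounds leave the auction unchanged.\<close>
  let ?I = "\<lambda>t s1. \<exists>H p P. auction_stored H p P s1 \<and> ba.auction_inv H p P \<and>
    (t \<le> ba.potential p P \<or> (\<forall>j<n. H j \<noteq> 0))"
  obtain s' where s': "run s (For 8 7 (Seq ?find ?cond)) s'" "?I ?N s'"
    "\<forall>a. a \<notin> insert 8 (mods (Seq ?find ?cond)) \<longrightarrow> s' a = s a"
  proof (rule run_For[where I = ?I and s = s and N = ?N and v = 8 and u = 7 and c = "Seq ?find ?cond"])
    show "?I 0 (s(8 := (s 8)(0 := 0)))"
      using zero ba.auction_inv_start
      by (intro exI[of _ "\<lambda>_. 0"]) (simp add: auction_stored_def)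
  next
    fix t s1
    assume I: "?I t s1" and s1: "bounded s1"
      and fr: "\<forall>a. a \<notin> insert 8 (mods (Seq ?find ?cond)) \<longrightarrow> s1 a = s a"
    have ready1: "ready s1" by (rule ready_frame[OF s(2)]) (use fr in auto)
    have edges1: "edges_stored c s1" by (rule edges_stored_frame[OF edges]) (use fr in auto)
    obtain H p P where st: "auction_stored H p P s1" and inv: "ba.auction_inv H p P"
      and pot: "t \<le> ba.potential p P \<or> (\<forall>j<n. H j \<noteq> 0)" using I by blast
    obtain s2 j where s2: "run s1 ?find s2" "s2 18 0 = of_nat j"
      "j < n \<and> H j = 0 \<or> j = n \<and> (\<forall>k<n. H k \<noteq> 0)" "\<forall>a. a \<noteq> 10 \<longrightarrow> a \<noteq> 18 \<longrightarrow> s2 a = s1 a"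
    proof (rule run_Find_loop[where s = s1 and N = n and u = 3 and v = 10 and acc = 18
          and g = "Less (Read 25 (Reg 10)) (Const 1)" and G = "\<lambda>k. H k = 0"])
    qed (use s1 ready_reg[OF ready1] b_bounds st in \<open>auto simp: auction_stored_def\<close>)
    have bd2: "bounded s2" by (rule run_bounded[OF s2(1)])
    have ready2: "ready s2" by (rule ready_frame[OF ready1]) (use s2(4) in auto)
    have edges2: "edges_stored c s2" by (rule edges_stored_frame[OF edges1]) (use s2(4) in auto)
    have st2: "auction_stored H p P s2" by (rule auction_stored_frame[OF st]) (use s2(4) in auto)
    have test: "bval (Less (Reg 18) (Reg 3)) s2 \<longleftrightarrow> j < n" using s2(2) ready_reg[OF ready2] by simp
    have "\<exists>s3. run s2 ?cond s3 \<and> ?I (Suc t) s3"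
    proof (cases "j < n")
      case True
      then have j: "j < n" "H j = 0" using s2(3) by auto
      obtain s3 H' p' P' where s3: "run s2 bid_com s3" "auction_stored H' p' P' s3"
        "ba.auction_inv H' p' P'" "ba.potential p P < ba.potential p' P'"
        by (rule run_bid[OF bd2 ready2 edges2 c st2 s2(2) j inv])
      have "Suc t \<le> ba.potential p' P'" using pot j s3(4) by auto
      moreover have "run s2 ?cond s3" using test True s3(1) by (intro run_Cond[OF bd2]) auto
      ultimately show ?thesis using s3 by blast
    next
      case False
      have "run s2 Skip s2" using run_sem[OF bd2, of Skip] by simp
      then have "run s2 ?cond s2" using test False by (intro run_Cond[OF bd2]) auto
      then show ?thesis using st2 inv s2(3) False by blast
    qed
    then obtain s3 where s3: "run s2 ?cond s3" "?I (Suc t) s3" by blast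
    have "?I (Suc t) (s3(8 := (s3 8)(0 := of_nat (Suc t))))"
      using s3(2) by (simp add: auction_stored_def)
    then show "\<exists>s2. run s1 (Seq ?find ?cond) s2 \<and> ?I (Suc t) (s2(8 := (s2 8)(0 := of_nat (Suc t))))"
      using run_Seq[OF s2(1) s3(1)] by blast
  qed (use s ready_reg[OF s(2)] b_ge in auto)
  obtain H p P where HpP: "auction_stored H p P s'" "ba.auction_inv H p P"
    "?N \<le> ba.potential p P \<or> (\<forall>j<n. H j \<noteq> 0)" using s'(2) by blast
  then have "\<forall>j<n. H j \<noteq> 0" using ba.potential_le[OF HpP(2)] by (metis Suc_eq_plus1 not_less_eq_eq)
  then show ?thesis
    using that[of s' H p P] s'(1,3) HpP by (auto simp: auction_com_def auction_stored_def)
qed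

lemma run_output:
  assumes s: "bounded s" "ready s" and edges: "edges_stored c s"
    and H: "\<forall>j<n. s 25 j = of_nat (H j)" and zero: "\<forall>i. s 1 i = 0"
  obtains s' where "run s output_com s'"
    "\<forall>i<m. s' 1 i = (if \<exists>j<n. H j = Suc (box i j) then 1 else 0)"
    "\<forall>i<m. \<forall>j<n. s' 1 (m + (i * n + j)) = (if H j = Suc (box i j) then 1 else 0)"
proof -
  define A where "A e \<longleftrightarrow> H (e mod n) = Suc (box (e div n) (e mod n))" for e
  \<comment> \<open>The contents of the output array after \<open>K\<close> pairs in row-major
    order: openings in the first \<open>m\<close> cells, assignments behind them. A facility opens
    as soon as a client is placed at it.\<close>
  define out where "out K u = (if u < m then if \<exists>e<K. e div n = u \<and> A e then 1 else 0
    else if u - m < K \<and> A (u - m) then 1 else (0::rat))" for K u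
  let ?g = "Eq (Read 25 (Reg 9)) (Plus (At2 23 (Reg 8) (Reg 3) (Reg 9)) (Const 1))"
  let ?body = "Cond ?g (Seq (Write 1 (Reg 8) (Const 1))
          (Write 1 (Plus (Reg 2) (Plus (Times (Reg 8) (Reg 3)) (Reg 9))) (Const 1))) Skip"
  let ?I = "\<lambda>K s1. \<forall>u. s1 1 u = out K u"
  obtain s' where s': "run s (For 8 2 (For 9 3 ?body)) s'" "?I (m * n) s'"
    "\<forall>a. a \<notin> insert 8 (mods (For 9 3 ?body)) \<longrightarrow> s' a = s a"
  proof (rule run_For[where I = "\<lambda>i. ?I (i * n)" and s = s and N = m and v = 8 and u = 2 and c = "For 9 3 ?body"])
    fix i s1
    assume i: "i < m" and I: "?I (i * n) s1" and reg8: "s1 8 0 = of_nat i" and s1: "bounded s1"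
      and fr: "\<forall>a. a \<notin> insert 8 (mods (For 9 3 ?body)) \<longrightarrow> s1 a = s a"
    have ready1: "ready s1" by (rule ready_frame[OF s(2)]) (use fr in auto)
    obtain s2 where s2: "run s1 (For 9 3 ?body) s2" "?I (i * n + n) s2"
      "\<forall>a. a \<notin> insert 9 (mods ?body) \<longrightarrow> s2 a = s1 a"
    proof (rule run_For[where I = "\<lambda>j. ?I (i * n + j)" and s = s1 and N = n and v = 9 and u = 3 and c = ?body])
      fix j s3
      assume j: "j < n" and J: "?I (i * n + j) s3" and reg9: "s3 9 0 = of_nat j" and s3: "bounded s3"
        and fr3: "\<forall>a. a \<notin> insert 9 (mods ?body) \<longrightarrow> s3 a = s1 a"
      have ready3: "ready s3" by (rule ready_frame[OF ready1]) (use fr3 in auto)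
      have edges3: "edges_stored c s3" by (rule edges_stored_frame[OF edges]) (use fr fr3 in auto)
      have reg8': "s3 8 0 = of_nat i" "s3 25 j = of_nat (H j)" using fr fr3 reg8 H j by auto
      have div: "(i * n + j) div n = i" "(i * n + j) mod n = j" using index_div_mod[OF j] by auto
      have "aval (At2 23 (Reg 8) (Reg 3) (Reg 9)) s3 = s3 23 (i * n + j)"
        using reg8' reg9 ready_reg[OF ready3] by (intro aval_At2) auto
      then have test: "bval ?g s3 \<longleftrightarrow> A (i * n + j)"
        using edges_storedD[OF edges3 i j] reg8' reg9 div by (simp add: A_def)
      have "rat_size 1 \<le> B" using rat_size_of_nat[of 1] i b_bounds by simp
      then have run: "run s3 ?body (sem ?body s3)"
        by (intro run_sem[OF s3]) simp
      have "sem ?body s3 1 u = out (Suc (i * n + j)) u" for u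
      proof (cases "A (i * n + j)")
        case True
        then have "sem ?body s3 = s3(1 := (s3 1)(i := 1, m + (i * n + j) := 1))"
          using test reg8' reg9 ready_reg[OF ready3] by (simp only: sem.simps if_True) simp
        then show ?thesis using J True div i by (auto simp: out_def less_Suc_eq)
      next
        case False
        then have "sem ?body s3 = s3" using test by (simp only: sem.simps if_False)
        then show ?thesis using J False by (auto simp: out_def less_Suc_eq)
      qed
      then show "\<exists>s4. run s3 ?body s4 \<and> ?I (i * n + Suc j) (s4(9 := (s4 9)(0 := of_nat (Suc j))))"
        using run by (intro exI[of _ "sem ?body s3"]) simp
    qed (use s1 ready_reg[OF ready1] b_bounds I in auto)
    then show "\<exists>s2. run s1 (For 9 3 ?body) s2 \<and> ?I (Suc i * n) (s2(8 := (s2 8)(0 := of_nat (Suc i))))"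
      by (intro exI[of _ s2]) (simp add: add.commute)
  qed (use s ready_reg[OF s(2)] b_bounds zero in \<open>auto simp: out_def\<close>)
  have "(\<exists>e<m * n. e div n = i \<and> A e) \<longleftrightarrow> (\<exists>j<n. H j = Suc (box i j))" if i: "i < m" for i
  proof
    assume "\<exists>e<m * n. e div n = i \<and> A e"
    then obtain e where e: "e < m * n" "e div n = i" "A e" by blast
    then have "0 < n" by (cases n) auto
    then show "\<exists>j<n. H j = Suc (box i j)" using e by (intro exI[of _ "e mod n"]) (auto simp: A_def)
  next
    assume "\<exists>j<n. H j = Suc (box i j)"
    then obtain j where j: "j < n" "H j = Suc (box i j)" by blast
    then show "\<exists>e<m * n. e div n = i \<and> A e"
      using index_less[OF i j(1)] index_div_mod[OF j(1), of i] by (intro exI[of _ "i * n + j"]) (simp add: A_def)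
  qed
  moreover have "s' 1 (m + (i * n + j)) = (if H j = Suc (box i j) then 1 else 0)" if "i < m" "j < n" for i j
    using s'(2) index_less[OF that] index_div_mod[OF that(2), of i] by (simp add: out_def A_def)
  ultimately show ?thesis using that[of s'] s'(1,2) by (simp add: output_com_def out_def)
qed

lemma run_rounding:
  assumes s: "bounded s" "loaded s" and zero: "\<forall>a i. a \<noteq> 0 \<longrightarrow> s a i = 0"
  obtains s' c H p P where "run s rounding_com s'" "cluster_inv m c"
    "box_assignment.auction_inv n (m * Suc n) (weight c) (\<epsilon> / 3) H p P" "\<forall>j<n. H j \<noteq> 0"
    "\<forall>i<m. s' 1 i = (if \<exists>j<n. H j = Suc (box i j) then 1 else 0)"
    "\<forall>i<m. \<forall>j<n. s' 1 (m + (i * n + j)) = (if H j = Suc (box i j) then 1 else 0)"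
proof -
  obtain s1 where s1: "run s setup_com s1" "ready s1" "\<forall>a. 7 < a \<or> a = 1 \<longrightarrow> s1 a = s a"
    by (rule run_setup[OF s])
  have zero1: "\<forall>i. s1 a i = 0" if "7 < a \<or> a = 1" for a using s1(3) zero that by auto
  obtain s2 where s2: "run s1 radius_com s2" "\<forall>i<m. s2 20 i = radius i"
    "\<forall>a. a \<notin> {8, 9, 10, 11, 20} \<longrightarrow> s2 a = s1 a"
    by (rule run_radius[OF run_bounded[OF s1(1)] s1(2)]) (use zero1 in auto)
  have ready2: "ready s2" by (rule ready_frame[OF s1(2)]) (use s2 in auto)
  obtain s3 c where s3: "run s2 cluster_com s3" "\<forall>i<m. s3 21 i = of_nat (c i)" and c: "cluster_inv m c"
    and s3_fr: "\<forall>a. a \<notin> {8, 9, 10, 11, 12, 13, 14, 21} \<longrightarrow> s3 a = s2 a"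
    by (rule run_cluster[OF run_bounded[OF s2(1)] ready2 s2(2)]) (use zero1 s2(3) in auto)
  have ready3: "ready s3" by (rule ready_frame[OF ready2]) (use s3_fr in auto)
  obtain s4 where s4: "run s3 edge_com s4"
    "\<forall>e<m * n. s4 22 e = flow c (e div n) (e mod n) \<and> s4 23 e = of_nat (box (e div n) (e mod n))"
    "\<forall>a. a \<notin> {8, 9, 10, 11, 16, 17, 22, 23} \<longrightarrow> s4 a = s3 a"
    by (rule run_edge[OF run_bounded[OF s3(1)] ready3 _ s3(2)]) (use s2(2) s3_fr in auto)
  have ready4: "ready s4" by (rule ready_frame[OF ready3]) (use s4 in auto)
  obtain s5 where s5: "run s4 capacity_com s5" "\<forall>b<m * Suc n. s5 24 b = (\<Sum>j<n. weight c j b)"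
    "\<forall>a. a \<notin> {8, 10, 11, 24} \<longrightarrow> s5 a = s4 a"
    by (rule run_capacity[OF run_bounded[OF s4(1)] ready4 s4(2)])
  have ready5: "ready s5" by (rule ready_frame[OF ready4]) (use s5 in auto)
  have edges5: "edges_stored c s5" using s4(2) s5(2,3) by (simp add: edges_stored_def)
  have zero5: "\<forall>i. s5 a i = 0" if "a \<in> {1, 25, 26, 27}" for a
    using zero1[of a] s2(3) s3_fr s4(3) s5(3) that by auto
  obtain s6 H p P where s6: "run s5 auction_com s6" "\<forall>j<n. s6 25 j = of_nat (H j) \<and> H j \<noteq> 0"
    "box_assignment.auction_inv n (m * Suc n) (weight c) (\<epsilon> / 3) H p P"
    "\<forall>a. a \<notin> {8, 10, 11, 12, 13, 15, 16, 18, 25, 26, 27} \<longrightarrow> s6 a = s5 a"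
    by (rule run_auction[OF run_bounded[OF s5(1)] ready5 edges5 c]) (use zero5 in auto)
  have ready6: "ready s6" by (rule ready_frame[OF ready5]) (use s6 in auto)
  have edges6: "edges_stored c s6" by (rule edges_stored_frame[OF edges5]) (use s6 in auto)
  obtain s7 where s7: "run s6 output_com s7"
    "\<forall>i<m. s7 1 i = (if \<exists>j<n. H j = Suc (box i j) then 1 else 0)"
    "\<forall>i<m. \<forall>j<n. s7 1 (m + (i * n + j)) = (if H j = Suc (box i j) then 1 else 0)"
    by (rule run_output[OF run_bounded[OF s6(1)] ready6 edges6, of H]) (use s6 zero5 in auto)
  have "run s rounding_com s7"
    unfolding rounding_com_def
    by (intro run_Seq[OF s1(1)] run_Seq[OF s2(1)] run_Seq[OF s3(1)] run_Seq[OF s4(1)] run_Seq[OF s5(1)]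
        run_Seq[OF s6(1)] s7(1))
  then show ?thesis using that[OF _ c s6(3)] s6(2) s7(2,3) by blast
qed

end

section \<open>Instances and their encoding\<close>

context star_lp
begin

text \<open>A box determines its centre, so \<open>H j = Suc (box i j)\<close> can be read as the
  assignment of \<open>j\<close> to \<open>i\<close>. Only boxes of positive weight are used, and
  positive flow leads only to centres of clusters; hence the bound on the centres limits the open
  facilities.\<close>

lemma assignment_correct:
  assumes c: "cluster_inv m c" and all: "\<forall>j<n. H j \<noteq> 0"
    and inv: "box_assignment.auction_inv n (m * Suc n) (weight c) (\<epsilon> / 3) H p P"
  shows assigned_once: "j < n \<Longrightarrow> (\<Sum>i<m. if H j = Suc (box i j) then 1 else 0) = (1 :: rat)"
    and opened_le: "(\<Sum>i<m. if \<exists>j<n. H j = Suc (box i j) then 1 else 0) \<le> (1 + \<epsilon>) * k"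
    and assigned_load_le: "i < m \<Longrightarrow>
      (\<Sum>j<n. if H j = Suc (box i j) then d i (m + j) else 0) \<le> 135 * T / \<epsilon>\<^sup>2"
proof -
  interpret ba: box_assignment n "m * Suc n" "weight c" "\<epsilon> / 3" by (rule box_assignment[OF c])
  have pos: "0 < weight c j b" if "j < n" "H j = Suc b" for j b
    using inv that unfolding ba.auction_inv_def by blast
  have flow: "0 < flow c i j" if h: "j < n" "H j = Suc (box i j)" for i j
  proof -
    obtain s where s: "s < m" "box i j = box s j" "0 < flow c s j"
      using weight_pos[OF h(1) pos[OF h]] .
    then show ?thesis by (simp add: box_eq_iff)
  qed
  show "(\<Sum>i<m. if H j = Suc (box i j) then 1 else 0) = (1 :: rat)" if j: "j < n"
  proof -
    obtain b where b: "H j = Suc b" using all j not0_implies_Suc by blast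
    obtain s where s: "s < m" "b = box s j" using weight_pos[OF j pos[OF j b]] .
    have "(\<Sum>i<m. if H j = Suc (box i j) then 1 else 0) = (\<Sum>i<m. if i = s then 1 else (0 :: rat))"
      by (intro sum.cong) (auto simp: b s box_eq_iff)
    then show ?thesis using s by simp
  qed
  show "(\<Sum>i<m. if \<exists>j<n. H j = Suc (box i j) then 1 else 0) \<le> (1 + \<epsilon>) * k"
  proof (cases "n = 0")
    \<comment> \<open>Without clients nothing is opened, and balls of the required mass need not
      exist.\<close>
    case True
    then show ?thesis using k_pos \<epsilon>_pos by simp
  next
    case False
    have "(\<Sum>i<m. if \<exists>j<n. H j = Suc (box i j) then 1 else 0) =
        (\<Sum>i\<in>{i \<in> {..<m}. \<exists>j<n. H j = Suc (box i j)}. 1 :: rat)"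
      by (simp only: sum.inter_filter[OF finite_lessThan])
    also have "\<dots> = of_nat (card {i \<in> {..<m}. \<exists>j<n. H j = Suc (box i j)})" by simp
    also have "\<dots> \<le> of_nat (card {s. s < m \<and> c s = Suc s})"
      using flow_pos(2)[OF c] flow by (intro of_nat_mono card_mono) auto
    also have "\<dots> \<le> (1 + \<epsilon>) * k" using card_centres[OF c] False by simp
    finally show ?thesis .
  qed
  show "(\<Sum>j<n. if H j = Suc (box i j) then d i (m + j) else 0) \<le> 135 * T / \<epsilon>\<^sup>2" if "i < m"
  proof (rule assigned_load[OF c that])
    show "of_nat (card {j. j < n \<and> H j = Suc b}) * (\<epsilon> / 3) < (\<Sum>j<n. weight c j b) + \<epsilon> / 3"
      if "b < m * Suc n" for b
      using inv that unfolding ba.auction_inv_def ba.occupancy_def ba.capacity_def by blast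
  qed (use flow in auto)
qed

end

definition common_denominator :: "rat list \<Rightarrow> int" where
  "common_denominator rs = (\<Prod>r\<leftarrow>rs. snd (quotient_of r))"

lemma common_denominator_pos: "0 < common_denominator rs"
  by (induction rs) (auto simp: common_denominator_def quotient_of_denom_pos')

text \<open>The plain product of denominators is small enough: its logarithm is at most the sum of
  their bit lengths, which \<open>input_size\<close> counts.\<close>

lemma common_denominator_less: "common_denominator rs < 2 ^ Suc (input_size rs)"
proof -
  have "common_denominator rs \<le> 2 ^ input_size rs"
  proof (induction rs)
    case (Cons r rs)
    obtain p q where pq: "quotient_of r = (p, q)" by force
    have "q < 2 ^ nat (bitlen q)" by (rule less_power_nat_bitlen)
    also have "(2 :: int) ^ nat (bitlen q) \<le> 2 ^ rat_size r"
      using pq by (intro power_increasing) (auto simp: rat_size_def)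
    finally have "snd (quotient_of r) \<le> 2 ^ rat_size r" using pq by simp
    then show ?case
      using Cons common_denominator_pos[of rs] quotient_of_denom_pos'[of r]
      by (simp add: common_denominator_def input_size_def power_add mult_mono)
  qed (simp add: common_denominator_def input_size_def)
  also have "(2 :: int) ^ input_size rs < 2 ^ Suc (input_size rs)" by (rule power_strict_increasing) auto
  finally show ?thesis .
qed

lemma common_denominator_Ints:
  assumes "r \<in> set rs"
  shows "r * of_int (common_denominator rs) \<in> \<int>"
proof -
  obtain p q where pq: "quotient_of r = (p, q)" by force
  then have r: "r = of_int p / of_int q" "q > 0"
    using quotient_of_div quotient_of_denom_pos by auto
  have "q dvd common_denominator rs"
    using assms pq unfolding common_denominator_def
    by (induction rs) (auto intro: dvd_mult)
  then obtain u where "common_denominator rs = q * u" by blast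
  then have "r * of_int (common_denominator rs) = of_int (p * u)" using r by simp
  then show ?thesis by (simp only: Ints_of_int)
qed

lemma abs_le_power_rat_size: "\<bar>r\<bar> \<le> 2 ^ rat_size r"
proof -
  obtain p q where r: "r = of_int p / of_int q" "0 < q"
    "rat_size r = 1 + nat (bitlen \<bar>p\<bar>) + nat (bitlen q)" by (rule rat_size_cases)
  have "\<bar>r\<bar> = of_int \<bar>p\<bar> / of_int q" using r by simp
  also have "\<dots> \<le> of_int \<bar>p\<bar> / 1" using r(2) by (intro divide_left_mono) auto
  also have "\<dots> \<le> of_int (2 ^ nat (bitlen \<bar>p\<bar>))"
    using less_power_nat_bitlen[of "\<bar>p\<bar>"] by (simp only: of_int_le_iff div_by_1)
  also have "\<dots> = 2 ^ nat (bitlen \<bar>p\<bar>)" by simp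
  also have "\<dots> \<le> 2 ^ rat_size r" using r(3) by (intro power_increasing) auto
  finally show ?thesis .
qed

lemma rat_size_le_input_size: "r \<in> set rs \<Longrightarrow> rat_size r \<le> input_size rs"
  unfolding input_size_def by (intro member_le_sum_list) auto

lemma length_le_input_size: "length rs \<le> input_size rs"
proof (induction rs)
  case (Cons r rs)
  then show ?case using rat_size_ge_2[of r] by (simp add: input_size_def)
qed (simp add: input_size_def)

text \<open>Over the common denominator the numerator is at most \<open>2 ^ (4 N + 1)\<close> for
  input size \<open>N\<close>, hence has at most \<open>4 N + 2\<close> bits. The denominator adds
  \<open>N + 1\<close> bits, and the encoding one more.\<close>

lemma rat_size_bound:
  assumes r: "r * of_int (common_denominator rs) \<in> \<int>" "\<bar>r\<bar> \<le> 2 ^ (3 * input_size rs)"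
  shows "rat_size r \<le> 5 * input_size rs + 4"
proof -
  let ?Q = "common_denominator rs" and ?N = "input_size rs"
  obtain z where z: "r * of_int ?Q = of_int z" using r(1) Ints_cases by metis
  have Q: "0 < ?Q" "?Q < 2 ^ Suc ?N" by (rule common_denominator_pos common_denominator_less)+
  have "of_int \<bar>z\<bar> = \<bar>r\<bar> * of_int ?Q" using Q z by (simp flip: z add: abs_mult)
  also have "\<dots> \<le> 2 ^ (3 * ?N) * of_int (2 ^ Suc ?N)"
  proof (rule mult_mono)
    show "of_int ?Q \<le> (of_int (2 ^ Suc ?N) :: rat)" using Q(2) by (simp only: of_int_le_iff)
    show "0 \<le> (of_int ?Q :: rat)" using Q(1) by simp
  qed (use r(2) in auto)
  also have "\<dots> = of_int (2 ^ (4 * ?N + 1))" by (simp add: power_add[symmetric])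
  finally have "\<bar>z\<bar> \<le> 2 ^ (4 * ?N + 1)" by (simp only: of_int_le_iff)
  also have "\<dots> < 2 ^ (4 * ?N + 2)" by (rule power_strict_increasing) auto
  finally have "nat (bitlen \<bar>z\<bar>) \<le> 4 * ?N + 2" "nat (bitlen \<bar>?Q\<bar>) \<le> ?N + 1"
    using Q by (simp_all add: nat_bitlen_le_iff)
  moreover have "rat_size r \<le> 1 + nat (bitlen \<bar>z\<bar>) + nat (bitlen \<bar>?Q\<bar>)"
    using z Q(1) by (intro rat_size_quotient) (auto simp: field_simps)
  ultimately show ?thesis by simp
qed

lemma rat_size_nat_bound:
  assumes "k \<le> (N + 1) ^ 4"
  shows "rat_size (of_nat k) \<le> 5 * N + 4"
proof -
  have "N + 1 \<le> 2 ^ N" using of_nat_less_two_power[of N] by (simp add: Suc_le_eq less_exp)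
  then have "(N + 1) ^ 4 \<le> (2 ^ N) ^ 4" by (rule power_mono) simp
  then have "k \<le> 2 ^ (4 * N)" using assms by (simp add: power_mult[symmetric] mult.commute)
  then have "\<bar>int k\<bar> \<le> 2 ^ (4 * N)" by simp
  also have "\<dots> < 2 ^ (4 * N + 1)" by (rule power_strict_increasing) auto
  finally have "\<bar>int k\<bar> < 2 ^ (4 * N + 1)" .
  then have "nat (bitlen \<bar>int k\<bar>) \<le> 4 * N + 1" by (simp only: nat_bitlen_le_iff)
  moreover have "nat (bitlen \<bar>1\<bar>) \<le> 1" by (simp add: nat_bitlen_le_iff)
  moreover have "rat_size (of_nat k) \<le> 1 + nat (bitlen \<bar>int k\<bar>) + nat (bitlen \<bar>1\<bar>)"
    by (rule rat_size_quotient) auto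
  ultimately show ?thesis by simp
qed

section \<open>Positions in the encoded lists\<close>

lemma length_product_list: "length [f p q. p \<leftarrow> ps, q \<leftarrow> qs] = length ps * length qs"
  by (induction ps) auto

lemma nth_product_list:
  assumes "i < length ps" "j < length qs"
  shows "[f p q. p \<leftarrow> ps, q \<leftarrow> qs] ! (i * length qs + j) = f (ps ! i) (qs ! j)"
  using assms
proof (induction ps arbitrary: i)
  case (Cons p ps)
  show ?case
  proof (cases i)
    case 0
    then show ?thesis using Cons.prems by (simp add: nth_append)
  next
    case (Suc l)
    then show ?thesis using Cons.prems Cons.IH[of l] by (simp add: nth_append algebra_simps)
  qed
qed simp

lemma sum_nth:
  assumes "distinct xs"
  shows "(\<Sum>a\<in>set xs. f a) = (\<Sum>i<length xs. f (xs ! i))"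
  using sum.reindex_bij_betw[OF bij_betw_nth[OF assms refl refl], of f] by simp

lemma instance_data_nth:
  fixes fs cs :: "'p list"
  assumes inp: "map real_of_rat inp = instance_data fs cs d T k x y \<epsilon>"
  defines "m \<equiv> length fs" and "n \<equiv> length cs"
  shows "length inp = 5 + ((m + n) * (m + n) + (m + m * n))"
    and "inp ! 0 = of_nat m" "inp ! 1 = of_nat n"
    and "real_of_rat (inp ! 2) = T" "real_of_rat (inp ! 3) = k" "real_of_rat (inp ! 4) = \<epsilon>"
    and "p < m + n \<Longrightarrow> q < m + n \<Longrightarrow>
      real_of_rat (inp ! (5 + (p * (m + n) + q))) = d ((fs @ cs) ! p) ((fs @ cs) ! q)"
    and "i < m \<Longrightarrow> real_of_rat (inp ! (5 + ((m + n) * (m + n) + i))) = y (fs ! i)"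
    and "i < m \<Longrightarrow> j < n \<Longrightarrow>
      real_of_rat (inp ! (5 + ((m + n) * (m + n) + (m + (i * n + j))))) = x (fs ! i) (cs ! j)"
proof -
  define Ds where "Ds = [d p q. p \<leftarrow> fs @ cs, q \<leftarrow> fs @ cs]"
  define Xs where "Xs = [x i j. i \<leftarrow> fs, j \<leftarrow> cs]"
  let ?head = "[real m, real n, T, k, \<epsilon>]"
  have data: "map real_of_rat inp = ?head @ (Ds @ (map y fs @ Xs))"
    using inp by (simp add: instance_data_def solution_data_def m_def n_def Ds_def Xs_def)
  have D: "length Ds = (m + n) * (m + n)"
    unfolding Ds_def using length_product_list[where f = d and ps = "fs @ cs" and qs = "fs @ cs"]
    by (simp only: length_append m_def n_def)
  have X: "length Xs = m * n"
    unfolding Xs_def using length_product_list[where f = x and ps = fs and qs = cs] by (simp only: m_def n_def)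
  have "length (map real_of_rat inp) = 5 + (length Ds + (m + length Xs))" unfolding data by (simp add: m_def)
  then show len: "length inp = 5 + ((m + n) * (m + n) + (m + m * n))" unfolding D X by simp
  have get: "real_of_rat (inp ! u) = (?head @ (Ds @ (map y fs @ Xs))) ! u" if "u < length inp" for u
    using that unfolding data[symmetric] by simp
  have "real_of_rat (inp ! 0) = real_of_rat (of_nat m)" "real_of_rat (inp ! 1) = real_of_rat (of_nat n)"
    using get[of 0] get[of 1] len by simp_all
  then show "inp ! 0 = of_nat m" "inp ! 1 = of_nat n" by (simp_all only: of_rat_eq_iff)
  show "real_of_rat (inp ! 2) = T" "real_of_rat (inp ! 3) = k" "real_of_rat (inp ! 4) = \<epsilon>"
    using get[of 2] get[of 3] get[of 4] len by simp_all
  have tail: "real_of_rat (inp ! (5 + u)) = (Ds @ (map y fs @ Xs)) ! u"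
    if "u < (m + n) * (m + n) + (m + m * n)" for u
  proof -
    have "length ?head = 5" by simp
    then show ?thesis
      using get[of "5 + u"] that len nth_append_length_plus[of ?head "Ds @ (map y fs @ Xs)" u]
      by (metis nat_add_left_cancel_less)
  qed
  show "real_of_rat (inp ! (5 + (p * (m + n) + q))) = d ((fs @ cs) ! p) ((fs @ cs) ! q)"
    if pq: "p < m + n" "q < m + n"
  proof -
    have lt: "p * (m + n) + q < (m + n) * (m + n)" by (rule index_less[OF pq])
    have "Ds ! (p * (m + n) + q) = d ((fs @ cs) ! p) ((fs @ cs) ! q)"
      using nth_product_list[of p "fs @ cs" q "fs @ cs" d] pq
      by (simp only: Ds_def length_append m_def n_def)
    then show ?thesis using tail[of "p * (m + n) + q"] lt D by (simp add: nth_append)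
  qed
  have sol: "real_of_rat (inp ! (5 + ((m + n) * (m + n) + u))) = (map y fs @ Xs) ! u" if "u < m + m * n" for u
    using tail[of "(m + n) * (m + n) + u"] that nth_append_length_plus[of Ds "map y fs @ Xs" u]
    unfolding D by simp
  show "real_of_rat (inp ! (5 + ((m + n) * (m + n) + i))) = y (fs ! i)" if "i < m"
    using sol[of i] that by (simp add: nth_append m_def)
  show "real_of_rat (inp ! (5 + ((m + n) * (m + n) + (m + (i * n + j))))) = x (fs ! i) (cs ! j)"
    if ij: "i < m" "j < n"
  proof -
    have "Xs ! (i * n + j) = x (fs ! i) (cs ! j)"
      using nth_product_list[of i fs j cs x] ij by (simp only: Xs_def m_def n_def)
    then show ?thesis
      using sol[of "m + (i * n + j)"] index_less[OF ij] nth_append_length_plus[of "map y fs" Xs "i * n + j"]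
      by (simp add: m_def)
  qed
qed

section \<open>Transfer between real instances and the program\<close>

lemma rounding_com_correct:
  fixes F C :: "nat set"
  assumes fs: "distinct fs" "set fs = F" and cs: "distinct cs" "set cs = C"
    and metric: "Metric_space (F \<union> C) d" and T: "T > 0" and k: "k > 0" and \<epsilon>: "0 < \<epsilon>" "\<epsilon> < 1"
    and lp: "(xstar, ystar) \<in> SC_LP F C d T k"
    and inp: "map real_of_rat inp = instance_data fs cs d T k xstar ystar \<epsilon>"
  shows "\<exists>out x y.
    runs_in_time rounding_com inp (com_factor ((input_size inp + 1) ^ 4) rounding_com * (5 * input_size inp + 4))
      (length fs + length fs * length cs) out \<and>
    map real_of_rat out = solution_data fs cs x y \<and>
    integral_solution F C x y \<and> approximate_solution F C d T k (135 / \<epsilon>\<^sup>2) (1 + \<epsilon>) x y"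
proof -
  define m where "m = length fs"
  define n where "n = length cs"
  define N where "N = input_size inp"
  define dq where "dq p q = inp ! (5 + (p * (m + n) + q))" for p q
  define yq where "yq i = inp ! (5 + ((m + n) * (m + n) + i))" for i
  define xq where "xq i j = inp ! (5 + ((m + n) * (m + n) + (m + (i * n + j))))" for i j
  note nth = instance_data_nth[OF inp, folded m_def n_def]
  have fs_F: "fs ! i \<in> F" if "i < m" for i using that fs(2) by (auto simp: m_def)
  have cs_C: "cs ! j \<in> C" if "j < n" for j using that cs(2) by (auto simp: n_def)
  have D: "real_of_rat (dq p q) = d ((fs @ cs) ! p) ((fs @ cs) ! q)" if "p < m + n" "q < m + n" for p q
    using nth(7)[OF that] by (simp add: dq_def)
  have Dc: "real_of_rat (dq i (m + j)) = d (fs ! i) (cs ! j)" if "i < m" "j < n" for i j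
    using D[of i "m + j"] that by (simp add: nth_append m_def)
  have Y: "real_of_rat (yq i) = ystar (fs ! i)" if "i < m" for i using nth(8)[OF that] by (simp add: yq_def)
  have X: "real_of_rat (xq i j) = xstar (fs ! i) (cs ! j)" if "i < m" "j < n" for i j
    using nth(9)[OF that] by (simp add: xq_def)
  have pts: "(fs @ cs) ! p \<in> F \<union> C" if "p < m + n" for p
    using nth_mem[of p "fs @ cs"] that fs(2) cs(2) by (auto simp: m_def n_def)
  interpret Metric_space "F \<union> C" d by (rule metric)
  have sum_F: "(\<Sum>i\<in>F. f i) = (\<Sum>i<m. f (fs ! i))" for f :: "nat \<Rightarrow> real"
    using sum_nth[OF fs(1), of f] by (simp add: fs(2) m_def)
  have sum_C: "(\<Sum>j\<in>C. f j) = (\<Sum>j<n. f (cs ! j))" for f :: "nat \<Rightarrow> real"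
    using sum_nth[OF cs(1), of f] by (simp add: cs(2) n_def)
  have lp_load: "\<And>i. i \<in> F \<Longrightarrow> (\<Sum>j\<in>C. d i j * xstar i j) \<le> T * ystar i"
    and lp_k: "(\<Sum>i\<in>F. ystar i) \<le> k"
    and lp_x: "\<And>j. j \<in> C \<Longrightarrow> (\<Sum>i\<in>F. xstar i j) = 1"
    and lp_xy: "\<And>i j. i \<in> F \<Longrightarrow> j \<in> C \<Longrightarrow> xstar i j \<le> ystar i"
    and lp_y01: "\<And>i. i \<in> F \<Longrightarrow> 0 \<le> ystar i \<and> ystar i \<le> 1"
    and lp_x0: "\<And>i j. i \<in> F \<Longrightarrow> j \<in> C \<Longrightarrow> 0 \<le> xstar i j"
    and lp_far: "\<And>i j. i \<in> F \<Longrightarrow> j \<in> C \<Longrightarrow> T < d i j \<Longrightarrow> xstar i j = 0"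
    using lp unfolding SC_LP_def fractional_assignment_def by auto
  \<comment> \<open>Each constraint is transferred by applying \<open>of_rat\<close> to both sides,
    which preserves and reflects equality and order.\<close>
  have lp': "star_lp m n dq xq yq (inp ! 2) (inp ! 3) (inp ! 4)"
  proof
    fix p q assume pq: "p < m + n" "q < m + n"
    have "0 \<le> real_of_rat (dq p q)" "real_of_rat (dq p q) = real_of_rat (dq q p)"
      using D pq by (simp_all add: commute)
    then show "0 \<le> dq p q" "dq p q = dq q p" by simp_all
  next
    fix p assume p: "p < m + n"
    have "real_of_rat (dq p p) = 0" using D[OF p p] pts[OF p] by simp
    then show "dq p p = 0" by simp
  next
    fix p q r assume pqr: "p < m + n" "q < m + n" "r < m + n"
    have "real_of_rat (dq p r) \<le> real_of_rat (dq p q + dq q r)"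
      using triangle[OF pts pts pts] pqr by (simp add: of_rat_add D)
    then show "dq p r \<le> dq p q + dq q r" by (simp only: of_rat_less_eq)
  next
    show "0 < inp ! 2" "0 < inp ! 3" "0 < inp ! 4"
      using T k \<epsilon>(1) unfolding nth(4-6)[symmetric] by simp_all
    have "real_of_rat (inp ! 4) < real_of_rat 1" using \<epsilon>(2) nth(6) by simp
    then show "inp ! 4 < 1" by (simp only: of_rat_less)
  next
    fix i assume i: "i < m"
    have "real_of_rat (\<Sum>j<n. dq i (m + j) * xq i j) \<le> real_of_rat (inp ! 2 * yq i)"
      using lp_load[OF fs_F[OF i]] nth(4) by (simp add: of_rat_sum of_rat_mult Dc X Y i sum_C)
    then show "(\<Sum>j<n. dq i (m + j) * xq i j) \<le> inp ! 2 * yq i" by (simp only: of_rat_less_eq)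
    have "real_of_rat 0 \<le> real_of_rat (yq i)" "real_of_rat (yq i) \<le> real_of_rat 1"
      using lp_y01[OF fs_F[OF i]] Y[OF i] by simp_all
    then show "0 \<le> yq i" "yq i \<le> 1" by (simp_all only: of_rat_less_eq)
  next
    have "real_of_rat (\<Sum>i<m. yq i) \<le> real_of_rat (inp ! 3)"
      using lp_k nth(5) by (simp add: of_rat_sum Y sum_F)
    then show "(\<Sum>i<m. yq i) \<le> inp ! 3" by (simp only: of_rat_less_eq)
  next
    fix j assume j: "j < n"
    have "real_of_rat (\<Sum>i<m. xq i j) = real_of_rat 1"
      using lp_x[OF cs_C[OF j]] by (simp add: of_rat_sum X j sum_F)
    then show "(\<Sum>i<m. xq i j) = 1" by (simp only: of_rat_eq_iff)
  next
    fix i j assume ij: "i < m" "j < n"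
    have "real_of_rat (xq i j) \<le> real_of_rat (yq i)" "real_of_rat 0 \<le> real_of_rat (xq i j)"
      using lp_xy[OF fs_F[OF ij(1)] cs_C[OF ij(2)]] lp_x0[OF fs_F[OF ij(1)] cs_C[OF ij(2)]] X[OF ij] Y[OF ij(1)]
      by simp_all
    then show "xq i j \<le> yq i" "0 \<le> xq i j" by (simp_all only: of_rat_less_eq)
    assume "inp ! 2 < dq i (m + j)"
    then have "real_of_rat (inp ! 2) < real_of_rat (dq i (m + j))" by (simp only: of_rat_less)
    then have "real_of_rat (xq i j) = 0"
      using lp_far[OF fs_F[OF ij(1)] cs_C[OF ij(2)]] X[OF ij] Dc[OF ij] nth(4) by simp
    then show "xq i j = 0" by simp
  qed
  have N_len: "length inp \<le> N" unfolding N_def by (rule length_le_input_size)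
  \<comment> \<open>The numbers \<open>m\<close> and \<open>n\<close> are written in binary, so
    their own sizes would bound them only exponentially. The distance matrix makes them at most the
    length of the input.\<close>
  have "m + n \<le> (m + n) * (m + n)" by simp
  then have mn_N: "m + n \<le> N" using N_len nth(1) by linarith
  have in_set: "dq p q \<in> set inp" if "p < m + n" "q < m + n" for p q
    using index_less[OF that] nth(1) unfolding dq_def by (intro nth_mem) simp
  have lp'': "rounding m n dq xq yq (inp ! 2) (inp ! 3) (inp ! 4) (5 * N + 4) ((N + 1) ^ 4)
      (common_denominator inp) (2 ^ (3 * N))"
  proof (intro rounding.intro lp' resource_bounds.intro rounding_axioms.intro)
    show "rat_size (of_nat l) \<le> 5 * N + 4" if "l \<le> (N + 1) ^ 4" for l
      by (rule rat_size_nat_bound[OF that])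
    show "rat_size r \<le> 5 * N + 4"
      if "r * of_int (common_denominator inp) \<in> \<int>" "\<bar>r\<bar> \<le> 2 ^ (3 * N)" for r
      using rat_size_bound that unfolding N_def by blast
    show "dq p q * of_int (common_denominator inp) \<in> \<int>" if "p < m + n" "q < m + n" for p q
      by (rule common_denominator_Ints[OF in_set[OF that]])
    show "yq i * of_int (common_denominator inp) \<in> \<int>" if "i < m" for i
      using that nth(1) unfolding yq_def by (intro common_denominator_Ints nth_mem) simp
    show "xq i j * of_int (common_denominator inp) \<in> \<int>" if "i < m" "j < n" for i j
      using index_less[OF that] nth(1) unfolding xq_def by (intro common_denominator_Ints nth_mem) simp
    have pow: "m \<le> 2 ^ N" "n \<le> 2 ^ N" using mn_N less_exp[of N] by linarith+
    then have "m * n * m \<le> 2 ^ N * 2 ^ N * 2 ^ N" by (intro mult_mono) auto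
    also have "\<dots> = 2 ^ (3 * N)" by (simp flip: power_add)
    finally show "of_nat (m * n * m) \<le> (2 ^ (3 * N) :: rat)"
      by (metis of_nat_le_iff of_nat_numeral of_nat_power)
    have "(2 :: nat) ^ N \<le> 2 ^ (3 * N)" by (intro power_increasing) auto
    with pow(1) have "m \<le> 2 ^ (3 * N)" by (rule order_trans)
    then show "of_nat m \<le> (2 ^ (3 * N) :: rat)"
      by (metis of_nat_le_iff of_nat_numeral of_nat_power)
    show "dq p q * 2 ^ n \<le> 2 ^ (3 * N)" if pq: "p < m + n" "q < m + n" for p q
    proof -
      have "dq p q \<le> 2 ^ rat_size (dq p q)" using abs_le_power_rat_size[of "dq p q"] by simp
      also have "\<dots> \<le> 2 ^ N"
        using rat_size_le_input_size[OF in_set[OF pq]] by (intro power_increasing) (auto simp: N_def)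
      finally have "dq p q * 2 ^ n \<le> 2 ^ N * 2 ^ N"
        using mn_N by (intro mult_mono power_increasing) auto
      also have "\<dots> = 2 ^ (2 * N)" by (simp flip: power_add)
      also have "\<dots> \<le> 2 ^ (3 * N)" by (intro power_increasing) auto
      finally show ?thesis .
    qed
    \<comment> \<open>With \<open>m * Suc n \<le> N * (N + 1)\<close> the left side is at most
      \<open>N ^ 4 + 3 * N ^ 3 + 3 * N ^ 2 + 2 * N + 1\<close>, which explains the exponent
      4.\<close>
    show "(n + m * Suc n) * Suc (m * Suc n) + 1 \<le> (N + 1) ^ 4"
    proof -
      have "m * Suc n \<le> N * (N + 1)" using mn_N by (intro mult_mono) auto
      then have "(n + m * Suc n) * Suc (m * Suc n) \<le> (N + N * (N + 1)) * Suc (N * (N + 1))"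
        using mn_N by (intro mult_mono) auto
      moreover have "(N + N * (N + 1)) * Suc (N * (N + 1)) + 1 \<le> (N + 1) ^ 4"
        by (simp add: algebra_simps power4_eq_xxxx)
      ultimately show ?thesis by linarith
    qed
  qed
  interpret rounding m n dq xq yq "inp ! 2" "inp ! 3" "inp ! 4" "5 * N + 4" "(N + 1) ^ 4"
    "common_denominator inp" "2 ^ (3 * N)" by (rule lp'')
  let ?s = "initial_memory inp"
  have "bounded ?s"
    unfolding bounded_def
  proof (intro allI)
    fix a i
    have "rat_size (inp ! i) \<le> N" if "i < length inp"
      unfolding N_def using that by (intro rat_size_le_input_size nth_mem)
    moreover have "rat_size 0 \<le> 5 * N + 4" using rat_size_of_nat[of 0] by simp
    ultimately show "rat_size (?s a i) \<le> 5 * N + 4" by (auto simp: initial_memory_def)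
  qed
  moreover have "loaded ?s"
  proof -
    have idx: "?s 0 u = inp ! u" if "u < 5 + ((m + n) * (m + n) + (m + m * n))" for u
      using that nth(1) by (simp add: initial_memory_def)
    have "?s 0 0 = of_nat m" "?s 0 1 = of_nat n" using idx[of 0] idx[of 1] nth(2,3) by simp_all
    moreover have "?s 0 2 = inp ! 2" "?s 0 4 = inp ! 4" using idx by simp_all
    moreover have "?s 0 (5 + (p * (m + n) + q)) = dq p q" if "p < m + n" "q < m + n" for p q
      using index_less[OF that] unfolding dq_def by (intro idx) simp
    moreover have "?s 0 (5 + ((m + n) * (m + n) + i)) = yq i" if "i < m" for i
      using that unfolding yq_def by (intro idx) simp
    moreover have "?s 0 (5 + ((m + n) * (m + n) + (m + (i * n + j)))) = xq i j" if "i < m" "j < n" for i j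
      using index_less[OF that] unfolding xq_def by (intro idx) simp
    ultimately show ?thesis unfolding loaded_def by blast
  qed
  ultimately obtain s c H p P where run: "run ?s rounding_com s" and c: "cluster_inv m c"
    and auction: "box_assignment.auction_inv n (m * Suc n) (weight c) (inp ! 4 / 3) H p P"
    and all: "\<forall>j<n. H j \<noteq> 0"
    and out_y: "\<forall>i<m. s 1 i = (if \<exists>j<n. H j = Suc (box i j) then 1 else 0)"
    and out_x: "\<forall>i<m. \<forall>j<n. s 1 (m + (i * n + j)) = (if H j = Suc (box i j) then 1 else 0)"
    by (rule run_rounding) (auto simp: initial_memory_def)
  \<comment> \<open>The output is indexed by positions, the solution by points. Distinctness of the
    lists makes \<open>inv_into\<close> recover the position of a point.\<close>
  define x where "x u v = real_of_rat (s 1 (m + (inv_into {..<m} ((!) fs) u * n + inv_into {..<n} ((!) cs) v)))" for u v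
  define y where "y u = real_of_rat (s 1 (inv_into {..<m} ((!) fs) u))" for u
  have inv_fs: "inv_into {..<m} ((!) fs) (fs ! i) = i" if "i < m" for i
    using that fs(1) by (intro inv_into_f_f inj_on_nth) (auto simp: m_def)
  have inv_cs: "inv_into {..<n} ((!) cs) (cs ! j) = j" if "j < n" for j
    using that cs(1) by (intro inv_into_f_f inj_on_nth) (auto simp: n_def)
  have x_eq: "x (fs ! i) (cs ! j) = (if H j = Suc (box i j) then 1 else 0)" if "i < m" "j < n" for i j
    using out_x that by (simp add: x_def inv_fs inv_cs)
  have y_eq: "y (fs ! i) = (if \<exists>j<n. H j = Suc (box i j) then 1 else 0)" if "i < m" for i
    using out_y that by (simp add: y_def inv_fs)
  have F_nth: "\<exists>i<m. u = fs ! i" if "u \<in> F" for u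
    using that fs(2) by (metis in_set_conv_nth m_def)
  have C_nth: "\<exists>j<n. v = cs ! j" if "v \<in> C" for v
    using that cs(2) by (metis in_set_conv_nth n_def)
  have integral: "integral_solution F C x y"
    unfolding integral_solution_def
  proof (intro conjI ballI)
    fix u v assume "u \<in> F" "v \<in> C"
    then obtain i j where "i < m" "u = fs ! i" "j < n" "v = cs ! j" using F_nth C_nth by meson
    then show "x u v \<in> {0, 1}" by (simp add: x_eq)
  next
    fix u assume "u \<in> F"
    then obtain i where "i < m" "u = fs ! i" using F_nth by meson
    then show "y u \<in> {0, 1}" by (simp add: y_eq)
  qed
  have frac: "fractional_assignment F C x y"
    unfolding fractional_assignment_def
  proof (intro conjI ballI)
    fix v assume "v \<in> C"
    then obtain j where j: "j < n" "v = cs ! j" using C_nth by blast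
    have "(\<Sum>i\<in>F. x i v) = real_of_rat (\<Sum>i<m. if H j = Suc (box i j) then 1 else 0)"
      unfolding sum_F of_rat_sum using j by (intro sum.cong) (auto simp: x_eq)
    then show "(\<Sum>i\<in>F. x i v) = 1" using assigned_once[OF c all auction j(1)] by simp
  next
    fix u v assume "u \<in> F" "v \<in> C"
    then obtain i j where ij: "i < m" "u = fs ! i" "j < n" "v = cs ! j" using F_nth C_nth by meson
    show "x u v \<le> y u" "0 \<le> x u v" "x u v \<le> 1" using ij by (auto simp: x_eq y_eq)
  next
    fix u assume "u \<in> F"
    then obtain i where i: "i < m" "u = fs ! i" using F_nth by meson
    show "0 \<le> y u" "y u \<le> 1" using i by (auto simp: y_eq)
  qed
  have "(\<Sum>i\<in>F. y i) = real_of_rat (\<Sum>i<m. if \<exists>j<n. H j = Suc (box i j) then 1 else 0)"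
    unfolding sum_F of_rat_sum by (intro sum.cong) (auto simp: y_eq)
  also have "\<dots> \<le> real_of_rat ((1 + inp ! 4) * inp ! 3)"
    using opened_le[OF c all auction] by (simp only: of_rat_less_eq)
  also have "\<dots> = (1 + \<epsilon>) * k" using nth(5,6) by (simp add: of_rat_mult of_rat_add)
  finally have opened: "(\<Sum>i\<in>F. y i) \<le> (1 + \<epsilon>) * k" .
  have loads: "load C d x u \<le> 135 / \<epsilon>\<^sup>2 * T * y u" if u: "u \<in> F" for u
  proof -
    obtain i where i: "i < m" "u = fs ! i" using F_nth[OF u] by blast
    have load: "load C d x u = real_of_rat (\<Sum>j<n. if H j = Suc (box i j) then dq i (m + j) else 0)"
      unfolding load_def sum_C of_rat_sum using i by (intro sum.cong) (auto simp: x_eq Dc)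
    show ?thesis
    proof (cases "\<exists>j<n. H j = Suc (box i j)")
      case True
      have "load C d x u \<le> real_of_rat (135 * inp ! 2 / (inp ! 4)\<^sup>2)"
        unfolding load using assigned_load_le[OF c all auction i(1)] by (simp only: of_rat_less_eq)
      also have "\<dots> = 135 / \<epsilon>\<^sup>2 * T" using nth(4,6) by (simp add: of_rat_mult of_rat_divide of_rat_power)
      finally show ?thesis using True i by (simp add: y_eq)
    next
      case False
      then have "load C d x u = 0" unfolding load by (auto intro!: sum.neutral)
      moreover have "y u = 0" using False i by (auto simp: y_eq)
      ultimately show ?thesis by simp
    qed
  qed
  define out where "out = map (s 1) [0..<m + m * n]"
  have sol: "map real_of_rat out = solution_data fs cs x y"
  proof (rule nth_equalityI)
    show len: "length (map real_of_rat out) = length (solution_data fs cs x y)"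
      using length_product_list[where f = x and ps = fs and qs = cs] by (simp add: out_def solution_data_def m_def n_def)
    fix u assume "u < length (map real_of_rat out)"
    then have u: "u < m + m * n" by (simp add: out_def)
    show "map real_of_rat out ! u = solution_data fs cs x y ! u"
    proof (cases "u < m")
      case True
      then show ?thesis using u by (simp add: out_def solution_data_def nth_append m_def[symmetric] y_def inv_fs)
    next
      case False
      define e where "e = u - m"
      have e: "u = m + e" "e < m * n" using False u by (auto simp: e_def)
      then have n: "0 < n" by (cases n) auto
      have ij: "e div n < m" "e mod n < n" using e n by (auto simp: less_mult_imp_div_less)
      have "solution_data fs cs x y ! u = [x i j. i \<leftarrow> fs, j \<leftarrow> cs] ! (e div n * n + e mod n)"
        using e(1) by (simp add: solution_data_def nth_append m_def)
      also have "\<dots> = x (fs ! (e div n)) (cs ! (e mod n))"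
        using nth_product_list[of "e div n" fs "e mod n" cs x] ij by (simp only: m_def n_def)
      also have "\<dots> = real_of_rat (s 1 u)" using ij by (simp add: x_def inv_fs inv_cs e(1))
      finally show ?thesis using u by (simp add: out_def)
    qed
  qed
  have "runs_in_time rounding_com inp (com_factor ((N + 1) ^ 4) rounding_com * (5 * N + 4)) (m + m * n) out"
    using run unfolding run_def runs_in_time_def out_def by blast
  then show ?thesis
    using sol integral frac opened loads unfolding approximate_solution_def m_def n_def N_def by blast
qed

theorem theorem3:
  shows "\<exists>(P :: com) (p :: nat poly) (K :: real). K > 0 \<and>
    (\<forall>(F :: nat set) (C :: nat set) fs cs d T k xstar ystar \<epsilon> inp.
       distinct fs \<and> set fs = F \<and> distinct cs \<and> set cs = C \<and>
       Metric_space (F \<union> C) d \<and> T > 0 \<and> k > 0 \<and> 0 < \<epsilon> \<and> \<epsilon> < 1 \<and>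
       (xstar, ystar) \<in> SC_LP F C d T k \<and>
       map real_of_rat inp = instance_data fs cs d T k xstar ystar \<epsilon>
       \<longrightarrow>
       (\<exists>out x y.
          runs_in_time P inp (poly p (input_size inp)) (length fs + length fs * length cs) out \<and>
          map real_of_rat out = solution_data fs cs x y \<and>
          integral_solution F C x y \<and>
          approximate_solution F C d T k (K / \<epsilon>\<^sup>2) (1 + \<epsilon>) x y))"
proof -
  obtain p where p: "\<forall>b. poly p b = com_factor b rounding_com" using com_factor_poly by blast
  \<comment> \<open>Substituting \<open>(N + 1) ^ 4\<close> for the iteration bound and multiplying
    by the size bound \<open>5 * N + 4\<close> gives one polynomial for all inputs.\<close>
  have cost: "poly (pcompose p ([:1, 1:] ^ 4) * [:4, 5:]) N = com_factor ((N + 1) ^ 4) rounding_com * (5 * N + 4)" for N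
    using p by (simp add: poly_pcompose poly_power algebra_simps)
  show ?thesis
  proof (intro exI[of _ rounding_com] exI[of _ "pcompose p ([:1, 1:] ^ 4) * [:4, 5:]"] exI[of _ 135]
      conjI allI impI)
    fix F C :: "nat set" and fs cs d T k xstar ystar \<epsilon> inp
    assume "distinct fs \<and> set fs = F \<and> distinct cs \<and> set cs = C \<and>
       Metric_space (F \<union> C) d \<and> T > 0 \<and> k > 0 \<and> 0 < \<epsilon> \<and> \<epsilon> < 1 \<and>
       (xstar, ystar) \<in> SC_LP F C d T k \<and>
       map real_of_rat inp = instance_data fs cs d T k xstar ystar \<epsilon>"
    then show "\<exists>out x y.
          runs_in_time rounding_com inp (poly (pcompose p ([:1, 1:] ^ 4) * [:4, 5:]) (input_size inp))
            (length fs + length fs * length cs) out \<and>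
          map real_of_rat out = solution_data fs cs x y \<and>
          integral_solution F C x y \<and>
          approximate_solution F C d T k (135 / \<epsilon>\<^sup>2) (1 + \<epsilon>) x y"
      unfolding cost by (elim conjE) (rule rounding_com_correct)
  qed simp
qed

end
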